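(* Let $p\in[1,\infty)$. If $u\in\mathfrak{B}^{\mathcal{L},\beta_0}_{p,p}(\mathbb{G}^{n}_{\alpha})$ for some $\beta_0\in(0,1)$, then $$\lim_{\beta\rightarrow0^{+}}\beta\, N_{p,p}^{\mathcal{L},\beta}(u)^{p}=\frac{4}{p}\|u\|^{p}_{L^{p}(\mathbb{G}^{n}_{\alpha})}.$$
   Context: Setting. Let $m,k\ge 1$ be integers, $n=m+k$, $\alpha\ge 0$. Points of $\mathbb{R}^n=\mathbb{R}^m\times\mathbb{R}^k$ are written $g=(x,y)$. The Grushin space $\mathbb{G}^n_\alpha$ is $\mathbb{R}^n$ with the Carnot-Carathéodory distance of the vector fields $\partial_{x_i}$ ($1\le i\le m$), $|x|^\alpha\partial_{y_j}$ ($1\le j\le k$), and with Lebesgue measure $dg$. $\mathcal{L}=-\Delta_x-|x|^{2\alpha}\Delta_y$ is the Grushin-Laplace operator (a non-negative self-adjoint operator on $L^2$), and $e^{-t\mathcal{L}}u(g)=\int K_t(g,g')u(g')\,dg'$ is its heat semigroup, with symmetric non-negative heat kernel $K_t$. Besov spaces. Write $e^{-t\mathcal{L}}(|u-u(g)|^p)(g)=\int_{\mathbb{G}^n_\alpha} K_t(g,g')|u(g')-u(g)|^p\,dg'$. For $p\in[1,\infty)$, $\beta>0$, $u\in L^p(\mathbb{G}^n_\alpha)$ let $$N_{p,p}^{\mathcal{L},\beta}(u)=\Big(\int_{0}^{\infty}\int_{\mathbb{G}^{n}_{\alpha}}e^{-t\mathcal{L}}(|u-u(g)|^{p})(g)\,dg\,\frac{dt}{t^{\beta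 p/2+1}}\Big)^{1/p}.$$ $B_{p,p}^{\mathcal{L},\beta}(\mathbb{G}^n_\alpha)=\{u\in L^p: N_{p,p}^{\mathcal{L},\beta}(u)<\infty\}$ with norm $\|u\|_{L^p}+N_{p,p}^{\mathcal{L},\beta}(u)$, and $\mathfrak{B}_{p,p}^{\mathcal{L},\beta}(\mathbb{G}^n_\alpha)$ is the closure of $C_c^\infty(\mathbb{G}^n_\alpha)$ (smooth compactly supported functions on $\mathbb{R}^n$) in $B_{p,p}^{\mathcal{L},\beta}(\mathbb{G}^n_\alpha)$ for this norm. *)

theory Defs
  imports "HOL-Analysis.Analysis"
begin

type_synonym ('m, 'k) grushin = "(real ^ 'm) \<times> (real ^ 'k)"

section \<open>Test functions\<close>

primrec continuously_differentiable :: "nat \<Rightarrow> ('a::euclidean_space \<Rightarrow> real) \<Rightarrow> bool" where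
  "continuously_differentiable 0 f \<longleftrightarrow> continuous_on UNIV f"
| "continuously_differentiable (Suc r) f \<longleftrightarrow>
     (\<forall>x. f differentiable (at x)) \<and>
     (\<forall>v. continuously_differentiable r (\<lambda>x. frechet_derivative f (at x) v))"

definition Cc_infty :: "('a::euclidean_space \<Rightarrow> real) set" where
  "Cc_infty = {f. (\<forall>r. continuously_differentiable r f) \<and> compact (closure {x. f x \<noteq> 0})}"

definition partial :: "'a::euclidean_space \<Rightarrow> ('a \<Rightarrow> real) \<Rightarrow> 'a \<Rightarrow> real" where
  "partial v f x = frechet_derivative f (at x) v"

section \<open>Lebesgue spaces\<close>

text \<open>Elements of \<open>L\<^sup>p\<close> are represented by Borel functions; functions that agree almost
  everywhere are not identified.\<close>

definition Lp :: "real \<Rightarrow> ('a::euclidean_space \<Rightarrow> real) set" where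
  "Lp p = {f \<in> borel_measurable lborel. integrable lborel (\<lambda>x. \<bar>f x\<bar> powr p)}"

definition Lp_norm :: "real \<Rightarrow> ('a::euclidean_space \<Rightarrow> real) \<Rightarrow> real" where
  "Lp_norm p f = (LINT x|lborel. \<bar>f x\<bar> powr p) powr (1 / p)"

section \<open>The Grushin operator\<close>

text \<open>The case distinction is needed because \<open>0 powr 0 = 0\<close>.\<close>

definition grushin_weight :: "real \<Rightarrow> real ^ 'm \<Rightarrow> real" where
  "grushin_weight \<alpha> x = (if \<alpha> = 0 then 1 else norm x powr (2 * \<alpha>))"

definition grushin_expr ::
    "real \<Rightarrow> (('m::finite, 'k::finite) grushin \<Rightarrow> real) \<Rightarrow> ('m, 'k) grushin \<Rightarrow> real" where
  "grushin_expr \<alpha> f g =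
     - (\<Sum>i\<in>UNIV. partial (axis i 1, 0) (partial (axis i 1, 0) f) g)
     - grushin_weight \<alpha> (fst g) * (\<Sum>j\<in>UNIV. partial (0, axis j 1) (partial (0, axis j 1) f) g)"

text \<open>The self-adjoint operator \<open>\<L>\<close> is the Friedrichs extension of \<^const>\<open>grushin_expr\<close> on
  \<^const>\<open>Cc_infty\<close>. Its form domain is the completion of \<^const>\<open>Cc_infty\<close> for
  \<open>\<phi> \<mapsto> \<parallel>\<phi>\<parallel>\<^sub>2\<^sup>2 + \<langle>\<phi>, \<L> \<phi>\<rangle>\<close>, realised inside \<open>L\<^sup>2\<close>, and its domain consists of those \<open>u\<close> in the
  form domain for which \<open>\<L> u\<close>, taken in the weak sense, is in \<open>L\<^sup>2\<close>.\<close>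

definition grushin_form_domain :: "real \<Rightarrow> (('m::finite, 'k::finite) grushin \<Rightarrow> real) set" where
  "grushin_form_domain \<alpha> = {u \<in> Lp 2. \<exists>\<phi>. (\<forall>n. \<phi> n \<in> Cc_infty) \<and>
     (\<lambda>n. Lp_norm 2 (\<lambda>g. \<phi> n g - u g)) \<longlonglongrightarrow> 0 \<and>
     (\<forall>\<epsilon>>0. \<exists>N. \<forall>i\<ge>N. \<forall>j\<ge>N.
        (LINT g|lborel. (\<phi> i g - \<phi> j g) * grushin_expr \<alpha> (\<lambda>h. \<phi> i h - \<phi> j h) g) < \<epsilon>)}"

text \<open>\<open>grushin_operator \<alpha> u w\<close> means that \<open>u\<close> is in the domain of \<open>\<L>\<close> and \<open>\<L> u = w\<close>.\<close>

definition grushin_operator ::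
    "real \<Rightarrow> (('m::finite, 'k::finite) grushin \<Rightarrow> real) \<Rightarrow> (('m, 'k) grushin \<Rightarrow> real) \<Rightarrow> bool" where
  "grushin_operator \<alpha> u w \<longleftrightarrow> u \<in> grushin_form_domain \<alpha> \<and> w \<in> Lp 2 \<and>
     (\<forall>\<phi>\<in>Cc_infty. (LINT g|lborel. u g * grushin_expr \<alpha> \<phi> g) = (LINT g|lborel. w g * \<phi> g))"

section \<open>The heat semigroup and the heat kernel\<close>

definition C0_semigroup_L2 :: "(real \<Rightarrow> ('a::euclidean_space \<Rightarrow> real) \<Rightarrow> 'a \<Rightarrow> real) \<Rightarrow> bool" where
  "C0_semigroup_L2 T \<longleftrightarrow>
     (\<forall>t\<ge>0. \<forall>f\<in>Lp 2. T t f \<in> Lp 2) \<and>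
     (\<forall>t\<ge>0. \<forall>f\<in>Lp 2. \<forall>h\<in>Lp 2. \<forall>a b.
        AE x in lborel. T t (\<lambda>z. a * f z + b * h z) x = a * T t f x + b * T t h x) \<and>
     (\<forall>t\<ge>0. \<exists>C. \<forall>f\<in>Lp 2. Lp_norm 2 (T t f) \<le> C * Lp_norm 2 f) \<and>
     (\<forall>f\<in>Lp 2. AE x in lborel. T 0 f x = f x) \<and>
     (\<forall>s\<ge>0. \<forall>t\<ge>0. \<forall>f\<in>Lp 2. AE x in lborel. T (s + t) f x = T s (T t f) x) \<and>
     (\<forall>f\<in>Lp 2. ((\<lambda>t. Lp_norm 2 (\<lambda>x. T t f x - f x)) \<longlongrightarrow> 0) (at_right 0))"

definition generator_L2 :: "(real \<Rightarrow> ('a::euclidean_space \<Rightarrow> real) \<Rightarrow> 'a \<Rightarrow> real) \<Rightarrow>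
    ('a \<Rightarrow> real) \<Rightarrow> ('a \<Rightarrow> real) \<Rightarrow> bool" where
  "generator_L2 T f w \<longleftrightarrow> f \<in> Lp 2 \<and> w \<in> Lp 2 \<and>
     ((\<lambda>t. Lp_norm 2 (\<lambda>x. (T t f x - f x) / t - w x)) \<longlongrightarrow> 0) (at_right 0)"

text \<open>\<open>e\<^bsup>-t\<L>\<^esup>\<close> is the strongly continuous semigroup whose generator is \<open>-\<L>\<close>; this determines it
  up to null sets.\<close>

definition heat_semigroup :: "real \<Rightarrow>
    (real \<Rightarrow> (('m::finite, 'k::finite) grushin \<Rightarrow> real) \<Rightarrow> ('m, 'k) grushin \<Rightarrow> real) \<Rightarrow> bool" where
  "heat_semigroup \<alpha> T \<longleftrightarrow> C0_semigroup_L2 T \<and>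
     (\<forall>f w. generator_L2 T f w \<longleftrightarrow> grushin_operator \<alpha> f (\<lambda>g. - w g))"

text \<open>The heat kernel is determined by \<open>\<alpha>\<close> only up to null sets, so it is described by a predicate.\<close>

definition heat_kernel :: "real \<Rightarrow>
    (real \<Rightarrow> ('m::finite, 'k::finite) grushin \<Rightarrow> ('m, 'k) grushin \<Rightarrow> real) \<Rightarrow> bool" where
  "heat_kernel \<alpha> K \<longleftrightarrow>
     set_borel_measurable borel ({0<..} \<times> UNIV) (\<lambda>(t, g, h). K t g h) \<and>
     (\<forall>t>0. \<forall>g h. 0 \<le> K t g h \<and> K t g h = K t h g) \<and>
     (\<exists>T. heat_semigroup \<alpha> T \<and>
        (\<forall>t>0. \<forall>f\<in>Lp 2. AE g in lborel.
           integrable lborel (\<lambda>h. K t g h * f h) \<and> T t f g = (LINT h|lborel. K t g h * f h)))"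

section \<open>Besov spaces\<close>

text \<open>The seminorm may be infinite, and the library has no real powers of \<^typ>\<open>ennreal\<close>.\<close>

definition powr_ennreal :: "ennreal \<Rightarrow> real \<Rightarrow> ennreal" where
  "powr_ennreal a r = (if a = \<infinity> then \<infinity> else ennreal (enn2real a powr r))"

definition besov_seminorm ::
    "(real \<Rightarrow> 'a \<Rightarrow> 'a \<Rightarrow> real) \<Rightarrow> real \<Rightarrow> real \<Rightarrow> ('a::euclidean_space \<Rightarrow> real) \<Rightarrow> ennreal" where
  "besov_seminorm K p \<beta> u = powr_ennreal
     (\<integral>\<^sup>+t\<in>{0<..}. (\<integral>\<^sup>+g. (\<integral>\<^sup>+h. ennreal (K t g h * \<bar>u h - u g\<bar> powr p) \<partial>lborel) \<partial>lborel)
        / ennreal (t powr (\<beta> * p / 2 + 1)) \<partial>lborel) (1 / p)"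

definition besov_space ::
    "(real \<Rightarrow> 'a \<Rightarrow> 'a \<Rightarrow> real) \<Rightarrow> real \<Rightarrow> real \<Rightarrow> ('a::euclidean_space \<Rightarrow> real) set" where
  "besov_space K p \<beta> = {u \<in> Lp p. besov_seminorm K p \<beta> u < \<infinity>}"

definition besov_norm ::
    "(real \<Rightarrow> 'a \<Rightarrow> 'a \<Rightarrow> real) \<Rightarrow> real \<Rightarrow> real \<Rightarrow> ('a::euclidean_space \<Rightarrow> real) \<Rightarrow> ennreal" where
  "besov_norm K p \<beta> u = ennreal (Lp_norm p u) + besov_seminorm K p \<beta> u"

definition besov_closure ::
    "(real \<Rightarrow> 'a \<Rightarrow> 'a \<Rightarrow> real) \<Rightarrow> real \<Rightarrow> real \<Rightarrow> ('a::euclidean_space \<Rightarrow> real) set" where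
  "besov_closure K p \<beta> = {u \<in> besov_space K p \<beta>.
     \<forall>\<epsilon>>0. \<exists>\<phi>\<in>Cc_infty. besov_norm K p \<beta> (\<lambda>g. u g - \<phi> g) < ennreal \<epsilon>}"

end

theory Submission
  imports Defs
begin

text \<open>Let \<open>F(t)\<close> be the double integral of \<open>K\<^sub>t(g, h) \<bar>u(h) - u(g)\<bar>\<^sup>p\<close>. Only the behaviour of \<open>F\<close> for large \<open>t\<close>
  matters: finiteness of the seminorm at \<open>\<beta>\<^sub>0\<close> makes the contribution of bounded \<open>t\<close> vanish as
  \<open>\<beta> \<rightarrow> 0\<close>, and \<open>F(t) \<rightarrow> 2 \<parallel>u\<parallel>\<^sub>p\<^sup>p\<close> turns the rest into \<open>(2 / p) 2 \<parallel>u\<parallel>\<^sub>p\<^sup>p\<close>.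

  The limit of \<open>F\<close> needs that \<open>K\<^sub>t\<close> preserves mass and that it spreads out, so that the mass it keeps
  within a ball tends to 0. Both follow from one observation: the \<open>x\<^sub>i\<close>-marginal of the heat flow is the
  Euclidean one, that is,
  \<open>\<integral> e\<^bsup>-t\<L>\<^esup>f cos (\<xi> x\<^sub>i) = exp (- t \<xi>\<^sup>2) \<integral> f cos (\<xi> x\<^sub>i)\<close> for \<open>f \<ge> 0\<close>. This is obtained by differentiating in \<open>t\<close> against
  \<open>cos (\<xi> x\<^sub>i) \<chi>\<^sub>R\<close> with cutoffs \<open>\<chi>\<^sub>R\<close> adapted to the Grushin dilations and letting \<open>R \<rightarrow> \<infinity>\<close>.\<close>

section \<open>The space of square-integrable functions\<close>

text \<open>The semigroup is given only through its generator: each \<open>T t\<close> is bounded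
  with a constant that may depend on \<open>t\<close>, and neither a formula nor Gaussian bounds for
  the kernel are at hand. What can be computed is the time derivative of
  \<open>ip (T s f) \<phi>\<close> for a test function \<open>\<phi>\<close>, so all information is
  drawn from this pairing. Symmetry of \<open>T\<close>, read off from the symmetry of
  \<open>K\<close>, moves the operator to the smooth side. The function cos(xi x_i) is constant in
  y, hence an eigenfunction of L with eigenvalue xi^2, but it is not square-integrable and has to be
  cut off. The resulting errors are uniformly of order 1/R and disappear in the limit as soon as the
  L^1 norm of \<open>T s f\<close> is bounded on compact time intervals. This a priori bound is the
  main obstacle, since the semigroup is controlled in L^2 only. Frequency xi = 0 gives conservation
  of mass. The frequencies xi != 0 decay exponentially in time; averaging finitely many of them
  dominates the indicator of a ball and gives the spreading.\<close>

lemma Lp2_iff: "f \<in> Lp 2 \<longleftrightarrow> f \<in> borel_measurable borel \<and> integrable lborel (\<lambda>x. (f x)\<^sup>2)"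
  by (simp add: Lp_def)

lemma Lp2_measurable: "f \<in> Lp 2 \<Longrightarrow> f \<in> borel_measurable borel"
  by (simp add: Lp2_iff)

lemma Lp2_integrable_mult:
  assumes "f \<in> Lp 2" "g \<in> Lp 2"
  shows "integrable lborel (\<lambda>x. f x * g x)"
proof (rule Bochner_Integration.integrable_bound)
  show "integrable lborel (\<lambda>x. (f x)\<^sup>2 + (g x)\<^sup>2)"
    using assms by (auto simp: Lp2_iff)
  show "(\<lambda>x. f x * g x) \<in> borel_measurable lborel"
    using assms by (auto simp: Lp2_iff)
  have "norm (a * b) \<le> norm (a\<^sup>2 + b\<^sup>2)" for a b :: real
  proof -
    have "0 \<le> (\<bar>a\<bar> - \<bar>b\<bar>)\<^sup>2" "0 \<le> \<bar>a\<bar> * \<bar>b\<bar>" by auto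
    then have "\<bar>a\<bar> * \<bar>b\<bar> \<le> a\<^sup>2 + b\<^sup>2" unfolding power2_diff power2_abs by linarith
    then show ?thesis by (simp add: abs_mult)
  qed
  then show "AE x in lborel. norm (f x * g x) \<le> norm ((f x)\<^sup>2 + (g x)\<^sup>2)" by simp
qed

lemma Lp2_lincomb:
  assumes "f \<in> Lp 2" "g \<in> Lp 2"
  shows "(\<lambda>x. a * f x + b * g x) \<in> Lp 2"
proof -
  have "(\<lambda>x. (a * f x + b * g x)\<^sup>2) = (\<lambda>x. a\<^sup>2 * (f x)\<^sup>2 + 2 * a * b * (f x * g x) + b\<^sup>2 * (g x)\<^sup>2)"
    by (auto simp: power2_eq_square algebra_simps)
  moreover have "integrable lborel (\<lambda>x. a\<^sup>2 * (f x)\<^sup>2 + 2 * a * b * (f x * g x) + b\<^sup>2 * (g x)\<^sup>2)"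
    using assms Lp2_integrable_mult[OF assms]
    by (intro Bochner_Integration.integrable_add integrable_mult_right) (auto simp: Lp2_iff)
  ultimately show ?thesis using assms by (auto simp: Lp2_iff)
qed

lemma Lp2_diff: "f \<in> Lp 2 \<Longrightarrow> g \<in> Lp 2 \<Longrightarrow> (\<lambda>x. f x - g x) \<in> Lp 2"
  using Lp2_lincomb[of f g 1 "-1"] by simp

lemma Lp2_cmult: "f \<in> Lp 2 \<Longrightarrow> (\<lambda>x. c * f x) \<in> Lp 2"
  using Lp2_lincomb[of f f c 0] by simp

lemma Lp2_abs: "f \<in> Lp 2 \<Longrightarrow> (\<lambda>x. \<bar>f x\<bar>) \<in> Lp 2"
  by (auto simp: Lp2_iff)

lemma indicator_Lp2:
  assumes "A \<in> sets borel" "emeasure lborel A < \<infinity>"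
  shows "indicator A \<in> Lp 2"
proof -
  have "(\<lambda>x. (indicator A x :: real)\<^sup>2) = indicator A"
    by (auto simp: indicator_def power2_eq_square)
  then show ?thesis using assms integrable_real_indicator[of A lborel] by (simp add: Lp2_iff)
qed

definition ip :: "('a::euclidean_space \<Rightarrow> real) \<Rightarrow> ('a \<Rightarrow> real) \<Rightarrow> real" where
  "ip f g = (LINT x|lborel. f x * g x)"

lemma ip_commute: "ip f g = ip g f"
  by (simp add: ip_def mult.commute)

lemma ip_diff_right:
  "f \<in> Lp 2 \<Longrightarrow> g \<in> Lp 2 \<Longrightarrow> h \<in> Lp 2 \<Longrightarrow> ip f (\<lambda>x. g x - h x) = ip f g - ip f h"
  by (simp add: ip_def right_diff_distrib Lp2_integrable_mult)

lemma ip_cmult_right: "ip f (\<lambda>x. c * g x) = c * ip f g"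
  by (simp add: ip_def mult.left_commute)

lemma ip_cong_AE_right:
  assumes "f \<in> Lp 2" "g \<in> Lp 2" "h \<in> Lp 2" "AE x in lborel. g x = h x"
  shows "ip f g = ip f h"
  unfolding ip_def using assms
  by (intro integral_cong_AE) (auto simp: Lp2_iff)

lemma Lp_norm_2_eq: "Lp_norm 2 f = sqrt (ip f f)"
  by (simp add: Lp_norm_def ip_def powr_half_sqrt power2_eq_square)

lemma ip_self_nonneg: "0 \<le> ip f f"
  by (simp add: ip_def)

lemma Lp_norm_2_nonneg: "0 \<le> Lp_norm 2 f"
  by (simp add: Lp_norm_def)

lemma Cauchy_Schwarz_ip:
  assumes f: "f \<in> Lp 2" and g: "g \<in> Lp 2"
  shows "\<bar>ip f g\<bar> \<le> Lp_norm 2 f * Lp_norm 2 g"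
proof -
  let ?A = "ip f f" and ?B = "ip g g" and ?I = "ip f g"
  have quad: "0 \<le> x\<^sup>2 * ?A + 2 * x * ?I + ?B" for x
  proof -
    have "0 \<le> (LINT z|lborel. (x * f z + g z)\<^sup>2)" by simp
    also have "\<dots> = (LINT z|lborel. x\<^sup>2 * (f z * f z) + 2 * x * (f z * g z) + g z * g z)"
      by (intro Bochner_Integration.integral_cong) (auto simp: power2_eq_square algebra_simps)
    also have "\<dots> = x\<^sup>2 * ?A + 2 * x * ?I + ?B"
      using Lp2_integrable_mult[OF f f] Lp2_integrable_mult[OF f g] Lp2_integrable_mult[OF g g]
      by (simp add: ip_def)
    finally show ?thesis .
  qed
  have "?I\<^sup>2 \<le> ?A * ?B"
  proof (cases "?A = 0")
    case True
    \<comment> \<open>With A = 0 the quadratic is linear in x; at this x it takes the value -1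
      unless I vanishes.\<close>
    then have "?I = 0"
      using quad[of "- (?B + 1) / (2 * ?I)"] by (cases "?I = 0") (auto simp: field_simps)
    then show ?thesis using True by simp
  next
    case False
    then have A: "?A > 0" using ip_self_nonneg[of f] by simp
    \<comment> \<open>The quadratic is evaluated at its minimiser -I/A.\<close>
    have "0 \<le> ?A * ((- ?I / ?A)\<^sup>2 * ?A + 2 * (- ?I / ?A) * ?I + ?B)"
      using A quad[of "- ?I / ?A"] by simp
    also have "\<dots> = ?A * ?B - ?I\<^sup>2"
      using A by (simp add: field_simps power2_eq_square)
    finally show ?thesis by simp
  qed
  then have "sqrt (?I\<^sup>2) \<le> sqrt (?A * ?B)" by (rule real_sqrt_le_mono)
  then show ?thesis by (simp add: Lp_norm_2_eq real_sqrt_mult)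
qed

section \<open>Symmetric semigroups\<close>

text \<open>A right-continuous function that is midpoint log-convex is bounded on compact intervals:
  if it exceeded both end values, it would first do so at some \<open>i\<close>, and from there on the
  increments over a suitable step would have to grow.\<close>

lemma midpoint_log_convex_bounded:
  fixes P :: "real \<Rightarrow> real"
  assumes nonneg: "\<And>s. 0 \<le> s \<Longrightarrow> 0 \<le> P s"
    and rc: "\<And>s. 0 \<le> s \<Longrightarrow> (P \<longlongrightarrow> P s) (at_right s)"
    and mid: "\<And>a b. 0 \<le> a \<Longrightarrow> 0 \<le> b \<Longrightarrow> (P ((a + b) / 2))\<^sup>2 \<le> P a * P b"
    and x: "0 \<le> x" "x \<le> S"
  shows "P x \<le> max (P 0) (P S)"
proof (rule ccontr)
  let ?M = "max (P 0) (P S)"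
  assume "\<not> ?thesis"
  then obtain m where m: "?M < m" "m < P x" using dense by (metis not_le)
  define A where "A = {s. 0 \<le> s \<and> s \<le> S \<and> m \<le> P s}"
  define i where "i = Inf A"
  have xA: "x \<in> A" using x m by (auto simp: A_def)
  have bb: "bdd_below A" by (rule bdd_belowI[of _ 0]) (auto simp: A_def)
  have i0: "0 \<le> i" unfolding i_def using xA by (intro cInf_greatest) (auto simp: A_def)
  have iS: "i \<le> S" using cInf_lower[OF xA bb] x by (simp add: i_def)
  \<comment> \<open>Right-continuity makes the infimum attained: if P were below m at i, it would
    stay below m just to the right of i, where A has points.\<close>
  have mi: "m \<le> P i"
  proof (rule ccontr)
    assume "\<not> m \<le> P i"
    then have "\<forall>\<^sub>F s in at_right i. P s < m"
      using rc[OF i0] by (intro order_tendstoD) auto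
    then obtain b where b: "b > i" "\<And>s. i < s \<Longrightarrow> s < b \<Longrightarrow> P s < m"
      by (auto simp: eventually_at_right_field)
    obtain s where "s \<in> A" "s < b"
      using cInf_lessD[of A b] xA b(1) by (auto simp: i_def)
    moreover have "i \<le> s" using cInf_lower[OF \<open>s \<in> A\<close> bb] by (simp add: i_def)
    ultimately show False
      using b(2)[of s] \<open>\<not> m \<le> P i\<close> by (cases "s = i") (auto simp: A_def)
  qed
  have "i \<noteq> 0" "i \<noteq> S" using mi m by auto
  then have i: "0 < i" "i < S" using i0 iS by auto
  \<comment> \<open>The step d = (S - i)/k divides the interval exactly, so k steps lead from i to
    S; k is large enough for d < i, so that i - d is still in the domain of P.\<close>
  obtain k :: nat where k: "(S - i) / i < real k" using reals_Archimedean2 by blast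
  have kpos: "real k > 0" using k i by (smt (verit) divide_pos_pos)
  define d where "d = (S - i) / real k"
  have d: "0 < d" "d < i" using k kpos i by (auto simp: d_def field_simps)
  have low: "P (i - d) < m"
  proof (rule ccontr)
    assume "\<not> ?thesis"
    then have "i - d \<in> A" using d i by (auto simp: A_def)
    from cInf_lower[OF this bb] d show False by (simp add: i_def)
  qed
  have step: "P (i + (real j - 1) * d) < P (i + real j * d) \<and> m \<le> P (i + real j * d)" for j
  proof (induction j)
    case 0
    show ?case using low mi by simp
  next
    case (Suc j)
    let ?a = "P (i + (real j - 1) * d)" and ?b = "P (i + real j * d)" and ?c = "P (i + real (Suc j) * d)"
    have p0: "0 \<le> i + (real j - 1) * d"
      using d i by (simp add: algebra_simps) (smt (verit) mult_nonneg_nonneg of_nat_0_le_iff)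
    have p1: "0 \<le> i + real (Suc j) * d" using d i by simp
    have "?b\<^sup>2 \<le> ?a * ?c"
      using mid[OF p0 p1] by (simp add: algebra_simps add_divide_distrib)
    moreover have "0 \<le> ?a" using nonneg[OF p0] .
    moreover have "m > 0" using m nonneg[of 0] by simp
    ultimately have "?b < ?c"
    proof -
      assume h: "?b\<^sup>2 \<le> ?a * ?c" "0 \<le> ?a" "0 < m"
      have "?c \<ge> 0" using nonneg[OF p1] .
      have "?b > 0" using Suc h by auto
      show ?thesis
      proof (rule ccontr)
        assume "\<not> ?thesis"
        then have "?a * ?c \<le> ?a * ?b" using h by (intro mult_left_mono) auto
        also have "\<dots> < ?b * ?b" using Suc \<open>?b > 0\<close> by (intro mult_strict_right_mono) auto
        finally show False using h by (simp add: power2_eq_square)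
      qed
    qed
    then show ?case using Suc by auto
  qed
  have "i + real k * d = S" using kpos by (simp add: d_def)
  with step[of k] m show False by simp
qed

locale symmetric_semigroup =
  fixes T :: "real \<Rightarrow> ('a::euclidean_space \<Rightarrow> real) \<Rightarrow> 'a \<Rightarrow> real"
  assumes semigroup: "C0_semigroup_L2 T"
    and symmetric: "0 \<le> s \<Longrightarrow> f \<in> Lp 2 \<Longrightarrow> g \<in> Lp 2 \<Longrightarrow> ip (T s f) g = ip f (T s g)"
begin

lemma T_Lp2: "0 \<le> t \<Longrightarrow> f \<in> Lp 2 \<Longrightarrow> T t f \<in> Lp 2"
  using semigroup by (simp add: C0_semigroup_L2_def)

lemma T_add: "0 \<le> s \<Longrightarrow> 0 \<le> t \<Longrightarrow> f \<in> Lp 2 \<Longrightarrow> AE x in lborel. T (s + t) f x = T s (T t f) x"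
  using semigroup by (simp add: C0_semigroup_L2_def)

lemma T_continuous_0:
  "f \<in> Lp 2 \<Longrightarrow> ((\<lambda>t. Lp_norm 2 (\<lambda>x. T t f x - f x)) \<longlongrightarrow> 0) (at_right 0)"
  using semigroup by (simp add: C0_semigroup_L2_def)

lemma ip_T_add:
  assumes "0 \<le> s" "0 \<le> t" "f \<in> Lp 2" "g \<in> Lp 2"
  shows "ip f (T (s + t) g) = ip (T s f) (T t g)"
proof -
  have "ip f (T (s + t) g) = ip f (T s (T t g))"
    using assms by (intro ip_cong_AE_right T_Lp2 T_add) auto
  then show ?thesis using assms symmetric[of s f "T t g"] by (simp add: T_Lp2)
qed

text \<open>Symmetry shifts the increment in time onto g. Strong continuity at 0 of the orbit of g
  then controls the orbit of f at every time.\<close>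

lemma ip_T_increment:
  assumes "0 \<le> r" "0 \<le> h" "f \<in> Lp 2" "g \<in> Lp 2"
  shows "ip (T (r + h) f) g - ip (T r f) g = ip (T r f) (\<lambda>x. T h g x - g x)"
proof -
  have "ip (T (r + h) f) g = ip f (T (r + h) g)"
    using assms by (intro symmetric) auto
  also have "\<dots> = ip (T r f) (T h g)" using assms by (rule ip_T_add)
  finally show ?thesis using assms by (simp add: ip_diff_right T_Lp2)
qed

text \<open>Symmetry takes the place of the uniform boundedness principle. The function P(s) = <f,
  T_s f> is the squared norm of T_(s/2) f and P((a + b)/2) = <T_(a/2) f, T_(b/2) f>, so
  Cauchy-Schwarz makes P midpoint log-convex; strong continuity at 0 makes it
  right-continuous.\<close>

lemma T_locally_bounded:
  assumes f: "f \<in> Lp 2" and S: "0 \<le> S"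
  obtains B where "0 \<le> B" "\<And>s. 0 \<le> s \<Longrightarrow> s \<le> S \<Longrightarrow> Lp_norm 2 (T s f) \<le> B"
proof -
  define P where "P s = ip f (T s f)" for s
  have P_norm: "P s = (Lp_norm 2 (T (s / 2) f))\<^sup>2" if "0 \<le> s" for s
    using ip_T_add[of "s / 2" "s / 2" f f] that f
    by (simp add: P_def Lp_norm_2_eq ip_self_nonneg)
  have nonneg: "0 \<le> P s" if "0 \<le> s" for s
    using P_norm[OF that] by simp
  have mid: "(P ((a + b) / 2))\<^sup>2 \<le> P a * P b" if "0 \<le> a" "0 \<le> b" for a b
  proof -
    have "P ((a + b) / 2) = ip (T (a / 2) f) (T (b / 2) f)"
      using ip_T_add[of "a / 2" "b / 2" f f] that f by (simp add: P_def add_divide_distrib)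
    then have "\<bar>P ((a + b) / 2)\<bar> \<le> Lp_norm 2 (T (a / 2) f) * Lp_norm 2 (T (b / 2) f)"
      using Cauchy_Schwarz_ip[of "T (a / 2) f" "T (b / 2) f"] that f by (simp add: T_Lp2)
    then have "\<bar>P ((a + b) / 2)\<bar>\<^sup>2 \<le> (Lp_norm 2 (T (a / 2) f) * Lp_norm 2 (T (b / 2) f))\<^sup>2"
      by (intro power_mono) auto
    then show ?thesis using that by (simp add: P_norm power_mult_distrib)
  qed
  have rc: "(P \<longlongrightarrow> P s) (at_right s)" if s: "0 \<le> s" for s
  proof -
    have "((\<lambda>h. P (s + h)) \<longlongrightarrow> P s) (at_right 0)"
    proof (rule Lim_transform[where g = "\<lambda>h. P s"])
      have "((\<lambda>h. Lp_norm 2 (T s f) * Lp_norm 2 (\<lambda>x. T h f x - f x)) \<longlongrightarrow> 0) (at_right 0)"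
        using tendsto_mult_left[OF T_continuous_0[OF f], of "Lp_norm 2 (T s f)"] by simp
      then show "((\<lambda>h. P (s + h) - P s) \<longlongrightarrow> 0) (at_right 0)"
      proof (rule Lim_null_comparison[rotated])
        show "\<forall>\<^sub>F h in at_right 0. norm (P (s + h) - P s)
            \<le> Lp_norm 2 (T s f) * Lp_norm 2 (\<lambda>x. T h f x - f x)"
          using eventually_at_right_less[of "0::real"]
        proof eventually_elim
          case (elim h)
          have "P (s + h) - P s = ip (T s f) (\<lambda>x. T h f x - f x)"
            using ip_T_increment[of s h f f] s elim f by (simp add: P_def ip_commute)
          then show ?case
            using s elim f by (simp add: Cauchy_Schwarz_ip T_Lp2 Lp2_diff)
        qed
      qed
    qed simp
    then show ?thesis
      by (simp add: filterlim_at_right_to_0[of _ _ s] add.commute)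
  qed
  \<comment> \<open>The squared norm of \<open>T s f\<close> is P(2s), hence the end point
    2S.\<close>
  define B where "B = sqrt (max (P 0) (P (2 * S)))"
  show ?thesis
  proof
    show "0 \<le> B" using nonneg[of 0] by (simp add: B_def max_def)
    fix s assume s: "0 \<le> s" "s \<le> S"
    have "P (2 * s) \<le> max (P 0) (P (2 * S))"
      using s S by (intro midpoint_log_convex_bounded nonneg rc mid) auto
    then have "sqrt ((Lp_norm 2 (T s f))\<^sup>2) \<le> B"
      unfolding B_def using P_norm[of "2 * s"] s by (intro real_sqrt_le_mono) auto
    then show "Lp_norm 2 (T s f) \<le> B" by (simp add: Lp_norm_2_nonneg)
  qed
qed

text \<open>The increment between r <= s is bounded by B times the displacement of g after time s -
  r. This bound does not see the position of r, so one-sided continuity of the orbit of g at 0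
  yields continuity from both sides.\<close>

lemma weakly_continuous:
  assumes f: "f \<in> Lp 2" and g: "g \<in> Lp 2"
  shows "continuous_on {0..S} (\<lambda>s. ip (T s f) g)"
proof (cases "0 \<le> S")
  case True
  obtain B where B: "0 \<le> B" "\<And>s. 0 \<le> s \<Longrightarrow> s \<le> S \<Longrightarrow> Lp_norm 2 (T s f) \<le> B"
    using T_locally_bounded[OF f True] by blast
  define \<omega> where "\<omega> h = Lp_norm 2 (\<lambda>x. T h g x - g x)" for h
  have est: "\<bar>ip (T s f) g - ip (T r f) g\<bar> \<le> B * \<omega> (s - r)" if "0 \<le> r" "r \<le> s" "s \<le> S" for r s
  proof -
    have "\<bar>ip (T s f) g - ip (T r f) g\<bar> = \<bar>ip (T r f) (\<lambda>x. T (s - r) g x - g x)\<bar>"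
      using ip_T_increment[of r "s - r" f g] that f g by simp
    also have "\<dots> \<le> Lp_norm 2 (T r f) * \<omega> (s - r)"
      unfolding \<omega>_def using that f g by (intro Cauchy_Schwarz_ip T_Lp2 Lp2_diff) auto
    also have "\<dots> \<le> B * \<omega> (s - r)"
      using that B by (intro mult_right_mono) (auto simp: \<omega>_def Lp_norm_2_nonneg)
    finally show ?thesis .
  qed
  show ?thesis
    unfolding continuous_on_iff
  proof safe
    fix x e :: real assume "x \<in> {0..S}" "0 < e"
    have "(\<omega> \<longlongrightarrow> 0) (at_right 0)" unfolding \<omega>_def using T_continuous_0[OF g] .
    moreover have "0 < e / (B + 1)" using \<open>0 < e\<close> B by simp
    ultimately have "\<forall>\<^sub>F h in at_right 0. \<omega> h < e / (B + 1)"
      by (rule order_tendstoD)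
    then obtain d where d: "d > 0" "\<And>h. 0 < h \<Longrightarrow> h < d \<Longrightarrow> \<omega> h < e / (B + 1)"
      by (auto simp: eventually_at_right_field)
    have small: "B * \<omega> h < e" if "0 < h" "h < d" for h
    proof -
      have "B * \<omega> h \<le> B * (e / (B + 1))" using d(2)[OF that] B by (intro mult_left_mono) auto
      also have "\<dots> < e" using B \<open>0 < e\<close> by (simp add: field_simps)
      finally show ?thesis .
    qed
    show "\<exists>d>0. \<forall>x'\<in>{0..S}. dist x' x < d \<longrightarrow> dist (ip (T x' f) g) (ip (T x f) g) < e"
    proof (intro exI[of _ d] conjI ballI impI)
      fix y assume y: "y \<in> {0..S}" "dist y x < d"
      consider "y = x" | "x < y" | "y < x" by linarith
      then show "dist (ip (T y f) g) (ip (T x f) g) < e"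
      proof cases
        case 1 then show ?thesis using \<open>0 < e\<close> by simp
      next
        case 2
        then show ?thesis using est[of x y] small[of "y - x"] y \<open>x \<in> {0..S}\<close>
          by (auto simp: dist_real_def)
      next
        case 3
        then show ?thesis using est[of y x] small[of "x - y"] y \<open>x \<in> {0..S}\<close>
          by (auto simp: dist_real_def abs_minus_commute)
      qed
    qed (use d in auto)
  qed
qed simp

text \<open>By symmetry the difference quotient in time falls on g, where it converges to w in norm.
  From the left the quotient over [y, x] is compared with the pairing at y instead of x; weak
  continuity closes this gap.\<close>

lemma generator_derivative:
  assumes f: "f \<in> Lp 2" and gen: "generator_L2 T g w" and x: "x \<in> {0..S}"
  shows "((\<lambda>s. ip (T s f) g) has_real_derivative ip (T x f) w) (at x within {0..S})"
proof -
  have g: "g \<in> Lp 2" and w: "w \<in> Lp 2"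
    and lim: "((\<lambda>t. Lp_norm 2 (\<lambda>x. (T t g x - g x) / t - w x)) \<longlongrightarrow> 0) (at_right 0)"
    using gen by (auto simp: generator_L2_def)
  define W where "W s = ip (T s f) g" for s
  define V where "V s = ip (T s f) w" for s
  define \<omega> where "\<omega> h = Lp_norm 2 (\<lambda>x. (T h g x - g x) / h - w x)" for h
  have \<omega>: "(\<omega> \<longlongrightarrow> 0) (at_right 0)" unfolding \<omega>_def using lim .
  obtain B where B: "0 \<le> B" "\<And>s. 0 \<le> s \<Longrightarrow> s \<le> S \<Longrightarrow> Lp_norm 2 (T s f) \<le> B"
    using T_locally_bounded[OF f, of S] x by auto
  have est: "\<bar>(W s - W r) / (s - r) - V r\<bar> \<le> B * \<omega> (s - r)" if "0 \<le> r" "r < s" "s \<le> S" for r s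
  proof -
    define h where "h = s - r"
    have h: "0 < h" "s = r + h" using that by (auto simp: h_def)
    have D: "(\<lambda>x. T h g x - g x) \<in> Lp 2" using h g by (intro Lp2_diff T_Lp2) auto
    have D': "(\<lambda>x. (T h g x - g x) / h) \<in> Lp 2" using Lp2_cmult[OF D, of "1 / h"] by simp
    have "(W s - W r) / h = ip (T r f) (\<lambda>x. T h g x - g x) / h"
      using ip_T_increment[of r h f g] that h f g by (simp add: W_def)
    also have "\<dots> = ip (T r f) (\<lambda>x. (T h g x - g x) / h)"
      using ip_cmult_right[of "T r f" "1 / h" "\<lambda>x. T h g x - g x"] by simp
    finally have "(W s - W r) / h - V r = ip (T r f) (\<lambda>x. (T h g x - g x) / h - w x)"
      unfolding V_def using that f w D' by (subst ip_diff_right) (auto intro: T_Lp2)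
    also have "\<bar>\<dots>\<bar> \<le> Lp_norm 2 (T r f) * \<omega> h"
      unfolding \<omega>_def using that f D' w by (intro Cauchy_Schwarz_ip T_Lp2 Lp2_diff) auto
    also have "\<dots> \<le> B * \<omega> h"
      using that B by (intro mult_right_mono) (auto simp: \<omega>_def Lp_norm_2_nonneg)
    finally show ?thesis by (simp add: h_def)
  qed
  have Vc: "continuous_on {0..S} V" unfolding V_def by (rule weakly_continuous[OF f w])
  have "((\<lambda>y. (W y - W x) / (y - x)) \<longlongrightarrow> V x) (at x within {0..S})"
    unfolding Lim_within
  proof safe
    fix e :: real assume e: "0 < e"
    have "0 < e / (2 * (B + 1))" using e B by simp
    then have "\<forall>\<^sub>F h in at_right 0. \<omega> h < e / (2 * (B + 1))"
      by (rule order_tendstoD[OF \<omega>])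
    then obtain d where d: "d > 0" "\<And>h. 0 < h \<Longrightarrow> h < d \<Longrightarrow> \<omega> h < e / (2 * (B + 1))"
      by (auto simp: eventually_at_right_field)
    have small: "B * \<omega> h < e / 2" if "0 < h" "h < d" for h
    proof -
      have "B * \<omega> h \<le> B * (e / (2 * (B + 1)))" using d(2)[OF that] B by (intro mult_left_mono) auto
      also have "\<dots> < e / 2" using B e by (simp add: field_simps)
      finally show ?thesis .
    qed
    obtain d' where d': "d' > 0" "\<And>y. y \<in> {0..S} \<Longrightarrow> dist y x < d' \<Longrightarrow> dist (V y) (V x) < e / 2"
      using Vc x e unfolding continuous_on_iff by (meson half_gt_zero)
    show "\<exists>d>0. \<forall>y\<in>{0..S}. 0 < dist y x \<and> dist y x < d \<longrightarrow> dist ((W y - W x) / (y - x)) (V x) < e"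
    proof (intro exI[of _ "min d d'"] conjI ballI impI)
      fix y assume y: "y \<in> {0..S}" "0 < dist y x \<and> dist y x < min d d'"
      consider "x < y" | "y < x" using y by force
      then show "dist ((W y - W x) / (y - x)) (V x) < e"
      proof cases
        case 1
        then show ?thesis using est[of x y] small[of "y - x"] y x e
          by (auto simp: dist_real_def)
      next
        case 2
        have "(W x - W y) / (x - y) = (W y - W x) / (y - x)"
          by (metis minus_diff_eq minus_divide_divide)
        moreover have "\<bar>(W x - W y) / (x - y) - V y\<bar> < e / 2"
          using 2 est[of y x] small[of "x - y"] y x by (auto simp: dist_real_def)
        moreover have "\<bar>V y - V x\<bar> < e / 2"
          using d'(2)[of y] y by (auto simp: dist_real_def)
        ultimately show ?thesis unfolding dist_real_def by linarith
      qed
    qed (use d d' in auto)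
  qed
  then show ?thesis
    by (simp add: has_field_derivative_iff W_def V_def)
qed

end

section \<open>Test functions\<close>

lemma continuously_differentiable_SucI:
  assumes "\<And>x. (f has_derivative f' x) (at x)"
    and "\<And>v. continuously_differentiable r (\<lambda>x. f' x v)"
  shows "continuously_differentiable (Suc r) f"
proof -
  have "frechet_derivative f (at x) = f' x" for x
    using frechet_derivative_at[OF assms(1)] by simp
  then show ?thesis using assms by (auto simp: differentiable_def)
qed

lemma continuously_differentiable_SucD:
  assumes "continuously_differentiable (Suc r) f"
  shows "(f has_derivative frechet_derivative f (at x)) (at x)"
    and "continuously_differentiable r (\<lambda>x. frechet_derivative f (at x) v)"
  using assms by (auto simp: frechet_derivative_works)

lemma continuously_differentiable_Suc_imp:
  "continuously_differentiable (Suc r) f \<Longrightarrow> continuously_differentiable r f"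
proof (induction r arbitrary: f)
  case 0
  then show ?case
    by (auto intro!: differentiable_imp_continuous_on simp: differentiable_on_def)
next
  case (Suc r)
  have "continuously_differentiable r (\<lambda>x. frechet_derivative f (at x) v)" for v
    using Suc.IH continuously_differentiable_SucD(2)[OF Suc.prems] by blast
  then show ?case using Suc.prems by simp
qed

lemma continuously_differentiable_const: "continuously_differentiable r (\<lambda>x. c)"
proof (induction r arbitrary: c)
  case (Suc r)
  show ?case by (rule continuously_differentiable_SucI[OF has_derivative_const Suc])
qed simp

lemma continuously_differentiable_linear:
  "bounded_linear f \<Longrightarrow> continuously_differentiable r f"
proof (cases r)
  case (Suc k)
  assume "bounded_linear f"
  then show ?thesis unfolding Suc
    by (intro continuously_differentiable_SucI[OF bounded_linear_imp_has_derivative]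
        continuously_differentiable_const)
qed (simp add: linear_continuous_on)

lemma continuously_differentiable_add:
  "continuously_differentiable r f \<Longrightarrow> continuously_differentiable r g
    \<Longrightarrow> continuously_differentiable r (\<lambda>x. f x + g x)"
proof (induction r arbitrary: f g)
  case (Suc r)
  show ?case
    by (rule continuously_differentiable_SucI
        [OF has_derivative_add[OF continuously_differentiable_SucD(1)[OF Suc.prems(1)]
            continuously_differentiable_SucD(1)[OF Suc.prems(2)]]])
      (intro Suc.IH continuously_differentiable_SucD(2)[OF Suc.prems(1)]
        continuously_differentiable_SucD(2)[OF Suc.prems(2)])
qed (auto intro: continuous_intros)

lemma continuously_differentiable_mult:
  "continuously_differentiable r f \<Longrightarrow> continuously_differentiable r g
    \<Longrightarrow> continuously_differentiable r (\<lambda>x. f x * g x)"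
proof (induction r arbitrary: f g)
  case (Suc r)
  show ?case
    by (rule continuously_differentiable_SucI
        [OF has_derivative_mult[OF continuously_differentiable_SucD(1)[OF Suc.prems(1)]
            continuously_differentiable_SucD(1)[OF Suc.prems(2)]]])
      (intro continuously_differentiable_add Suc.IH continuously_differentiable_SucD(2)[OF Suc.prems(1)]
        continuously_differentiable_SucD(2)[OF Suc.prems(2)]
        Suc.prems[THEN continuously_differentiable_Suc_imp])
qed (auto intro: continuous_intros)

lemma continuously_differentiable_compose_linear:
  assumes A: "bounded_linear A"
  shows "continuously_differentiable r f \<Longrightarrow> continuously_differentiable r (\<lambda>x. f (A x))"
proof (induction r arbitrary: f)
  case 0
  then show ?case
    by (auto intro!: continuous_on_compose2[of UNIV f] linear_continuous_on[OF A])
next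
  case (Suc r)
  show ?case
    by (rule continuously_differentiable_SucI
        [OF has_derivative_compose[OF bounded_linear_imp_has_derivative[OF A]
            continuously_differentiable_SucD(1)[OF Suc.prems]]])
      (intro Suc.IH continuously_differentiable_SucD(2)[OF Suc.prems])
qed

lemma continuously_differentiable_compose_real:
  fixes h :: "real \<Rightarrow> real"
  shows "continuously_differentiable r h \<Longrightarrow> continuously_differentiable r f
    \<Longrightarrow> continuously_differentiable r (\<lambda>x. h (f x))"
proof (induction r arbitrary: h)
  case 0
  then show ?case by (auto intro!: continuous_on_compose2[of UNIV h])
next
  case (Suc r)
  let ?h = "\<lambda>y. frechet_derivative h (at y)" and ?f = "\<lambda>x. frechet_derivative f (at x)"
  \<comment> \<open>In one variable the chain rule becomes a product of a derivative of f and h'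
    composed with f, so the product lemma and the induction hypothesis for h' apply.\<close>
  have hlin: "?h y t = t * ?h y 1" for y t
  proof -
    have "bounded_linear (?h y)"
      using continuously_differentiable_SucD(1)[OF Suc.prems(1)] by (rule has_derivative_bounded_linear)
    then have "?h y (t *\<^sub>R 1) = t *\<^sub>R ?h y 1" by (intro linear_cmul bounded_linear.linear)
    then show ?thesis by simp
  qed
  have D: "((\<lambda>x. h (f x)) has_derivative (\<lambda>v. ?f x v * ?h (f x) 1)) (at x)" for x
  proof -
    have "((\<lambda>x. h (f x)) has_derivative (\<lambda>v. ?h (f x) (?f x v))) (at x)"
      by (rule has_derivative_compose[OF continuously_differentiable_SucD(1)[OF Suc.prems(2)]
            continuously_differentiable_SucD(1)[OF Suc.prems(1)]])
    moreover have "(\<lambda>v. ?h (f x) (?f x v)) = (\<lambda>v. ?f x v * ?h (f x) 1)"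
      by (rule ext) (rule hlin)
    ultimately show ?thesis by (rule subst[rotated, where P = "\<lambda>D. (_ has_derivative D) _"])
  qed
  show ?case
    by (rule continuously_differentiable_SucI[OF D])
      (rule continuously_differentiable_mult[OF continuously_differentiable_SucD(2)[OF Suc.prems(2)]
          Suc.IH[OF continuously_differentiable_SucD(2)[OF Suc.prems(1)]
            continuously_differentiable_Suc_imp[OF Suc.prems(2)]]])
qed

section \<open>Smooth functions of compact support\<close>

lemma Cc_infty_iff:
  "f \<in> Cc_infty \<longleftrightarrow> (\<forall>r. continuously_differentiable r f) \<and> bounded {x. f x \<noteq> 0}"
  by (simp add: Cc_infty_def compact_closure)

lemma Cc_infty_mult_smooth:
  assumes "\<And>r. continuously_differentiable r c" "f \<in> Cc_infty"
  shows "(\<lambda>x. c x * f x) \<in> Cc_infty"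
  using assms unfolding Cc_infty_iff
  by (auto intro!: continuously_differentiable_mult elim!: bounded_subset)

lemma smooth_has_derivative:
  assumes "\<And>r. continuously_differentiable r f"
  shows "(f has_derivative (\<lambda>v. partial v f x)) (at x)"
  using continuously_differentiable_SucD(1)[OF assms] by (simp add: partial_def)

lemma Cc_infty_has_derivative:
  "f \<in> Cc_infty \<Longrightarrow> (f has_derivative (\<lambda>v. partial v f x)) (at x)"
  by (simp add: Cc_infty_iff smooth_has_derivative)

lemma partial_eq: "(f has_derivative f') (at x) \<Longrightarrow> partial v f x = f' v"
  using frechet_derivative_at[of f f' x] by (simp add: partial_def)

lemma Cc_infty_continuous: "f \<in> Cc_infty \<Longrightarrow> continuous_on A f"
  by (auto simp: Cc_infty_iff intro: continuous_on_subset dest!: spec[of _ 0])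

lemma partial_eq_0_outside:
  assumes S: "closed S" "\<And>x. x \<notin> S \<Longrightarrow> f x = 0" and x: "x \<notin> S"
  shows "partial v f x = 0"
proof (rule partial_eq)
  show "(f has_derivative (\<lambda>v. 0)) (at x)"
    by (rule has_derivative_transform_within_open[where f = "\<lambda>_. 0" and s = "- S"])
      (use S x in auto)
qed

lemma smooth_partial:
  assumes "\<And>r. continuously_differentiable r f"
  shows "continuously_differentiable r (partial v f)"
  using continuously_differentiable_SucD(2)[OF assms[of "Suc r"], of v] by (simp add: partial_def[abs_def])

lemma Cc_infty_smooth: "f \<in> Cc_infty \<Longrightarrow> continuously_differentiable r f"
  by (simp add: Cc_infty_iff)

lemma Cc_infty_partial:
  assumes f: "f \<in> Cc_infty"
  shows "partial v f \<in> Cc_infty"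
proof -
  have "partial v f x = 0" if "x \<notin> closure {x. f x \<noteq> 0}" for x
  proof (rule partial_eq_0_outside[OF closed_closure _ that])
    fix y assume y: "y \<notin> closure {x. f x \<noteq> 0}"
    show "f y = 0"
    proof (rule ccontr)
      assume "f y \<noteq> 0"
      then have "y \<in> closure {x. f x \<noteq> 0}" by (intro subsetD[OF closure_subset]) simp
      then show False using y by simp
    qed
  qed
  then have "{x. partial v f x \<noteq> 0} \<subseteq> closure {x. f x \<noteq> 0}" by auto
  moreover have "bounded (closure {x. f x \<noteq> 0})"
    using f by (auto simp: Cc_infty_iff intro: bounded_closure)
  ultimately have "bounded {x. partial v f x \<noteq> 0}" by (rule bounded_subset[rotated])
  moreover have "continuously_differentiable r (partial v f)" for r
    using smooth_partial[of f r v] Cc_infty_smooth[OF f] by blast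
  ultimately show ?thesis by (simp add: Cc_infty_iff)
qed

lemma Cc_infty_bounded_support: "f \<in> Cc_infty \<Longrightarrow> bounded {x. f x \<noteq> 0}"
  by (simp add: Cc_infty_iff)

lemma continuous_bounded_support_bounded:
  fixes f :: "'a::euclidean_space \<Rightarrow> real"
  assumes "continuous_on UNIV f" "bounded {x. f x \<noteq> 0}"
  obtains C where "0 \<le> C" "\<And>x. \<bar>f x\<bar> \<le> C"
proof -
  have "bounded (f ` closure {x. f x \<noteq> 0})"
    using assms
    by (intro compact_imp_bounded compact_continuous_image) (auto simp: compact_closure intro: continuous_on_subset)
  then obtain C where C: "\<forall>y\<in>f ` closure {x. f x \<noteq> 0}. norm y \<le> C"
    unfolding bounded_iff by blast
  have "\<bar>f x\<bar> \<le> max C 0" for x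
  proof (cases "f x = 0")
    case False
    then have "x \<in> closure {x. f x \<noteq> 0}" by (intro subsetD[OF closure_subset]) simp
    then show ?thesis using bspec[OF C, of "f x"] by (simp add: le_max_iff_disj)
  qed simp
  then show thesis by (intro that[of "max C 0"]) auto
qed

lemma integrable_bounded_support:
  fixes f :: "'a::euclidean_space \<Rightarrow> real"
  assumes c: "continuous_on UNIV f" and b: "bounded {x. f x \<noteq> 0}"
  shows "integrable lborel f"
proof -
  have "integrable lborel (\<lambda>x. indicator (closure {x. f x \<noteq> 0}) x *\<^sub>R f x)"
    using c b by (intro borel_integrable_compact) (auto simp: compact_closure intro: continuous_on_subset)
  moreover have "(\<lambda>x. indicator (closure {x. f x \<noteq> 0}) x *\<^sub>R f x) = f"
    using subsetD[OF closure_subset[of "{x. f x \<noteq> 0}"]] by (auto simp: indicator_def fun_eq_iff)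
  ultimately show ?thesis by simp
qed

lemma Lp2_bounded_support:
  assumes c: "continuous_on UNIV f" and b: "bounded {x. f x \<noteq> 0}"
  shows "f \<in> Lp 2"
  using assms by (auto simp: Lp2_iff intro!: borel_measurable_continuous_onI integrable_bounded_support
      continuous_intros)

lemma Cc_infty_Lp2: "f \<in> Cc_infty \<Longrightarrow> f \<in> Lp 2"
  by (intro Lp2_bounded_support Cc_infty_continuous Cc_infty_bounded_support)

section \<open>Integration by parts with a weight that is invariant along the direction\<close>

lemma lborel_integral_translate:
  fixes f :: "'a::euclidean_space \<Rightarrow> real"
  assumes "f \<in> borel_measurable borel"
  shows "(LINT x|lborel. f (x + v)) = (LINT x|lborel. f x)"
proof -
  have "(LINT x|lborel. f x) = (LINT x|distr lborel borel (\<lambda>x. v + x). f x)"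
    by (simp add: lborel_distr_plus)
  also have "\<dots> = (LINT x|lborel. f (v + x))"
    using assms by (intro integral_distr) auto
  finally show ?thesis by (simp add: add.commute)
qed

text \<open>Translation invariance of Lebesgue measure, with W unchanged along v, makes the integral
  of W times any difference quotient of F vanish; dominated convergence passes to the derivative. W
  is never differentiated, so the weight |x|^(2 alpha), which may be non-smooth at x = 0, is
  admissible for the y directions.\<close>

lemma integral_partial_eq_0:
  assumes F: "F \<in> Cc_infty" and W: "continuous_on UNIV W" and inv: "\<And>x s. W (x + s *\<^sub>R v) = W x"
  shows "(LINT x|lborel. W x * partial v F x) = 0"
proof -
  define s where "s n = 1 / real (Suc n)" for n
  have s: "0 < s n" "s n \<le> 1" for n by (auto simp: s_def)
  define D where "D n x = W x * ((F (x + s n *\<^sub>R v) - F x) / s n)" for n x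
  have Fm [measurable]: "F \<in> borel_measurable borel" and Wm [measurable]: "W \<in> borel_measurable borel"
    using Cc_infty_continuous[OF F] W by (auto intro: borel_measurable_continuous_onI)
  have Pm [measurable]: "partial v F \<in> borel_measurable borel"
    using Cc_infty_continuous[OF Cc_infty_partial[OF F]] by (intro borel_measurable_continuous_onI)
  have line: "((\<lambda>t. F (x + t *\<^sub>R v)) has_real_derivative partial v F (x + t *\<^sub>R v)) (at t)" for x t
  proof -
    have "((\<lambda>t. x + t *\<^sub>R v) has_derivative (\<lambda>h. h *\<^sub>R v)) (at t)"
      by (auto intro!: derivative_eq_intros)
    from has_derivative_compose[OF this Cc_infty_has_derivative[OF F]]
    have D: "((\<lambda>t. F (x + t *\<^sub>R v)) has_derivative (\<lambda>h. partial (h *\<^sub>R v) F (x + t *\<^sub>R v))) (at t)" .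
    have "bounded_linear (\<lambda>v. partial v F (x + t *\<^sub>R v'))" for v'
      using Cc_infty_has_derivative[OF F] by (rule has_derivative_bounded_linear)
    then have "partial (h *\<^sub>R v) F (x + t *\<^sub>R v) = h * partial v F (x + t *\<^sub>R v)" for h
      using linear_cmul[OF bounded_linear.linear, of "\<lambda>w. partial w F (x + t *\<^sub>R v)" h v] by simp
    then show ?thesis using D by (simp add: has_field_derivative_def mult_commute_abs)
  qed
  obtain C where C: "0 \<le> C" "\<And>x. \<bar>partial v F x\<bar> \<le> C"
    using continuous_bounded_support_bounded Cc_infty_partial[OF F] Cc_infty_continuous
      Cc_infty_bounded_support by metis
  \<comment> \<open>The mean value theorem bounds all quotients by C; together with a common bounded
    support this gives the integrable majorant.\<close>
  have quot: "\<bar>(F (x + t *\<^sub>R v) - F x) / t\<bar> \<le> C" if "0 < t" for x t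
  proof -
    have "\<exists>z>0. z < t \<and> F (x + t *\<^sub>R v) - F (x + 0 *\<^sub>R v) = (t - 0) * partial v F (x + z *\<^sub>R v)"
      by (rule MVT2[OF that line])
    then obtain z where "F (x + t *\<^sub>R v) - F x = t * partial v F (x + z *\<^sub>R v)" by auto
    then show ?thesis using C(2) that by simp
  qed
  obtain r where r: "\<And>x. F x \<noteq> 0 \<Longrightarrow> norm x \<le> r"
    using Cc_infty_bounded_support[OF F] unfolding bounded_iff by blast
  \<comment> \<open>The step lengths \<open>s n\<close> are at most 1, so this ball contains the
    support of F and of all its translates in use.\<close>
  let ?B = "cball 0 (r + norm v) :: 'a set"
  have "bounded (W ` ?B)"
    using W by (intro compact_imp_bounded compact_continuous_image) (auto intro: continuous_on_subset)
  then obtain M where M: "\<And>x. x \<in> ?B \<Longrightarrow> \<bar>W x\<bar> \<le> M"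
    unfolding bounded_iff by (metis imageI real_norm_def)
  have supp: "F (x + s n *\<^sub>R v) = 0" "F x = 0" if "x \<notin> ?B" for x n
  proof -
    have "r + norm v < norm x" using that by simp
    moreover have "norm (s n *\<^sub>R v) \<le> norm v" using s[of n] by (simp add: mult_left_le_one_le)
    moreover have "norm x \<le> norm (x + s n *\<^sub>R v) + norm (s n *\<^sub>R v)"
      using norm_triangle_ineq4[of "x + s n *\<^sub>R v" "s n *\<^sub>R v"] by simp
    ultimately have "\<not> norm (x + s n *\<^sub>R v) \<le> r" "\<not> norm x \<le> r"
      using norm_ge_zero[of v] by linarith+
    then show "F (x + s n *\<^sub>R v) = 0" "F x = 0" using r by blast+
  qed
  have "(\<lambda>n. LINT x|lborel. D n x) \<longlonglongrightarrow> (LINT x|lborel. W x * partial v F x)"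
  proof (rule integral_dominated_convergence[where w = "\<lambda>x. indicator ?B x *\<^sub>R (M * C)"])
    have "emeasure lborel ?B < \<infinity>" by (intro emeasure_bounded_finite) auto
    then show "integrable lborel (\<lambda>x. indicator ?B x *\<^sub>R (M * C))"
      by (intro integrable_scaleR_left integrable_real_indicator) auto
    show "AE x in lborel. norm (D n x) \<le> indicator ?B x *\<^sub>R (M * C)" for n
    proof (rule AE_I2)
      fix x
      show "norm (D n x) \<le> indicator ?B x *\<^sub>R (M * C)"
      proof (cases "x \<in> ?B")
        case True
        have "\<bar>W x\<bar> * \<bar>(F (x + s n *\<^sub>R v) - F x) / s n\<bar> \<le> M * C"
          using M[OF True] quot[OF s(1)] C by (intro mult_mono) auto
        then show ?thesis using True by (simp only: D_def abs_mult real_norm_def indicator_simps(1) scaleR_one)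
      next
        case False then show ?thesis using supp[OF False] by (simp add: D_def)
      qed
    qed
    have "s \<longlonglongrightarrow> 0"
      using LIMSEQ_inverse_real_of_nat by (simp add: s_def[abs_def] inverse_eq_divide)
    moreover have "s n \<noteq> 0" for n using s(1)[of n] by simp
    ultimately have s0: "filterlim s (at 0) sequentially"
      by (simp add: filterlim_at always_eventually)
    show "AE x in lborel. (\<lambda>n. D n x) \<longlonglongrightarrow> W x * partial v F x"
    proof (rule AE_I2)
      fix x
      have "((\<lambda>t. (F (x + t *\<^sub>R v) - F x) / t) \<longlongrightarrow> partial v F x) (at 0)"
        using line[of x 0] by (simp add: has_field_derivative_iff)
      from filterlim_compose[OF this s0]
      show "(\<lambda>n. D n x) \<longlonglongrightarrow> W x * partial v F x"
        unfolding D_def by (intro tendsto_mult_left)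
    qed
  qed (auto simp: D_def)
  moreover have "(LINT x|lborel. D n x) = 0" for n
  proof -
    have I: "integrable lborel (\<lambda>x. W x * F x)"
      using W Cc_infty_continuous[OF F] Cc_infty_bounded_support[OF F]
      by (intro integrable_bounded_support continuous_intros) (auto elim: bounded_subset)
    have eq: "(\<lambda>x. W x * F (x + s n *\<^sub>R v)) = (\<lambda>x. W (x + s n *\<^sub>R v) * F (x + s n *\<^sub>R v))"
      by (simp add: inv)
    have I': "integrable lborel (\<lambda>x. W x * F (x + s n *\<^sub>R v))"
    proof (rule integrable_bounded_support)
      have "continuous_on UNIV (\<lambda>x. F (x + s n *\<^sub>R v))"
        by (intro continuous_on_compose2[OF Cc_infty_continuous[OF F, of UNIV]] continuous_intros) auto
      then show "continuous_on UNIV (\<lambda>x. W x * F (x + s n *\<^sub>R v))" by (intro continuous_intros W)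
      have "{x. W x * F (x + s n *\<^sub>R v) \<noteq> 0} \<subseteq> ?B" using supp(1) by fastforce
      then show "bounded {x. W x * F (x + s n *\<^sub>R v) \<noteq> 0}" by (rule bounded_subset[OF bounded_cball])
    qed
    have "(LINT x|lborel. D n x)
        = ((LINT x|lborel. W x * F (x + s n *\<^sub>R v)) - (LINT x|lborel. W x * F x)) / s n"
      unfolding D_def using I I' by (simp add: right_diff_distrib diff_divide_distrib)
    also have "(LINT x|lborel. W x * F (x + s n *\<^sub>R v)) = (LINT x|lborel. W x * F x)"
      unfolding eq by (rule lborel_integral_translate) auto
    finally show ?thesis by simp
  qed
  then have "(\<lambda>n. LINT x|lborel. D n x) \<longlonglongrightarrow> 0" by (simp only: tendsto_const)
  ultimately show ?thesis by (rule LIMSEQ_unique)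
qed

lemma partial_mult:
  assumes "(f has_derivative (\<lambda>v. partial v f x)) (at x)" "(g has_derivative (\<lambda>v. partial v g x)) (at x)"
  shows "partial v (\<lambda>x. f x * g x) x = f x * partial v g x + partial v f x * g x"
  using partial_eq[OF has_derivative_mult[OF assms]] by simp

text \<open>Both sides equal minus the integral of W times the product of the first derivatives: the
  total derivative of f times the derivative of g integrates to 0 against W.\<close>

lemma integral_second_partial_symmetric:
  assumes f: "f \<in> Cc_infty" and g: "g \<in> Cc_infty"
    and W: "continuous_on UNIV W" and inv: "\<And>x s. W (x + s *\<^sub>R v) = W x"
  shows "(LINT x|lborel. W x * (f x * partial v (partial v g) x))
    = (LINT x|lborel. W x * (partial v (partial v f) x * g x))"
proof -
  have swap: "(LINT x|lborel. W x * (f x * partial v (partial v g) x))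
      = - (LINT x|lborel. W x * (partial v f x * partial v g x))"
    if f: "f \<in> Cc_infty" and g: "g \<in> Cc_infty" for f g
  proof -
    have g': "partial v g \<in> Cc_infty" and g'': "partial v (partial v g) \<in> Cc_infty"
      and f': "partial v f \<in> Cc_infty"
      using f g by (auto intro: Cc_infty_partial)
    have "(\<lambda>x. f x * partial v g x) \<in> Cc_infty"
      using f g' by (intro Cc_infty_mult_smooth) (auto simp: Cc_infty_iff)
    note zero = integral_partial_eq_0[where W = W and v = v, OF this W inv]
    have Wi: "integrable lborel (\<lambda>x. W x * (a x * b x))" if "a \<in> Cc_infty" "b \<in> Cc_infty" for a b
      using that W by (intro integrable_bounded_support continuous_intros)
        (auto intro: Cc_infty_continuous bounded_subset[OF Cc_infty_bounded_support[of b]])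
    have "0 = (LINT x|lborel. W x * (f x * partial v (partial v g) x) + W x * (partial v f x * partial v g x))"
      using zero by (simp add: partial_mult[OF Cc_infty_has_derivative[OF f] Cc_infty_has_derivative[OF g']]
          distrib_left)
    also have "\<dots> = (LINT x|lborel. W x * (f x * partial v (partial v g) x))
        + (LINT x|lborel. W x * (partial v f x * partial v g x))"
      using f f' g' g'' by (intro Bochner_Integration.integral_add Wi)
    finally show ?thesis by simp
  qed
  have "(LINT x|lborel. W x * (partial v (partial v f) x * g x))
      = - (LINT x|lborel. W x * (partial v f x * partial v g x))"
    using swap[OF g f] by (simp add: mult.commute)
  then show ?thesis using swap[OF f g] by simp
qed

text \<open>The powers in the denominator make the family closed under differentiation up to linear
  combinations, so smoothness of all members follows by one induction.\<close>

definition flat_exp :: "nat \<Rightarrow> real \<Rightarrow> real" where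
  "flat_exp n x = (if x \<le> 0 then 0 else exp (- 1 / x) / x ^ n)"

lemma flat_exp_tendsto_0: "(flat_exp n \<longlongrightarrow> 0) (at 0)"
proof -
  have "((\<lambda>y. y ^ n / exp y) \<longlongrightarrow> (0::real)) at_top" by (rule tendsto_power_div_exp_0)
  note lim = filterlim_compose[OF this filterlim_inverse_at_top_right]
  have "inverse x ^ n / exp (inverse x) = flat_exp n x" if "0 < x" for x
  proof -
    have "- 1 / x = - inverse x" by (simp only: divide_inverse mult_minus_left mult_1)
    then have "exp (- 1 / x) = inverse (exp (inverse x))" by (simp only: exp_minus)
    then have "flat_exp n x = inverse (exp (inverse x)) / x ^ n" using that by (simp only: flat_exp_def if_False not_le[symmetric])
    also have "\<dots> = inverse x ^ n / exp (inverse x)" by (simp only: divide_inverse power_inverse mult.commute)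
    finally show ?thesis by (rule sym)
  qed
  then have "\<forall>\<^sub>F x in at_right 0. inverse x ^ n / exp (inverse x) = flat_exp n x"
    using eventually_at_right_less[of "0::real"] by (auto elim: eventually_mono)
  then have "(flat_exp n \<longlongrightarrow> 0) (at_right 0)"
    by (rule Lim_transform_eventually[OF lim])
  moreover have "\<forall>\<^sub>F x in at_left 0. flat_exp n x = 0"
    unfolding flat_exp_def by (rule eventually_at_leftI[of "-1"]) auto
  then have "(flat_exp n \<longlongrightarrow> 0) (at_left 0)" by (rule tendsto_eventually)
  ultimately show ?thesis unfolding filterlim_at_split by blast
qed

lemma flat_exp_derivative:
  "(flat_exp n has_real_derivative flat_exp (n + 2) x - real n * flat_exp (n + 1) x) (at x)"
proof -
  consider "x < 0" | "x = 0" | "0 < x" by linarith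
  then show ?thesis
  proof cases
    case 1
    have "((\<lambda>x. 0) has_real_derivative 0) (at x)" by simp
    then have "(flat_exp n has_real_derivative 0) (at x)"
      by (rule has_field_derivative_transform_within_open[where S = "{..<0}"])
        (use 1 in \<open>auto simp: flat_exp_def\<close>)
    then show ?thesis using 1 by (simp add: flat_exp_def)
  next
    case 2
    \<comment> \<open>The difference quotient of \<open>flat_exp n\<close> at 0 is
      \<open>flat_exp (n + 1)\<close>, which tends to 0.\<close>
    have "((\<lambda>y. (flat_exp n y - flat_exp n 0) / (y - 0)) \<longlongrightarrow> 0) (at 0)"
      by (rule Lim_transform_eventually[OF flat_exp_tendsto_0[of "n + 1"]])
        (auto simp: flat_exp_def intro!: always_eventually)
    then show ?thesis using 2 by (simp add: has_field_derivative_iff flat_exp_def)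
  next
    case 3
    have "((\<lambda>x. exp (- 1 / x) / x ^ n) has_real_derivative
        flat_exp (n + 2) x - real n * flat_exp (n + 1) x) (at x)"
    proof (rule DERIV_cong)
      show "((\<lambda>x. exp (- 1 / x) / x ^ n) has_real_derivative
          (exp (- 1 / x) * (1 / x\<^sup>2) * x ^ n - exp (- 1 / x) * (real n * x ^ (n - 1))) / (x ^ n * x ^ n)) (at x)"
        using 3 by (auto intro!: derivative_eq_intros simp: power2_eq_square)
      have a: "real n * x ^ (n - 1) / (x ^ n * x ^ n) = real n / x ^ (n + 1)"
        using 3 by (cases n) auto
      have b: "1 / x\<^sup>2 * x ^ n / (x ^ n * x ^ n) = 1 / x ^ (n + 2)"
        using 3 by (simp add: power_add divide_simps) (simp add: power2_eq_square)
      have c: "(e * a * b - e * c) / d = e * (a * b / d) - e * (c / d)" for e a b c d :: real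
        by (simp add: diff_divide_distrib)
      show "(exp (- 1 / x) * (1 / x\<^sup>2) * x ^ n - exp (- 1 / x) * (real n * x ^ (n - 1))) / (x ^ n * x ^ n)
          = flat_exp (n + 2) x - real n * flat_exp (n + 1) x"
        unfolding c a b using 3 by (simp add: flat_exp_def)
    qed
    then show ?thesis
      by (rule has_field_derivative_transform_within_open[where S = "{0<..}"])
        (use 3 in \<open>auto simp: flat_exp_def\<close>)
  qed
qed

lemma flat_exp_smooth: "continuously_differentiable r (flat_exp n)"
proof (induction r arbitrary: n)
  case 0
  have "isCont (flat_exp n) x" for x using DERIV_isCont[OF flat_exp_derivative] .
  then show ?case by (simp add: continuous_on_eq_continuous_at)
next
  case (Suc r)
  show ?case
  proof (rule continuously_differentiable_SucI)
    show "(flat_exp n has_derivative (\<lambda>v. (flat_exp (n + 2) x + (- real n) * flat_exp (n + 1) x) * v)) (at x)"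
      for x using flat_exp_derivative[of n x] by (simp add: has_field_derivative_def)
    show "continuously_differentiable r (\<lambda>x. (flat_exp (n + 2) x + (- real n) * flat_exp (n + 1) x) * v)"
      for v
      by (intro continuously_differentiable_mult continuously_differentiable_add
          continuously_differentiable_const Suc)
  qed
qed

text \<open>The standard mollifier exp(-1/(1 - |g|^2)), not normalised: its value at the origin is
  exp(-1). The positive factor \<open>bump 0\<close> therefore appears in the later limits and is
  divided out.\<close>

definition bump :: "'a::euclidean_space \<Rightarrow> real" where
  "bump g = flat_exp 0 (1 - g \<bullet> g)"

lemma bump_eq_0: "1 \<le> norm g \<Longrightarrow> bump g = 0"
  by (simp add: bump_def flat_exp_def dot_square_norm one_le_power)

lemma bump_Cc_infty: "bump \<in> Cc_infty"
proof -
  have sq: "continuously_differentiable r (\<lambda>g::'a. g \<bullet> g)" for r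
  proof (cases r)
    case (Suc k)
    have "((\<lambda>g::'a. g \<bullet> g) has_derivative (\<lambda>v. 2 * (g \<bullet> v))) (at g)" for g
      by (auto intro!: derivative_eq_intros simp: inner_commute)
    then show ?thesis unfolding Suc
      by (rule continuously_differentiable_SucI)
        (intro continuously_differentiable_linear bounded_linear_intros)
  qed (auto intro: continuous_intros)
  have "continuously_differentiable r (\<lambda>g::'a. 1 + (- 1) * (g \<bullet> g))" for r
    by (intro continuously_differentiable_add continuously_differentiable_mult
        continuously_differentiable_const sq)
  then have "continuously_differentiable r (bump :: 'a \<Rightarrow> real)" for r
    using continuously_differentiable_compose_real[OF flat_exp_smooth[of r 0], of "\<lambda>g::'a. 1 - g \<bullet> g"]
    by (simp add: bump_def[abs_def])
  moreover have "{g::'a. bump g \<noteq> 0} \<subseteq> cball 0 1"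
  proof
    fix g :: 'a assume "g \<in> {g. bump g \<noteq> 0}"
    then show "g \<in> cball 0 1" using bump_eq_0[of g] by (cases "1 \<le> norm g") auto
  qed
  then have "bounded {g::'a. bump g \<noteq> 0}" by (rule bounded_subset[OF bounded_cball])
  ultimately show ?thesis unfolding Cc_infty_iff by blast
qed

lemma bump_nonneg: "0 \<le> bump g"
  by (simp add: bump_def flat_exp_def)

lemma bump_pos: "norm g < 1 \<Longrightarrow> 0 < bump g"
  using power_strict_mono[of "norm g" 1 2] by (simp add: bump_def flat_exp_def dot_square_norm)

lemma bump_le_1: "bump g \<le> 1"
  by (simp add: bump_def flat_exp_def)

section \<open>The Grushin operator on test functions\<close>

lemma partial_add:
  assumes "(f has_derivative (\<lambda>v. partial v f x)) (at x)" "(g has_derivative (\<lambda>v. partial v g x)) (at x)"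
  shows "partial v (\<lambda>x. f x + g x) x = partial v f x + partial v g x"
  using partial_eq[OF has_derivative_add[OF assms]] by simp

lemma second_partial_mult:
  assumes c: "\<And>r. continuously_differentiable r c" and f: "\<And>r. continuously_differentiable r f"
  shows "partial v (partial v (\<lambda>g. c g * f g)) g
    = c g * partial v (partial v f) g + 2 * partial v c g * partial v f g + partial v (partial v c) g * f g"
proof -
  note c' = smooth_partial[of c _ v, OF c] and f' = smooth_partial[of f _ v, OF f]
  have eq: "partial v (\<lambda>g. c g * f g) = (\<lambda>g. c g * partial v f g + partial v c g * f g)"
    using partial_mult[OF smooth_has_derivative[OF c] smooth_has_derivative[OF f]] by (rule ext)
  have "partial v (partial v (\<lambda>g. c g * f g)) g = partial v (\<lambda>g. c g * partial v f g) g + partial v (\<lambda>g. partial v c g * f g) g"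
    unfolding eq by (intro partial_add smooth_has_derivative continuously_differentiable_mult c f c' f')
  also have "partial v (\<lambda>g. c g * partial v f g) g = c g * partial v (partial v f) g + partial v c g * partial v f g"
    by (intro partial_mult smooth_has_derivative c f')
  also have "partial v (\<lambda>g. partial v c g * f g) g = partial v c g * partial v f g + partial v (partial v c) g * f g"
    by (intro partial_mult smooth_has_derivative c' f)
  finally show ?thesis by simp
qed

lemma partial_scaleR:
  assumes "(f has_derivative (\<lambda>v. partial v f x)) (at x)"
  shows "partial (c *\<^sub>R v) f x = c * partial v f x"
  using linear_cmul[OF bounded_linear.linear[OF has_derivative_bounded_linear[OF assms]], of c v] by simp

text \<open>Only the action of A on the single direction v matters: a dilation scales the horizontal
  and the vertical coordinate vectors by different factors.\<close>

lemma second_partial_compose_linear: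
  assumes A: "bounded_linear A" and f: "\<And>r. continuously_differentiable r f" and v: "A v = c *\<^sub>R v'"
  shows "partial v (\<lambda>x. f (A x)) x = c * partial v' f (A x)"
    and "partial v (partial v (\<lambda>x. f (A x))) x = c\<^sup>2 * partial v' (partial v' f) (A x)"
proof -
  have one: "partial v (\<lambda>x. h (A x)) x = c * partial v' h (A x)"
    if h: "\<And>r. continuously_differentiable r h" for h x
  proof -
    have "partial v (\<lambda>x. h (A x)) x = partial (A v) h (A x)"
      by (rule partial_eq, rule has_derivative_compose[OF bounded_linear_imp_has_derivative[OF A]
            smooth_has_derivative[OF h]])
    then show ?thesis using partial_scaleR[OF smooth_has_derivative[OF h]] by (simp add: v)
  qed
  show "partial v (\<lambda>x. f (A x)) x = c * partial v' f (A x)" using one[OF f] .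
  have eq: "partial v (\<lambda>x. f (A x)) = (\<lambda>x. c * partial v' f (A x))" using one[OF f] by (rule ext)
  have "continuously_differentiable r (\<lambda>x. c * partial v' f x)" for r
    by (intro continuously_differentiable_mult continuously_differentiable_const smooth_partial f)
  from one[OF this] have "partial v (partial v (\<lambda>x. f (A x))) x = c * partial v' (\<lambda>x. c * partial v' f x) (A x)"
    unfolding eq .
  also have "partial v' (\<lambda>x. c * partial v' f x) (A x) = c * partial v' (partial v' f) (A x)"
    by (rule partial_eq, intro has_derivative_mult_right smooth_has_derivative smooth_partial f)
  finally show "partial v (partial v (\<lambda>x. f (A x))) x = c\<^sup>2 * partial v' (partial v' f) (A x)"
    by (simp add: power2_eq_square)
qed

section \<open>The weight, and the symmetry and domain of the operator\<close>

lemma grushin_weight_continuous: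
  assumes "0 \<le> \<alpha>"
  shows "continuous_on A (\<lambda>g. grushin_weight \<alpha> (fst g))"
proof (cases "\<alpha> = 0")
  case False
  then show ?thesis using assms unfolding grushin_weight_def
    by (simp, intro continuous_on_powr' continuous_intros) auto
qed (simp add: grushin_weight_def)

lemma grushin_weight_scaleR:
  "0 < c \<Longrightarrow> grushin_weight \<alpha> (c *\<^sub>R x) = c powr (2 * \<alpha>) * grushin_weight \<alpha> x"
  by (simp add: grushin_weight_def powr_mult)

lemma grushin_expr_continuous:
  assumes "0 \<le> \<alpha>" "f \<in> Cc_infty"
  shows "continuous_on A (grushin_expr \<alpha> f)"
  unfolding grushin_expr_def[abs_def]
  by (intro continuous_intros grushin_weight_continuous Cc_infty_continuous Cc_infty_partial assms)

lemma grushin_expr_eq_0_outside: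
  fixes f :: "('a::finite, 'b::finite) grushin \<Rightarrow> real"
  assumes "closed S" "\<And>x. x \<notin> S \<Longrightarrow> f x = 0" "x \<notin> S"
  shows "grushin_expr \<alpha> f x = 0"
proof -
  have 1: "partial v f y = 0" if "y \<notin> S" for v y :: "('a, 'b) grushin"
    by (rule partial_eq_0_outside[OF assms(1,2) that])
  have "partial v (partial v f) x = 0" for v
    by (rule partial_eq_0_outside[OF assms(1) 1 assms(3)])
  then show ?thesis by (simp add: grushin_expr_def)
qed

lemma grushin_expr_bounded_support:
  fixes f :: "('a::finite, 'b::finite) grushin \<Rightarrow> real"
  assumes "f \<in> Cc_infty"
  shows "bounded {x. grushin_expr \<alpha> f x \<noteq> 0}"
proof -
  obtain r where r: "\<And>x. f x \<noteq> 0 \<Longrightarrow> norm x \<le> r"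
    using Cc_infty_bounded_support[OF assms] unfolding bounded_iff by blast
  have "grushin_expr \<alpha> f x = 0" if "x \<notin> cball 0 r" for x
  proof (rule grushin_expr_eq_0_outside[OF closed_cball _ that])
    fix y :: "('a, 'b) grushin" assume "y \<notin> cball 0 r" then show "f y = 0" using r[of y] by auto
  qed
  then have "{x. grushin_expr \<alpha> f x \<noteq> 0} \<subseteq> cball 0 r" by blast
  then show ?thesis by (rule bounded_subset[OF bounded_cball])
qed

lemma grushin_expr_Lp2: "0 \<le> \<alpha> \<Longrightarrow> f \<in> Cc_infty \<Longrightarrow> grushin_expr \<alpha> f \<in> Lp 2"
  by (intro Lp2_bounded_support grushin_expr_continuous grushin_expr_bounded_support)

text \<open>The weight depends on x alone and is thus invariant along each y direction, so every
  second-order term is symmetric by itself.\<close>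

lemma grushin_expr_symmetric:
  assumes \<alpha>: "0 \<le> \<alpha>" and f: "f \<in> Cc_infty" and h: "h \<in> Cc_infty"
  shows "(LINT g|lborel. f g * grushin_expr \<alpha> h g) = (LINT g|lborel. grushin_expr \<alpha> f g * h g)"
proof -
  define w where "w g = grushin_weight \<alpha> (fst g)" for g :: "('a, 'b) grushin"
  define X :: "'a \<Rightarrow> ('a, 'b) grushin" where "X i = (axis i 1, 0)" for i
  define Y :: "'b \<Rightarrow> ('a, 'b) grushin" where "Y j = (0, axis j 1)" for j
  have wc: "continuous_on UNIV w" unfolding w_def by (rule grushin_weight_continuous[OF \<alpha>])
  have int: "integrable lborel (\<lambda>g. W g * (a g * b g))"
    if "continuous_on UNIV W" "a \<in> Cc_infty" "b \<in> Cc_infty" for W a b :: "('a, 'b) grushin \<Rightarrow> real"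
  proof (rule integrable_bounded_support)
    show "continuous_on UNIV (\<lambda>g. W g * (a g * b g))"
      by (intro continuous_on_mult that Cc_infty_continuous)
    show "bounded {g. W g * (a g * b g) \<noteq> 0}"
      by (rule bounded_subset[OF Cc_infty_bounded_support[OF that(2)]]) auto
  qed
  \<comment> \<open>The factor 1 gives the horizontal terms the same weighted form as the vertical
    ones, so one symmetry lemma serves both.\<close>
  have expand: "(LINT g|lborel. a g * grushin_expr \<alpha> b g)
      = - (\<Sum>i\<in>UNIV. LINT g|lborel. 1 * (a g * partial (X i) (partial (X i) b) g))
        - (\<Sum>j\<in>UNIV. LINT g|lborel. w g * (a g * partial (Y j) (partial (Y j) b) g))"
    if a: "a \<in> Cc_infty" and b: "b \<in> Cc_infty" for a b
  proof -
    have "(LINT g|lborel. a g * grushin_expr \<alpha> b g)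
        = (LINT g|lborel. - (\<Sum>i\<in>UNIV. 1 * (a g * partial (X i) (partial (X i) b) g))
            - (\<Sum>j\<in>UNIV. w g * (a g * partial (Y j) (partial (Y j) b) g)))"
      by (intro Bochner_Integration.integral_cong)
        (simp_all add: grushin_expr_def w_def X_def Y_def algebra_simps sum_distrib_left)
    also have "\<dots> = (LINT g|lborel. - (\<Sum>i\<in>UNIV. 1 * (a g * partial (X i) (partial (X i) b) g)))
        - (LINT g|lborel. (\<Sum>j\<in>UNIV. w g * (a g * partial (Y j) (partial (Y j) b) g)))"
      by (intro Bochner_Integration.integral_diff integrable_minus Bochner_Integration.integrable_sum int wc a b
          Cc_infty_partial continuous_on_const)
    also have "(LINT g|lborel. (\<Sum>j\<in>UNIV. w g * (a g * partial (Y j) (partial (Y j) b) g)))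
        = (\<Sum>j\<in>UNIV. LINT g|lborel. w g * (a g * partial (Y j) (partial (Y j) b) g))"
      by (intro Bochner_Integration.integral_sum int wc a b Cc_infty_partial)
    also have "(LINT g|lborel. - (\<Sum>i\<in>UNIV. 1 * (a g * partial (X i) (partial (X i) b) g)))
        = - (LINT g|lborel. (\<Sum>i\<in>UNIV. 1 * (a g * partial (X i) (partial (X i) b) g)))"
      by (rule integral_minus)
    also have "(LINT g|lborel. (\<Sum>i\<in>UNIV. 1 * (a g * partial (X i) (partial (X i) b) g)))
        = (\<Sum>i\<in>UNIV. LINT g|lborel. 1 * (a g * partial (X i) (partial (X i) b) g))"
      by (intro Bochner_Integration.integral_sum int a b Cc_infty_partial continuous_on_const)
    finally show ?thesis .
  qed
  have 1: "(LINT g|lborel. 1 * (f g * partial (X i) (partial (X i) h) g))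
      = (LINT g|lborel. 1 * (h g * partial (X i) (partial (X i) f) g))" for i
    using integral_second_partial_symmetric[OF f h, of "\<lambda>_. 1" "X i"] by (simp add: mult.commute)
  have inv: "w (g + s *\<^sub>R Y j) = w g" for g s j
    by (simp add: w_def Y_def)
  have 2: "(LINT g|lborel. w g * (f g * partial (Y j) (partial (Y j) h) g))
      = (LINT g|lborel. w g * (h g * partial (Y j) (partial (Y j) f) g))" for j
    using integral_second_partial_symmetric[OF f h wc inv] by (simp add: mult.commute)
  have "(LINT g|lborel. f g * grushin_expr \<alpha> h g) = (LINT g|lborel. h g * grushin_expr \<alpha> f g)"
    unfolding expand[OF f h] expand[OF h f] 1 2 ..
  then show ?thesis by (simp add: mult.commute)
qed

text \<open>The constant sequence f witnesses membership in the form domain, and the weak equation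
  is the formal symmetry. Thus test functions lie in the domain of the generator, where the pairing
  can be differentiated.\<close>

lemma Cc_infty_grushin_operator:
  assumes \<alpha>: "0 \<le> \<alpha>" and f: "f \<in> Cc_infty"
  shows "grushin_operator \<alpha> f (grushin_expr \<alpha> f)"
proof -
  have "f \<in> grushin_form_domain \<alpha>"
    unfolding grushin_form_domain_def
    using f Cc_infty_Lp2[OF f]
    by (auto intro!: exI[of _ "\<lambda>_. f"] simp: Lp_norm_2_eq ip_def)
  then show ?thesis
    using grushin_expr_symmetric[OF \<alpha> f] grushin_expr_Lp2[OF \<alpha> f]
    by (simp add: grushin_operator_def)
qed

lemma heat_semigroup_generator:
  assumes "0 \<le> \<alpha>" "heat_semigroup \<alpha> T" "f \<in> Cc_infty"
  shows "generator_L2 T f (\<lambda>g. - grushin_expr \<alpha> f g)"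
  using assms Cc_infty_grushin_operator[of \<alpha> f] by (simp add: heat_semigroup_def)

text \<open>The exponents are such that the fields d/dx_i and |x|^alpha d/dy_j scale by the same
  factor c, which makes the operator homogeneous of degree 2.\<close>

definition dilation :: "real \<Rightarrow> real \<Rightarrow> ('m::finite, 'k::finite) grushin \<Rightarrow> ('m, 'k) grushin" where
  "dilation \<alpha> c g = (c *\<^sub>R fst g, (c powr (\<alpha> + 1)) *\<^sub>R snd g)"

lemma bounded_linear_dilation: "bounded_linear (dilation \<alpha> c)"
  unfolding dilation_def[abs_def]
  by (intro bounded_linear_Pair bounded_linear_compose[OF bounded_linear_scaleR_right]
      bounded_linear_fst bounded_linear_snd)

lemma dilation_dilation: "0 \<le> a \<Longrightarrow> 0 \<le> b \<Longrightarrow> dilation \<alpha> a (dilation \<alpha> b g) = dilation \<alpha> (a * b) g"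
  by (simp add: dilation_def powr_mult)

lemma grushin_expr_dilation:
  assumes f: "f \<in> Cc_infty" and c: "0 < c"
  shows "grushin_expr \<alpha> (\<lambda>g. f (dilation \<alpha> c g)) g = c\<^sup>2 * grushin_expr \<alpha> f (dilation \<alpha> c g)"
proof -
  note fs = Cc_infty_smooth[OF f]
  have X: "partial (axis i 1, 0) (partial (axis i 1, 0) (\<lambda>g. f (dilation \<alpha> c g))) g
      = c\<^sup>2 * partial (axis i 1, 0) (partial (axis i 1, 0) f) (dilation \<alpha> c g)" for i
    by (rule second_partial_compose_linear(2)[OF bounded_linear_dilation fs]) (simp add: dilation_def)
  have Y: "partial (0, axis j 1) (partial (0, axis j 1) (\<lambda>g. f (dilation \<alpha> c g))) g
      = (c powr (\<alpha> + 1))\<^sup>2 * partial (0, axis j 1) (partial (0, axis j 1) f) (dilation \<alpha> c g)" for j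
    by (rule second_partial_compose_linear(2)[OF bounded_linear_dilation fs]) (simp add: dilation_def)
  \<comment> \<open>The surplus factor c^(2 alpha) turns the weight at g into the weight at the
    dilated point.\<close>
  have "(c powr (\<alpha> + 1))\<^sup>2 = c\<^sup>2 * c powr (2 * \<alpha>)"
    using c by (simp add: powr_add power2_eq_square) (simp add: powr_add[symmetric])
  then have w: "grushin_weight \<alpha> (fst g) * (c powr (\<alpha> + 1))\<^sup>2 = c\<^sup>2 * grushin_weight \<alpha> (fst (dilation \<alpha> c g))"
    using c by (simp add: dilation_def grushin_weight_scaleR)
  have "grushin_weight \<alpha> (fst g) * (\<Sum>j\<in>UNIV. (c powr (\<alpha> + 1))\<^sup>2 * Q j) =
      c\<^sup>2 * (grushin_weight \<alpha> (fst (dilation \<alpha> c g)) * (\<Sum>j\<in>UNIV. Q j))" for Q :: "'b \<Rightarrow> real"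
    by (simp only: sum_distrib_left[symmetric] mult.assoc[symmetric] w)
  then show ?thesis
    unfolding grushin_expr_def X Y by (simp add: sum_distrib_left[symmetric] right_diff_distrib)
qed

text \<open>Scaling by dilations makes the operator applied to the cutoff R^(-2) times a dilate of
  one fixed bounded function. As R grows the cutoff tends pointwise to the constant
  \<open>bump 0\<close>, not to 1.\<close>

definition cutoff :: "real \<Rightarrow> real \<Rightarrow> ('m::finite, 'k::finite) grushin \<Rightarrow> real" where
  "cutoff \<alpha> R g = bump (dilation \<alpha> (1 / R) g)"

lemma norm_dilation_le:
  assumes "0 \<le> \<alpha>" "0 \<le> c" "c \<le> 1"
  shows "norm (dilation \<alpha> c g) \<le> c * norm g"
proof -
  have "c powr (\<alpha> + 1) \<le> c"
  proof (cases "c = 0")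
    case False
    then have "c powr (\<alpha> + 1) \<le> c powr 1" using assms by (intro powr_mono') auto
    then show ?thesis using assms False by simp
  qed simp
  then have "(c powr (\<alpha> + 1) * norm (snd g))\<^sup>2 \<le> (c * norm (snd g))\<^sup>2"
    by (intro power_mono mult_right_mono) auto
  then have "norm (dilation \<alpha> c g) \<le> sqrt ((c * norm (fst g))\<^sup>2 + (c * norm (snd g))\<^sup>2)"
    using assms by (simp add: dilation_def norm_Pair power_mult_distrib)
  also have "\<dots> = sqrt (c\<^sup>2 * ((norm (fst g))\<^sup>2 + (norm (snd g))\<^sup>2))"
    by (simp add: power_mult_distrib distrib_left)
  also have "\<dots> = c * norm g"
    using assms by (simp add: real_sqrt_mult norm_prod_def)
  finally show ?thesis .
qed

lemma cutoff_Cc_infty: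
  assumes "0 < R"
  shows "cutoff \<alpha> R \<in> (Cc_infty :: (('m::finite, 'k::finite) grushin \<Rightarrow> real) set)"
proof -
  have "continuously_differentiable r (cutoff \<alpha> R :: ('m, 'k) grushin \<Rightarrow> real)" for r
    unfolding cutoff_def[abs_def]
    by (rule continuously_differentiable_compose_linear[OF bounded_linear_dilation Cc_infty_smooth[OF bump_Cc_infty]])
  moreover have "bounded {g :: ('m, 'k) grushin. cutoff \<alpha> R g \<noteq> 0}"
  proof (rule bounded_subset)
    show "bounded (dilation \<alpha> R ` cball (0 :: ('m, 'k) grushin) 1)"
      by (intro bounded_linear_image bounded_cball bounded_linear_dilation)
    show "{g :: ('m, 'k) grushin. cutoff \<alpha> R g \<noteq> 0} \<subseteq> dilation \<alpha> R ` cball 0 1"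
    proof safe
      fix g :: "('m, 'k) grushin" assume g: "cutoff \<alpha> R g \<noteq> 0"
      have "norm (dilation \<alpha> (1 / R) g) \<le> 1"
      proof (rule ccontr)
        assume "\<not> ?thesis"
        then have "cutoff \<alpha> R g = 0" unfolding cutoff_def by (intro bump_eq_0) simp
        then show False using g by simp
      qed
      moreover have "g = dilation \<alpha> R (dilation \<alpha> (1 / R) g)"
        using assms by (simp add: dilation_dilation) (simp add: dilation_def)
      ultimately show "g \<in> dilation \<alpha> R ` cball 0 1" by (metis imageI mem_cball_0)
    qed
  qed
  ultimately show ?thesis unfolding Cc_infty_iff by blast
qed

lemma cutoff_nonneg: "0 \<le> cutoff \<alpha> R g" and cutoff_le_1: "cutoff \<alpha> R g \<le> 1"
  by (simp_all add: cutoff_def bump_nonneg bump_le_1)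

lemma cutoff_tendsto:
  assumes "0 \<le> \<alpha>"
  shows "(\<lambda>n. cutoff \<alpha> (real (Suc n)) (g :: ('m, 'k) grushin)) \<longlonglongrightarrow> bump (0 :: ('m::finite, 'k::finite) grushin)"
proof -
  have "(\<lambda>n. dilation \<alpha> (1 / real (Suc n)) g) \<longlonglongrightarrow> 0"
  proof (rule Lim_null_comparison)
    show "(\<lambda>n. 1 / real (Suc n) * norm g) \<longlonglongrightarrow> 0"
      using tendsto_mult_left_zero[OF LIMSEQ_inverse_real_of_nat, of "norm g"]
      by (simp add: inverse_eq_divide)
    show "\<forall>\<^sub>F n in sequentially. norm (dilation \<alpha> (1 / real (Suc n)) g) \<le> 1 / real (Suc n) * norm g"
      by (intro always_eventually allI norm_dilation_le assms) auto
  qed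
  moreover have "continuous_on UNIV (bump :: ('m, 'k) grushin \<Rightarrow> real)"
    by (rule Cc_infty_continuous[OF bump_Cc_infty])
  then have "isCont (bump :: ('m, 'k) grushin \<Rightarrow> real) 0"
    using continuous_on_eq_continuous_at[OF open_UNIV] by blast
  ultimately show ?thesis unfolding cutoff_def by (rule isCont_tendsto_compose[rotated])
qed

text \<open>By scaling it suffices to treat R = 1, where the left side is bounded and supported in
  the unit ball, on which the cutoff of radius 2 has a positive lower bound. Having a cutoff on the
  right, rather than a constant, is what turns this into an inequality between masses at radii R and
  2R.\<close>

lemma grushin_expr_cutoff_le:
  assumes \<alpha>: "0 \<le> \<alpha>"
  obtains C where "0 \<le> C"
    "\<And>R (g :: ('m::finite, 'k::finite) grushin). 0 < R \<Longrightarrow>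
      \<bar>grushin_expr \<alpha> (cutoff \<alpha> R) g\<bar> \<le> C / R\<^sup>2 * cutoff \<alpha> (2 * R) g"
proof -
  let ?b = "bump :: ('m, 'k) grushin \<Rightarrow> real"
  obtain M where M: "0 \<le> M" "\<And>g. \<bar>grushin_expr \<alpha> ?b g\<bar> \<le> M"
    using continuous_bounded_support_bounded[OF grushin_expr_continuous[OF \<alpha> bump_Cc_infty]
        grushin_expr_bounded_support[OF bump_Cc_infty]] by blast
  \<comment> \<open>On the unit ball the half-dilated point h has norm at most 1/2, so 1 - |h|^2 >=
    1/2 and \<open>bump\<close> at h is at least exp(-2).\<close>
  define C where "C = M * exp 2"
  have base: "\<bar>grushin_expr \<alpha> ?b g\<bar> \<le> C * ?b (dilation \<alpha> (1 / 2) g)" for g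
  proof (cases "g \<in> cball 0 1")
    case True
    let ?h = "dilation \<alpha> (1 / 2) g"
    have "norm ?h \<le> 1 / 2 * norm g" using \<alpha> by (intro norm_dilation_le) auto
    also have "\<dots> \<le> 1 / 2" using True by simp
    finally have "(norm ?h)\<^sup>2 \<le> (1 / 2)\<^sup>2" by (intro power_mono) auto
    then have n: "1 / 2 \<le> 1 - ?h \<bullet> ?h" by (simp add: dot_square_norm power2_eq_square)
    then have "1 / (1 - ?h \<bullet> ?h) \<le> 1 / (1 / 2)" by (intro divide_left_mono) auto
    then have "exp (- 2) \<le> exp (- 1 / (1 - ?h \<bullet> ?h))" by simp
    also have "\<dots> = ?b ?h" using n by (simp add: bump_def flat_exp_def)
    finally have "exp 2 * exp (- 2) \<le> exp 2 * ?b ?h" by (rule mult_left_mono) simp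
    then have "1 \<le> exp 2 * ?b ?h" by (simp add: exp_add[symmetric])
    then have "M * 1 \<le> M * (exp 2 * ?b ?h)" using M by (intro mult_left_mono) auto
    then show ?thesis using M(2)[of g] by (simp add: C_def mult.assoc)
  next
    case False
    have "grushin_expr \<alpha> ?b g = 0"
      by (rule grushin_expr_eq_0_outside[OF closed_cball _ False]) (simp add: bump_eq_0)
    then show ?thesis using M by (simp add: C_def bump_nonneg)
  qed
  show thesis
  proof (rule that)
    show "0 \<le> C" using M by (simp add: C_def)
    fix R :: real and g :: "('m, 'k) grushin" assume R: "0 < R"
    have "grushin_expr \<alpha> (cutoff \<alpha> R) g = (1 / R)\<^sup>2 * grushin_expr \<alpha> ?b (dilation \<alpha> (1 / R) g)"
      unfolding cutoff_def[abs_def] using R by (intro grushin_expr_dilation bump_Cc_infty) auto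
    also have "\<bar>\<dots>\<bar> \<le> (1 / R)\<^sup>2 * (C * ?b (dilation \<alpha> (1 / 2) (dilation \<alpha> (1 / R) g)))"
      using base[of "dilation \<alpha> (1 / R) g"] by (simp add: abs_mult mult_left_mono)
    also have "\<dots> = C / R\<^sup>2 * cutoff \<alpha> (2 * R) g"
      using R by (simp add: cutoff_def dilation_dilation power_divide)
    finally show "\<bar>grushin_expr \<alpha> (cutoff \<alpha> R) g\<bar> \<le> C / R\<^sup>2 * cutoff \<alpha> (2 * R) g" .
  qed
qed

text \<open>An eigenfunction of the operator with eigenvalue xi^2, because it depends on one
  horizontal coordinate only. For xi = 0 it is the constant 1.\<close>

definition wave :: "('m::finite) \<Rightarrow> real \<Rightarrow> ('m, 'k::finite) grushin \<Rightarrow> real" where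
  "wave i \<xi> g = cos (\<xi> * fst g $ i)"

lemma wave_partials:
  fixes v :: "('m::finite, 'k::finite) grushin"
  shows "partial v (wave i \<xi>) g = - \<xi> * fst v $ i * sin (\<xi> * fst g $ i)"
    and "partial v (partial v (wave i \<xi>)) g = - (\<xi> * fst v $ i)\<^sup>2 * wave i \<xi> g"
    and "continuously_differentiable r (wave i \<xi> :: ('m, 'k) grushin \<Rightarrow> real)"
proof -
  \<comment> \<open>Combinations of sin and cos form a class closed under differentiation, unlike
    cos alone, so the induction goes through.\<close>
  have sc: "continuously_differentiable r (\<lambda>x. a * sin x + b * cos x)" for a b :: real and r
  proof (induction r arbitrary: a b)
    case 0 show ?case by (simp, intro continuous_intros)
  next
    case (Suc r)
    show ?case
    proof (rule continuously_differentiable_SucI)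
      show "((\<lambda>x. a * sin x + b * cos x) has_derivative (\<lambda>v. ((- b) * sin x + a * cos x) * v)) (at x)" for x
        by (auto intro!: derivative_eq_intros simp: algebra_simps)
      show "continuously_differentiable r (\<lambda>x. ((- b) * sin x + a * cos x) * v)" for v
        by (intro continuously_differentiable_mult continuously_differentiable_const Suc.IH)
    qed
  qed
  have lin: "bounded_linear (\<lambda>g :: ('m, 'k) grushin. \<xi> * fst g $ i)"
    by (intro bounded_linear_compose[OF bounded_linear_mult_right]
        bounded_linear_compose[OF bounded_linear_vec_nth] bounded_linear_fst)
  show "continuously_differentiable r (wave i \<xi> :: ('m, 'k) grushin \<Rightarrow> real)"
    using continuously_differentiable_compose_real[OF sc[of r 0 1] continuously_differentiable_linear[OF lin]]
    by (simp add: wave_def[abs_def])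
  have D: "((\<lambda>g :: ('m, 'k) grushin. \<xi> * fst g $ i) has_derivative (\<lambda>v. \<xi> * fst v $ i)) (at g)" for g
    by (rule bounded_linear_imp_has_derivative[OF lin])
  have 1: "partial v (wave i \<xi>) g = - \<xi> * fst v $ i * sin (\<xi> * fst g $ i)" for g :: "('m, 'k) grushin"
    unfolding wave_def[abs_def]
    by (rule partial_eq[THEN trans, OF has_derivative_cos[OF D]]) (simp add: mult.commute)
  show "partial v (wave i \<xi>) g = - \<xi> * fst v $ i * sin (\<xi> * fst g $ i)" by (rule 1)
  have "partial v (wave i \<xi>) = (\<lambda>g :: ('m, 'k) grushin. - \<xi> * fst v $ i * sin (\<xi> * fst g $ i))"
    using 1 by (rule ext)
  then show "partial v (partial v (wave i \<xi>)) g = - (\<xi> * fst v $ i)\<^sup>2 * wave i \<xi> g"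
    by (simp add: wave_def) (rule partial_eq[THEN trans,
          OF has_derivative_mult_right[OF has_derivative_sin[OF D], of "- (\<xi> * fst v $ i)", simplified]],
        simp add: power2_eq_square)
qed

lemma wave_cutoff_Cc_infty:
  "0 < R \<Longrightarrow> (\<lambda>g :: ('m::finite, 'k::finite) grushin. wave i \<xi> g * cutoff \<alpha> R g) \<in> Cc_infty"
  by (intro Cc_infty_mult_smooth wave_partials(3) cutoff_Cc_infty)

text \<open>By the Leibniz rule the defect is the wave times the operator applied to the cutoff, of
  order R^(-2), plus a cross term with the derivative of the cutoff along x_i, of order 1/R. The y
  directions give no cross terms since the wave is constant there.\<close>

lemma grushin_expr_wave_cutoff:
  assumes \<alpha>: "0 \<le> \<alpha>"
  obtains C where "0 \<le> C"
    "\<And>R (g :: ('m::finite, 'k::finite) grushin). 1 \<le> R \<Longrightarrow>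
      \<bar>grushin_expr \<alpha> (\<lambda>g. wave i \<xi> g * cutoff \<alpha> R g) g - \<xi>\<^sup>2 * (wave i \<xi> g * cutoff \<alpha> R g)\<bar> \<le> C / R"
proof -
  let ?b = "bump :: ('m, 'k) grushin \<Rightarrow> real"
  define e :: "('m, 'k) grushin" where "e = (axis i 1, 0)"
  obtain C1 where C1: "0 \<le> C1" "\<And>R (g :: ('m, 'k) grushin). 0 < R \<Longrightarrow>
      \<bar>grushin_expr \<alpha> (cutoff \<alpha> R) g\<bar> \<le> C1 / R\<^sup>2 * cutoff \<alpha> (2 * R) g"
    using grushin_expr_cutoff_le[OF \<alpha>] by blast
  obtain C2 where C2: "0 \<le> C2" "\<And>g. \<bar>partial e ?b g\<bar> \<le> C2"
    using continuous_bounded_support_bounded[OF Cc_infty_continuous[OF Cc_infty_partial[OF bump_Cc_infty]]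
        Cc_infty_bounded_support[OF Cc_infty_partial[OF bump_Cc_infty]]] by blast
  show thesis
  proof (rule that)
    show "0 \<le> C1 + 2 * \<bar>\<xi>\<bar> * C2" using C1 C2 by simp
    fix R :: real and g :: "('m, 'k) grushin" assume R: "1 \<le> R"
    let ?c = "cutoff \<alpha> R :: ('m, 'k) grushin \<Rightarrow> real"
    let ?w = "wave i \<xi> :: ('m, 'k) grushin \<Rightarrow> real"
    have cs: "continuously_differentiable r ?c" for r
      using R by (intro Cc_infty_smooth cutoff_Cc_infty) simp
    have pe: "partial e ?c g = 1 / R * partial e ?b (dilation \<alpha> (1 / R) g)"
      unfolding cutoff_def[abs_def]
      by (rule second_partial_compose_linear(1)[OF bounded_linear_dilation Cc_infty_smooth[OF bump_Cc_infty]])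
        (simp add: e_def dilation_def)
    have pm: "partial v (partial v (\<lambda>g. ?w g * ?c g)) g
        = ?w g * partial v (partial v ?c) g - 2 * \<xi> * fst v $ i * sin (\<xi> * fst g $ i) * partial v ?c g
          - (\<xi> * fst v $ i)\<^sup>2 * ?w g * ?c g" for v
      by (simp add: second_partial_mult[OF wave_partials(3) cs] wave_partials(1,2))
    have X: "partial (axis l 1, 0) (partial (axis l 1, 0) (\<lambda>g. ?w g * ?c g)) g
        = ?w g * partial (axis l 1, 0) (partial (axis l 1, 0) ?c) g
          - (if l = i then 2 * \<xi> * sin (\<xi> * fst g $ i) * partial e ?c g + \<xi>\<^sup>2 * (?w g * ?c g) else 0)" for l
      unfolding pm by (simp add: axis_def e_def)
    have Y: "partial (0, axis j 1) (partial (0, axis j 1) (\<lambda>g. ?w g * ?c g)) g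
        = ?w g * partial (0, axis j 1) (partial (0, axis j 1) ?c) g" for j
      unfolding pm by simp
    have "grushin_expr \<alpha> (\<lambda>g. ?w g * ?c g) g - \<xi>\<^sup>2 * (?w g * ?c g)
        = ?w g * grushin_expr \<alpha> ?c g + 2 * \<xi> * sin (\<xi> * fst g $ i) * partial e ?c g"
      unfolding grushin_expr_def X Y
      by (simp add: sum_subtractf sum_distrib_left[symmetric] algebra_simps)
    also have "\<bar>\<dots>\<bar> \<le> 1 * (C1 / R) + 2 * \<bar>\<xi>\<bar> * 1 * (1 / R * C2)"
    proof (rule order_trans[OF abs_triangle_ineq add_mono])
      have "\<bar>grushin_expr \<alpha> ?c g\<bar> \<le> C1 / R\<^sup>2 * cutoff \<alpha> (2 * R) g" using C1(2)[of R g] R by simp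
      also have "\<dots> \<le> C1 / R\<^sup>2 * 1" using C1 by (intro mult_left_mono cutoff_le_1) auto
      also have "\<dots> \<le> C1 / R" using C1 R by (auto intro!: divide_left_mono simp: power2_eq_square)
      finally show "\<bar>?w g * grushin_expr \<alpha> ?c g\<bar> \<le> 1 * (C1 / R)"
        unfolding abs_mult by (intro mult_mono) (auto simp: wave_def)
      show "\<bar>2 * \<xi> * sin (\<xi> * fst g $ i) * partial e ?c g\<bar> \<le> 2 * \<bar>\<xi>\<bar> * 1 * (1 / R * C2)"
        unfolding abs_mult pe using R C2 by (intro mult_mono) auto
    qed
    finally show "\<bar>grushin_expr \<alpha> (\<lambda>g. ?w g * ?c g) g - \<xi>\<^sup>2 * (?w g * ?c g)\<bar> \<le> (C1 + 2 * \<bar>\<xi>\<bar> * C2) / R"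
      by (simp add: add_divide_distrib)
  qed
qed

section \<open>Conservation of mass and the marginal in a horizontal direction\<close>

text \<open>Opens the existential quantifier in \<open>heat_kernel\<close>: \<open>T\<close> is one
  chosen semigroup, tied to \<open>K\<close> only almost everywhere for each \<open>t\<close> and
  \<open>f\<close>.\<close>

locale grushin_heat =
  fixes \<alpha> :: real
    and K :: "real \<Rightarrow> ('m::finite, 'k::finite) grushin \<Rightarrow> ('m, 'k) grushin \<Rightarrow> real"
    and T :: "real \<Rightarrow> (('m, 'k) grushin \<Rightarrow> real) \<Rightarrow> ('m, 'k) grushin \<Rightarrow> real"
  assumes \<alpha>: "0 \<le> \<alpha>"
    and K_borel: "set_borel_measurable borel ({0<..} \<times> UNIV) (\<lambda>(t, g, h). K t g h)"
    and K_nonneg: "0 < t \<Longrightarrow> 0 \<le> K t g h"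
    and K_sym: "0 < t \<Longrightarrow> K t g h = K t h g"
    and heat: "heat_semigroup \<alpha> T"
    and T_kernel: "0 < t \<Longrightarrow> f \<in> Lp 2 \<Longrightarrow> AE g in lborel.
      integrable lborel (\<lambda>h. K t g h * f h) \<and> T t f g = (LINT h|lborel. K t g h * f h)"
begin

section \<open>Symmetry and positivity inherited from the kernel\<close>

lemma K_measurable:
  assumes t: "0 < t"
  shows "(\<lambda>(g, h). K t g h) \<in> borel_measurable (borel \<Otimes>\<^sub>M borel)"
proof -
  have "(\<lambda>x. indicator ({0<..} \<times> UNIV) x *\<^sub>R (case x of (t, g, h) \<Rightarrow> K t g h)) \<in> borel_measurable borel"
    using K_borel by (simp add: set_borel_measurable_def)
  moreover have "(\<lambda>p. (t, p)) \<in> borel_measurable (borel \<Otimes>\<^sub>M borel :: (('m, 'k) grushin \<times> ('m, 'k) grushin) measure)"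
    unfolding borel_prod by (intro borel_measurable_continuous_onI continuous_intros)
  ultimately have "(\<lambda>p. indicator ({0<..} \<times> UNIV) (t, p) *\<^sub>R (case (t, p) of (t, g, h) \<Rightarrow> K t g h))
      \<in> borel_measurable (borel \<Otimes>\<^sub>M borel)"
    by (rule measurable_compose[rotated])
  then show ?thesis using t by (simp add: case_prod_beta')
qed

lemma C0: "C0_semigroup_L2 T"
  using heat by (simp add: heat_semigroup_def)

lemma T_mem: "0 \<le> t \<Longrightarrow> f \<in> Lp 2 \<Longrightarrow> T t f \<in> Lp 2"
  using C0 by (simp add: C0_semigroup_L2_def)

lemma T_zero: "f \<in> Lp 2 \<Longrightarrow> AE g in lborel. T 0 f g = f g"
  using C0 by (simp add: C0_semigroup_L2_def)

text \<open>For s > 0 this is Fubini and the symmetry of the kernel; absolute integrability comes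
  from the kernel representation of T applied to |f|, whose product with |g| is integrable. At s = 0
  there is no kernel, and T is the identity almost everywhere.\<close>

lemma T_symmetric:
  assumes s: "0 \<le> s" and f: "f \<in> Lp 2" and g: "g \<in> Lp 2"
  shows "ip (T s f) g = ip f (T s g)"
proof (cases "s = 0")
  case True
  have "ip (T 0 f) g = ip f g"
    using ip_cong_AE_right[OF g T_mem[OF _ f] f T_zero[OF f]] by (simp add: ip_commute)
  also have "\<dots> = ip f (T 0 g)"
    using ip_cong_AE_right[OF f T_mem[OF _ g] g T_zero[OF g]] by simp
  finally show ?thesis using True by simp
next
  case False
  then have s: "0 < s" using s by simp
  have m [measurable]: "f \<in> borel_measurable borel" "g \<in> borel_measurable borel"
    using f g by (auto intro: Lp2_measurable)
  have Tm [measurable]: "T s f \<in> borel_measurable borel" "T s g \<in> borel_measurable borel"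
      "T s (\<lambda>h. \<bar>f h\<bar>) \<in> borel_measurable borel"
    using T_mem s f g Lp2_abs[OF f] by (auto intro: Lp2_measurable)
  have Km [measurable]: "(\<lambda>(x, y). K s x y) \<in> borel_measurable (borel \<Otimes>\<^sub>M borel)"
    by (rule K_measurable[OF s])
  define F where "F = (\<lambda>x y. g x * (K s x y * f y))"
  have "integrable lborel (\<lambda>x. \<bar>g x\<bar> * T s (\<lambda>h. \<bar>f h\<bar>) x)"
    using s by (intro Lp2_integrable_mult Lp2_abs T_mem f g) auto
  moreover have ae: "AE x in lborel. \<bar>g x\<bar> * T s (\<lambda>h. \<bar>f h\<bar>) x = (LINT y|lborel. norm (F x y))"
    using T_kernel[OF s Lp2_abs[OF f]]
    by eventually_elim (auto simp: F_def abs_mult K_nonneg[OF s])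
  ultimately have int1: "integrable lborel (\<lambda>x. LINT y|lborel. norm (F x y))"
    by (subst (asm) integrable_cong_AE) (auto simp: F_def)
  have int: "integrable (lborel \<Otimes>\<^sub>M lborel) (case_prod F)"
  proof (rule lborel_pair.Fubini_integrable)
    show "AE x in lborel. integrable lborel (\<lambda>y. case_prod F (x, y))"
      using T_kernel[OF s f] by eventually_elim (auto simp: F_def)
  qed (use int1 in \<open>auto simp: F_def\<close>)
  have "ip (T s f) g = (LINT x|lborel. (LINT y|lborel. F x y))"
    unfolding ip_def
  proof (rule integral_cong_AE)
    show "AE x in lborel. T s f x * g x = (LINT y|lborel. F x y)"
      using T_kernel[OF s f] by eventually_elim (auto simp: F_def)
  qed (auto simp: F_def)
  also have "\<dots> = (LINT y|lborel. (LINT x|lborel. F x y))"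
    using lborel_pair.Fubini_integral[OF int] by simp
  also have "\<dots> = ip f (T s g)"
    unfolding ip_def
  proof (rule integral_cong_AE)
    show "AE y in lborel. (LINT x|lborel. F x y) = f y * T s g y"
      using T_kernel[OF s g]
    proof eventually_elim
      case (elim y)
      have "(LINT x|lborel. F x y) = (LINT x|lborel. f y * (K s y x * g x))"
        by (simp add: F_def K_sym[OF s, of _ y] mult.commute mult.left_commute)
      then show ?case using elim by simp
    qed
  qed (auto simp: F_def)
  finally show ?thesis .
qed

sublocale symmetric_semigroup T
  by unfold_locales (use C0 T_symmetric in auto)

lemma T_nonneg:
  assumes t: "0 \<le> t" and f: "f \<in> Lp 2" and nonneg: "\<And>x. 0 \<le> f x"
  shows "AE g in lborel. 0 \<le> T t f g"
proof (cases "t = 0")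
  case True
  then show ?thesis using T_zero[OF f] nonneg by (auto elim: eventually_mono)
next
  case False
  then have "0 < t" using t by simp
  from T_kernel[OF this f] show ?thesis
    by eventually_elim (auto intro!: integral_nonneg_AE simp: K_nonneg[OF \<open>0 < t\<close>] nonneg)
qed

lemma T_derivative:
  assumes f: "f \<in> Lp 2" and \<phi>: "\<phi> \<in> Cc_infty" and s: "s \<in> {0..S}"
  shows "((\<lambda>s. ip (T s f) \<phi>) has_real_derivative - ip (T s f) (grushin_expr \<alpha> \<phi>)) (at s within {0..S})"
  using generator_derivative[OF f heat_semigroup_generator[OF \<alpha> heat \<phi>] s]
    ip_cmult_right[of "T s f" "-1" "grushin_expr \<alpha> \<phi>"] by simp

text \<open>The cutoff lives in a Euclidean ball of radius R^N for an integer N >= alpha + 1, whose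
  volume is polynomial in R. The rate is immaterial; the exponent is even so that a bootstrap
  lowering it by 2 ends exactly at 0.\<close>

lemma cutoff_norm_le:
  obtains C n where "0 \<le> C"
    "\<And>R. 1 \<le> R \<Longrightarrow> Lp_norm 2 (cutoff \<alpha> R :: ('m, 'k) grushin \<Rightarrow> real) \<le> C * R ^ (2 * n)"
proof -
  define D where "D = DIM(('m, 'k) grushin)"
  obtain N :: nat where N: "\<alpha> + 1 \<le> real N" using real_arch_simple by blast
  define V where "V = unit_ball_vol (real D)"
  have V: "0 \<le> V" by (simp add: V_def)
  have "Lp_norm 2 (cutoff \<alpha> R :: ('m, 'k) grushin \<Rightarrow> real) \<le> sqrt V * R ^ (2 * (N * D))" if R: "1 \<le> R" for R
  proof -
    let ?c = "cutoff \<alpha> R :: ('m, 'k) grushin \<Rightarrow> real"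
    have supp: "?c g = 0" if g: "g \<notin> cball 0 (R ^ N)" for g
    proof -
      have "1 \<le> norm (dilation \<alpha> (1 / R) g)"
      proof (rule ccontr)
        assume lt: "\<not> ?thesis"
        have RN: "R powr (\<alpha> + 1) \<le> R ^ N"
          using R N powr_mono[of "\<alpha> + 1" "real N" R] by (simp add: powr_realpow)
        have R1: "R \<le> R powr (\<alpha> + 1)" using R \<alpha> powr_mono[of 1 "\<alpha> + 1" R] by simp
        let ?h = "dilation \<alpha> (1 / R) g"
        have g_eq: "g = dilation \<alpha> R ?h"
          using R by (simp add: dilation_dilation) (simp add: dilation_def)
        have "norm g = sqrt ((R * norm (fst ?h))\<^sup>2 + (R powr (\<alpha> + 1) * norm (snd ?h))\<^sup>2)"
          using R by (subst g_eq) (simp add: dilation_def norm_Pair power_mult_distrib)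
        also have "\<dots> \<le> sqrt ((R ^ N * norm (fst ?h))\<^sup>2 + (R ^ N * norm (snd ?h))\<^sup>2)"
          using R RN R1 by (intro real_sqrt_le_mono add_mono power_mono mult_right_mono) auto
        also have "\<dots> = sqrt ((R ^ N)\<^sup>2 * ((norm (fst ?h))\<^sup>2 + (norm (snd ?h))\<^sup>2))"
          by (simp add: power_mult_distrib distrib_left)
        also have "\<dots> = R ^ N * norm ?h"
          using R by (simp add: real_sqrt_mult norm_prod_def)
        also have "\<dots> \<le> R ^ N * 1" using R lt by (intro mult_left_mono) auto
        finally show False using g by simp
      qed
      then show ?thesis unfolding cutoff_def by (rule bump_eq_0)
    qed
    have "ip ?c ?c \<le> (LINT g|lborel. indicator (cball 0 (R ^ N)) (g :: ('m, 'k) grushin))"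
      unfolding ip_def
    proof (rule integral_mono)
      have c: "?c \<in> Lp 2" using R by (intro Cc_infty_Lp2 cutoff_Cc_infty) auto
      show "integrable lborel (\<lambda>g. ?c g * ?c g)" by (rule Lp2_integrable_mult[OF c c])
      show "integrable lborel (indicator (cball 0 (R ^ N)) :: ('m, 'k) grushin \<Rightarrow> real)"
        by (intro integrable_real_indicator emeasure_bounded_finite) auto
      show "?c g * ?c g \<le> indicator (cball 0 (R ^ N)) g" for g
        using supp[of g] mult_mono[OF cutoff_le_1 cutoff_le_1 _ cutoff_nonneg, of \<alpha> R g \<alpha> R g]
        by (cases "g \<in> cball 0 (R ^ N)") (auto simp: cutoff_nonneg)
    qed
    also have "\<dots> = V * (R ^ N) ^ D"
      using R content_cball[of "R ^ N" "0 :: ('m, 'k) grushin"] by (simp add: V_def D_def)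
    also have "\<dots> \<le> V * (R ^ (2 * (N * D)))\<^sup>2"
    proof (rule mult_left_mono[OF _ V])
      have "(R ^ N) ^ D = R ^ (N * D)" by (rule power_mult[symmetric])
      also have "\<dots> \<le> R ^ (2 * (2 * (N * D)))" using R by (intro power_increasing) auto
      also have "\<dots> = (R ^ (2 * (N * D)))\<^sup>2" by (simp add: power_mult[symmetric] mult.commute)
      finally show "(R ^ N) ^ D \<le> (R ^ (2 * (N * D)))\<^sup>2" .
    qed
    finally have "sqrt (ip ?c ?c) \<le> sqrt (V * (R ^ (2 * (N * D)))\<^sup>2)" by (rule real_sqrt_le_mono)
    then show ?thesis using R by (simp add: Lp_norm_2_eq real_sqrt_mult)
  qed
  then show thesis using V by (intro that[of "sqrt V" "N * D"]) auto
qed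

text \<open>Since \<open>\<bar>\<L> \<chi>\<^sub>R\<bar> \<le> C R\<^sup>-\<^sup>2 \<chi>\<^sub>2\<^sub>R\<close>, a bound of order \<open>R\<^sup>2\<^sup>n\<^sup>+\<^sup>2\<close> on the mass inside \<open>\<chi>\<^sub>R\<close> improves
  to one of order \<open>R\<^sup>2\<^sup>n\<close>, so finitely many steps lead from the \<open>L\<^sup>2\<close> bound to a uniform one.\<close>

lemma cutoff_mass_bounded:
  assumes f: "f \<in> Lp 2" and nonneg: "\<And>g. 0 \<le> f g" and f1: "integrable lborel f" and S: "0 \<le> S"
  obtains C where "0 \<le> C" "\<And>R s. 1 \<le> R \<Longrightarrow> s \<in> {0..S} \<Longrightarrow> ip (T s f) (cutoff \<alpha> R) \<le> C"
proof -
  define m where "m R s = ip (T s f) (cutoff \<alpha> R)" for R s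
  obtain C1 where C1: "0 \<le> C1" "\<And>R (g :: ('m, 'k) grushin). 0 < R \<Longrightarrow>
      \<bar>grushin_expr \<alpha> (cutoff \<alpha> R) g\<bar> \<le> C1 / R\<^sup>2 * cutoff \<alpha> (2 * R) g"
    using grushin_expr_cutoff_le[OF \<alpha>] by blast
  define I where "I = (LINT g|lborel. f g)"
  have I: "0 \<le> I" unfolding I_def by (intro integral_nonneg_AE) (simp add: nonneg)
  have c2: "cutoff \<alpha> R \<in> (Lp 2 :: (('m, 'k) grushin \<Rightarrow> real) set)" if "1 \<le> R" for R
    using that by (intro Cc_infty_Lp2 cutoff_Cc_infty) auto
  have m0: "m R 0 \<le> I" if R: "1 \<le> R" for R
  proof -
    have "m R 0 = ip f (cutoff \<alpha> R)"
      unfolding m_def ip_commute[of _ "cutoff \<alpha> R"]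
      using T_zero[OF f] c2[OF R] f by (intro ip_cong_AE_right T_mem) auto
    also have "\<dots> \<le> I" unfolding ip_def I_def
    proof (rule integral_mono[OF Lp2_integrable_mult[OF f c2[OF R]] f1])
      show "f g * cutoff \<alpha> R g \<le> f g" for g
        using mult_left_mono[OF cutoff_le_1[of \<alpha> R g] nonneg[of g]] by simp
    qed
    finally show ?thesis .
  qed
  \<comment> \<open>Positivity of \<open>T s f\<close> allows the pointwise bound on the cutoff to
    be integrated, giving the mass at radius 2R.\<close>
  have growth: "\<bar>ip (T s f) (grushin_expr \<alpha> (cutoff \<alpha> R))\<bar> \<le> C1 / R\<^sup>2 * m (2 * R) s"
    if R: "1 \<le> R" and s: "s \<in> {0..S}" for R s
  proof -
    have Ts: "T s f \<in> Lp 2" using s f by (intro T_mem) auto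
    have L: "grushin_expr \<alpha> (cutoff \<alpha> R) \<in> (Lp 2 :: (('m, 'k) grushin \<Rightarrow> real) set)"
      using R by (intro grushin_expr_Lp2[OF \<alpha>] cutoff_Cc_infty) auto
    have "\<bar>ip (T s f) (grushin_expr \<alpha> (cutoff \<alpha> R))\<bar> \<le> (LINT g|lborel. \<bar>T s f g * grushin_expr \<alpha> (cutoff \<alpha> R) g\<bar>)"
      unfolding ip_def by (rule integral_abs_bound)
    also have "\<dots> \<le> (LINT g|lborel. T s f g * (C1 / R\<^sup>2 * cutoff \<alpha> (2 * R) g))"
    proof (rule integral_mono_AE)
      show "integrable lborel (\<lambda>g. \<bar>T s f g * grushin_expr \<alpha> (cutoff \<alpha> R) g\<bar>)"
        using Lp2_integrable_mult[OF Ts L] by simp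
      show "integrable lborel (\<lambda>g. T s f g * (C1 / R\<^sup>2 * cutoff \<alpha> (2 * R) g))"
        using R by (intro Lp2_integrable_mult[OF Ts] Lp2_cmult c2) auto
      have "AE g in lborel. 0 \<le> T s f g" using s by (intro T_nonneg[OF _ f nonneg]) auto
      then show "AE g in lborel. \<bar>T s f g * grushin_expr \<alpha> (cutoff \<alpha> R) g\<bar>
          \<le> T s f g * (C1 / R\<^sup>2 * cutoff \<alpha> (2 * R) g)"
      proof eventually_elim
        case (elim g)
        then show ?case using mult_left_mono[OF C1(2)[of R g], of "T s f g"] R by (simp add: abs_mult)
      qed
    qed
    also have "\<dots> = C1 / R\<^sup>2 * m (2 * R) s"
      unfolding m_def ip_cmult_right[symmetric] by (simp add: ip_def)
    finally show ?thesis .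
  qed
  \<comment> \<open>The mean value inequality in time, starting from the initial mass, which is at
    most I for every R.\<close>
  have step: "m R s \<le> I + B * S"
    if R: "1 \<le> R" and s: "s \<in> {0..S}" and B: "\<And>r. r \<in> {0..S} \<Longrightarrow> C1 / R\<^sup>2 * m (2 * R) r \<le> B" for R s B
  proof -
    have "norm (m R s - m R 0) \<le> B * norm (s - 0)"
    proof (rule field_differentiable_bound[where S = "{0..S}"])
      fix r assume r: "r \<in> {0..S}"
      show "(m R has_real_derivative - ip (T r f) (grushin_expr \<alpha> (cutoff \<alpha> R))) (at r within {0..S})"
        unfolding m_def[abs_def] using R r by (intro T_derivative f cutoff_Cc_infty) auto
      show "norm (- ip (T r f) (grushin_expr \<alpha> (cutoff \<alpha> R))) \<le> B"
        using growth[OF R r] B[OF r] by simp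
    qed (use s S in auto)
    moreover have "0 \<le> B" using growth[OF R s] B[OF s] by linarith
    then have "B * norm (s - 0) \<le> B * S" using s by (intro mult_left_mono) auto
    ultimately show ?thesis using m0[OF R] by simp
  qed
  obtain C2 n where C2: "0 \<le> C2" "\<And>R. 1 \<le> R \<Longrightarrow>
      Lp_norm 2 (cutoff \<alpha> R :: ('m, 'k) grushin \<Rightarrow> real) \<le> C2 * R ^ (2 * n)"
    by (rule cutoff_norm_le) (rule that)
  obtain B2 where B2: "0 \<le> B2" "\<And>s. 0 \<le> s \<Longrightarrow> s \<le> S \<Longrightarrow> Lp_norm 2 (T s f) \<le> B2"
    using T_locally_bounded[OF f S] by blast
  \<comment> \<open>Downward induction on the exponent: Cauchy-Schwarz supplies the start at n, and
    each use of \<open>step\<close> gains the factor R^(-2). The goal at exponent 0 is the uniform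
    bound.\<close>
  have "\<exists>C\<ge>0. \<forall>R\<ge>1. \<forall>s\<in>{0..S}. m R s \<le> C * R ^ (2 * 0)"
  proof (rule inc_induct[of 0 n "\<lambda>k. \<exists>C\<ge>0. \<forall>R\<ge>1. \<forall>s\<in>{0..S}. m R s \<le> C * R ^ (2 * k)"])
    show "\<exists>C\<ge>0. \<forall>R\<ge>1. \<forall>s\<in>{0..S}. m R s \<le> C * R ^ (2 * n)"
    proof (intro exI[of _ "B2 * C2"] conjI allI impI ballI)
      fix R s :: real assume R: "1 \<le> R" and s: "s \<in> {0..S}"
      have "m R s \<le> Lp_norm 2 (T s f) * Lp_norm 2 (cutoff \<alpha> R :: ('m, 'k) grushin \<Rightarrow> real)"
        unfolding m_def using Cauchy_Schwarz_ip[OF T_mem[OF _ f] c2[OF R], of s] s by simp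
      also have "\<dots> \<le> B2 * (C2 * R ^ (2 * n))"
        using B2 C2 R s by (intro mult_mono) (auto simp: Lp_norm_2_nonneg)
      finally show "m R s \<le> B2 * C2 * R ^ (2 * n)" by simp
    qed (use B2 C2 in simp)
  next
    fix k assume "\<exists>C\<ge>0. \<forall>R\<ge>1. \<forall>s\<in>{0..S}. m R s \<le> C * R ^ (2 * Suc k)"
    then obtain C where C: "0 \<le> C" "\<And>R s. 1 \<le> R \<Longrightarrow> s \<in> {0..S} \<Longrightarrow> m R s \<le> C * R ^ (2 * Suc k)"
      by blast
    let ?B = "C1 * C * 2 ^ (2 * Suc k)"
    show "\<exists>C\<ge>0. \<forall>R\<ge>1. \<forall>s\<in>{0..S}. m R s \<le> C * R ^ (2 * k)"
    proof (intro exI[of _ "I + ?B * S"] conjI allI impI ballI)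
      fix R s :: real assume R: "1 \<le> R" and s: "s \<in> {0..S}"
      have "m R s \<le> I + ?B * R ^ (2 * k) * S"
      proof (rule step[OF R s])
        fix r assume r: "r \<in> {0..S}"
        have "C1 / R\<^sup>2 * m (2 * R) r \<le> C1 / R\<^sup>2 * (C * (2 * R) ^ (2 * Suc k))"
          using C1 R r by (intro mult_left_mono C(2)) auto
        also have "\<dots> = ?B * R ^ (2 * k)"
          using R by (simp add: power_mult_distrib power2_eq_square)
        finally show "C1 / R\<^sup>2 * m (2 * R) r \<le> ?B * R ^ (2 * k)" .
      qed
      also have "\<dots> \<le> I * R ^ (2 * k) + ?B * R ^ (2 * k) * S"
        using mult_left_mono[OF one_le_power[OF R, of "2 * k"] I] by simp
      finally show "m R s \<le> (I + ?B * S) * R ^ (2 * k)" by (simp add: algebra_simps)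
    qed (use I C1 C S in simp)
  qed simp
  then show thesis using that by (auto simp: m_def)
qed

lemma bump_0_pos: "0 < bump (0 :: ('m, 'k) grushin)"
  by (rule bump_pos) simp

text \<open>Fatou's lemma along the cutoffs, whose limit is \<open>bump 0\<close>; this explains the
  constant C / \<open>bump 0\<close>.\<close>

lemma T_integrable:
  assumes f: "f \<in> Lp 2" and nonneg: "\<And>g. 0 \<le> f g" and f1: "integrable lborel f" and S: "0 \<le> S"
  obtains C where "0 \<le> C"
    "\<And>s. s \<in> {0..S} \<Longrightarrow> integrable lborel (T s f) \<and> (LINT g|lborel. T s f g) \<le> C"
proof -
  obtain C where C: "0 \<le> C" "\<And>R s. 1 \<le> R \<Longrightarrow> s \<in> {0..S} \<Longrightarrow> ip (T s f) (cutoff \<alpha> R) \<le> C"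
    using cutoff_mass_bounded[OF assms] by blast
  let ?b = "bump (0 :: ('m, 'k) grushin)"
  have "integrable lborel (T s f) \<and> (LINT g|lborel. T s f g) \<le> C / ?b" if s: "s \<in> {0..S}" for s
  proof -
    let ?c = "\<lambda>n. cutoff \<alpha> (real (Suc n)) :: ('m, 'k) grushin \<Rightarrow> real"
    have Ts: "T s f \<in> Lp 2" using s f by (intro T_mem) auto
    have m [measurable]: "T s f \<in> borel_measurable borel" using Ts by (rule Lp2_measurable)
    have c2: "?c n \<in> Lp 2" for n by (intro Cc_infty_Lp2 cutoff_Cc_infty) auto
    have cm [measurable]: "?c n \<in> borel_measurable borel" for n using c2 by (rule Lp2_measurable)
    have pos: "AE g in lborel. 0 \<le> T s f g" using s by (intro T_nonneg[OF _ f nonneg]) auto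
    have "(\<integral>\<^sup>+g. ennreal (T s f g * ?b) \<partial>lborel)
        = (\<integral>\<^sup>+g. liminf (\<lambda>n. ennreal (T s f g * ?c n g)) \<partial>lborel)"
    proof (rule nn_integral_cong)
      fix g
      have "(\<lambda>n. ennreal (T s f g * ?c n g)) \<longlonglongrightarrow> ennreal (T s f g * ?b)"
        by (intro tendsto_ennrealI tendsto_mult_left cutoff_tendsto \<alpha>)
      then show "ennreal (T s f g * ?b) = liminf (\<lambda>n. ennreal (T s f g * ?c n g))"
        by (simp add: lim_imp_Liminf)
    qed
    also have "\<dots> \<le> liminf (\<lambda>n. \<integral>\<^sup>+g. ennreal (T s f g * ?c n g) \<partial>lborel)"
    proof (rule nn_integral_liminf)
      fix n
      show "(\<lambda>g. ennreal (T s f g * ?c n g)) \<in> borel_measurable lborel"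
        using borel_measurable_times[OF m cm[of n]] by simp
    qed
    also have "\<dots> \<le> liminf (\<lambda>n::nat. ennreal C)"
    proof (intro Liminf_mono always_eventually allI)
      fix n
      have "(\<integral>\<^sup>+g. ennreal (T s f g * ?c n g) \<partial>lborel) = ennreal (ip (T s f) (?c n))"
        unfolding ip_def using pos
        by (intro nn_integral_eq_integral Lp2_integrable_mult Ts c2) (auto simp: cutoff_nonneg)
      also have "\<dots> \<le> ennreal C" using s by (intro ennreal_leI C(2)) auto
      finally show "(\<integral>\<^sup>+g. ennreal (T s f g * ?c n g) \<partial>lborel) \<le> ennreal C" .
    qed
    also have "\<dots> = ennreal C" by (simp add: Liminf_const)
    finally have le: "(\<integral>\<^sup>+g. ennreal (T s f g * ?b) \<partial>lborel) \<le> ennreal C" .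
    have int: "integrable lborel (\<lambda>g. T s f g * ?b)"
    proof (rule integrableI_nonneg)
      show "AE g in lborel. 0 \<le> T s f g * ?b" using pos bump_0_pos by (auto elim: eventually_mono)
      show "(\<integral>\<^sup>+g. ennreal (T s f g * ?b) \<partial>lborel) < \<infinity>" using le by (rule order_le_less_trans) simp
    qed simp
    have "ennreal (LINT g|lborel. T s f g * ?b) \<le> ennreal C"
      using le pos bump_0_pos
      by (subst nn_integral_eq_integral[symmetric, OF int]) (auto elim: eventually_mono)
    then have "(LINT g|lborel. T s f g * ?b) \<le> C" using C by simp
    then show ?thesis using int bump_0_pos by (simp add: field_simps)
  qed
  then show thesis using C bump_0_pos by (intro that[of "C / ?b"]) auto
qed

text \<open>The truncated wave is an eigenfunction up to an error of order 1/R, and the L^1 norm of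
  \<open>T s f\<close> is bounded on [0, S]. Hence exp(xi^2 s) times the pairing with it has time
  derivative of order 1/R, and is constant in the limit.\<close>

lemma wave_integral:
  assumes f: "f \<in> Lp 2" and nonneg: "\<And>g. 0 \<le> f g" and f1: "integrable lborel f" and S: "0 \<le> S"
  shows "(LINT g|lborel. T S f g * wave i \<xi> g) = exp (- (\<xi>\<^sup>2 * S)) * (LINT g|lborel. f g * wave i \<xi> g)"
proof -
  let ?w = "wave i \<xi> :: ('m, 'k) grushin \<Rightarrow> real"
  let ?b = "bump (0 :: ('m, 'k) grushin)"
  define \<phi> where "\<phi> R g = ?w g * cutoff \<alpha> R g" for R and g :: "('m, 'k) grushin"
  have w1: "\<bar>?w g\<bar> \<le> 1" for g by (simp add: wave_def)
  have wm [measurable]: "?w \<in> borel_measurable borel"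
    using wave_partials(3)[of 0 i \<xi>] by (auto intro: borel_measurable_continuous_onI)
  obtain C where C: "0 \<le> C" "\<And>s. s \<in> {0..S} \<Longrightarrow> integrable lborel (T s f) \<and> (LINT g|lborel. T s f g) \<le> C"
    using T_integrable[OF assms] by blast
  obtain C' where C': "0 \<le> C'" "\<And>R (g :: ('m, 'k) grushin). 1 \<le> R \<Longrightarrow>
      \<bar>grushin_expr \<alpha> (\<phi> R) g - \<xi>\<^sup>2 * \<phi> R g\<bar> \<le> C' / R"
    unfolding \<phi>_def[abs_def] using grushin_expr_wave_cutoff[OF \<alpha>] by blast
  have \<phi>c: "\<phi> R \<in> Cc_infty" if "1 \<le> R" for R
    unfolding \<phi>_def[abs_def] using that by (intro wave_cutoff_Cc_infty) simp
  define E where "E = exp (\<xi>\<^sup>2 * S)"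
  \<comment> \<open>The exponential is the integrating factor that cancels the eigenvalue term in
    the derivative of the pairing.\<close>
  define G where "G R s = exp (\<xi>\<^sup>2 * s) * ip (T s f) (\<phi> R)" for R s
  have bound: "\<bar>G R S - G R 0\<bar> \<le> (E * (C' / R * C)) * S" if R: "1 \<le> R" for R
  proof -
    define D where "D s = exp (\<xi>\<^sup>2 * s) * (\<xi>\<^sup>2 * ip (T s f) (\<phi> R) - ip (T s f) (grushin_expr \<alpha> (\<phi> R)))" for s
    have "norm (G R S - G R 0) \<le> (E * (C' / R * C)) * norm (S - 0)"
    proof (rule field_differentiable_bound[where S = "{0..S}"])
      fix s assume s: "s \<in> {0..S}"
      show "(G R has_real_derivative D s) (at s within {0..S})"
        unfolding G_def[abs_def] D_def
        by (rule DERIV_cong[OF DERIV_mult[OF _ T_derivative[OF f \<phi>c[OF R] s]]])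
          (auto intro!: derivative_eq_intros simp: algebra_simps)
      have Ts: "T s f \<in> Lp 2" using s f by (intro T_mem) auto
      have \<phi>2: "\<phi> R \<in> Lp 2" and L2: "grushin_expr \<alpha> (\<phi> R) \<in> Lp 2"
        using \<phi>c[OF R] by (auto intro: Cc_infty_Lp2 grushin_expr_Lp2[OF \<alpha>])
      have diff: "\<xi>\<^sup>2 * ip (T s f) (\<phi> R) - ip (T s f) (grushin_expr \<alpha> (\<phi> R))
          = (LINT g|lborel. T s f g * (\<xi>\<^sup>2 * \<phi> R g - grushin_expr \<alpha> (\<phi> R) g))"
        using ip_diff_right[OF Ts Lp2_cmult[OF \<phi>2, of "\<xi>\<^sup>2"] L2]
        by (simp add: ip_cmult_right) (simp add: ip_def)
      have "\<bar>\<dots>\<bar> \<le> (LINT g|lborel. \<bar>T s f g * (\<xi>\<^sup>2 * \<phi> R g - grushin_expr \<alpha> (\<phi> R) g)\<bar>)"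
        by (rule integral_abs_bound)
      also have "\<dots> \<le> (LINT g|lborel. C' / R * T s f g)"
      proof (rule integral_mono_AE)
        show "integrable lborel (\<lambda>g. \<bar>T s f g * (\<xi>\<^sup>2 * \<phi> R g - grushin_expr \<alpha> (\<phi> R) g)\<bar>)"
          by (intro integrable_abs Lp2_integrable_mult[OF Ts] Lp2_diff Lp2_cmult \<phi>2 L2)
        show "integrable lborel (\<lambda>g. C' / R * T s f g)" using C(2)[OF s] by simp
        have "AE g in lborel. 0 \<le> T s f g" using s by (intro T_nonneg[OF _ f nonneg]) auto
        then show "AE g in lborel. \<bar>T s f g * (\<xi>\<^sup>2 * \<phi> R g - grushin_expr \<alpha> (\<phi> R) g)\<bar> \<le> C' / R * T s f g"
        proof eventually_elim
          case (elim g)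
          have "\<bar>\<xi>\<^sup>2 * \<phi> R g - grushin_expr \<alpha> (\<phi> R) g\<bar> \<le> C' / R"
            using C'(2)[OF R, of g] by (simp only: abs_minus_commute)
          from mult_left_mono[OF this elim] show ?case using elim by (simp add: abs_mult mult.commute)
        qed
      qed
      also have "\<dots> = C' / R * (LINT g|lborel. T s f g)" by (rule integral_mult_right_zero)
      also have "\<dots> \<le> C' / R * C" using C(2)[OF s] C' R by (intro mult_left_mono) auto
      finally have "\<bar>\<xi>\<^sup>2 * ip (T s f) (\<phi> R) - ip (T s f) (grushin_expr \<alpha> (\<phi> R))\<bar> \<le> C' / R * C"
        unfolding diff .
      moreover have "exp (\<xi>\<^sup>2 * s) \<le> E" using s by (simp add: E_def mult_left_mono)
      ultimately show "norm (D s) \<le> E * (C' / R * C)"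
        unfolding D_def real_norm_def abs_mult by (intro mult_mono) (auto simp: E_def)
    qed (use S in auto)
    then show ?thesis using S by simp
  qed
  define r where "r n = real (Suc n)" for n
  have lim: "(\<lambda>n. ip h (\<phi> (r n))) \<longlonglongrightarrow> (LINT g|lborel. h g * (?w g * ?b))"
    if h: "h \<in> Lp 2" "integrable lborel h" for h
    unfolding ip_def
  proof (rule integral_dominated_convergence[where w = "\<lambda>g. \<bar>h g\<bar>"])
    have [measurable]: "h \<in> borel_measurable borel" using h(1) by (rule Lp2_measurable)
    show "(\<lambda>g. h g * \<phi> (r n) g) \<in> borel_measurable lborel" for n
      using Lp2_measurable[OF Cc_infty_Lp2[OF \<phi>c[of "r n"]]] by (simp add: r_def)
    show "(\<lambda>g. h g * (?w g * ?b)) \<in> borel_measurable lborel" by simp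
    show "integrable lborel (\<lambda>g. \<bar>h g\<bar>)" using h(2) by simp
    show "AE g in lborel. (\<lambda>n. h g * \<phi> (r n) g) \<longlonglongrightarrow> h g * (?w g * ?b)"
      unfolding \<phi>_def r_def by (intro AE_I2 tendsto_mult_left cutoff_tendsto \<alpha>)
    show "AE g in lborel. norm (h g * \<phi> (r n) g) \<le> \<bar>h g\<bar>" for n
    proof (rule AE_I2)
      fix g :: "('m, 'k) grushin"
      have "\<bar>\<phi> (r n) g\<bar> \<le> 1 * 1"
        unfolding \<phi>_def abs_mult using w1 cutoff_nonneg[of \<alpha> "r n" g] cutoff_le_1[of \<alpha> "r n" g]
        by (intro mult_mono) auto
      from mult_left_mono[OF this, of "\<bar>h g\<bar>"] show "norm (h g * \<phi> (r n) g) \<le> \<bar>h g\<bar>"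
        by (simp add: abs_mult)
    qed
  qed
  have lim0: "(\<lambda>n. G (r n) S - G (r n) 0) \<longlonglongrightarrow> 0"
  proof (rule Lim_null_comparison)
    show "\<forall>\<^sub>F n in sequentially. norm (G (r n) S - G (r n) 0) \<le> E * C' * C * S * inverse (real (Suc n))"
      using bound by (intro always_eventually allI) (simp add: r_def divide_inverse mult_ac)
    show "(\<lambda>n. E * C' * C * S * inverse (real (Suc n))) \<longlonglongrightarrow> 0"
      using tendsto_mult_left[OF LIMSEQ_inverse_real_of_nat, of "E * C' * C * S"] by simp
  qed
  have "ip (T 0 f) \<psi> = ip f \<psi>" if "\<psi> \<in> Lp 2" for \<psi>
    unfolding ip_commute[of _ \<psi>] using T_zero[OF f] that f by (intro ip_cong_AE_right T_mem) auto
  then have G0: "G (r n) 0 = ip f (\<phi> (r n))" for n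
    using Cc_infty_Lp2[OF \<phi>c[of "r n"]] by (simp add: G_def r_def)
  have "(\<lambda>n. G (r n) S - G (r n) 0) \<longlonglongrightarrow>
      E * (LINT g|lborel. T S f g * (?w g * ?b)) - (LINT g|lborel. f g * (?w g * ?b))"
    unfolding G0 unfolding G_def E_def[symmetric] using C(2)[of S] S f f1
    by (intro tendsto_diff tendsto_mult_left lim T_mem) auto
  from LIMSEQ_unique[OF this lim0]
  have "E * (LINT g|lborel. T S f g * (?w g * ?b)) - (LINT g|lborel. f g * (?w g * ?b)) = 0" .
  moreover have "(LINT g|lborel. h g * (?w g * ?b)) = ?b * (LINT g|lborel. h g * ?w g)" for h
    by (simp add: mult.assoc[symmetric])
  ultimately have "?b * (E * (LINT g|lborel. T S f g * ?w g) - (LINT g|lborel. f g * ?w g)) = 0"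
    by (simp add: algebra_simps)
  then have "E * (LINT g|lborel. T S f g * ?w g) = (LINT g|lborel. f g * ?w g)"
    using bump_0_pos by simp
  then show ?thesis by (simp add: E_def exp_minus field_simps)
qed

section \<open>From the flow to the kernel: mass, marginals and spreading\<close>

lemma T_nn_integral:
  assumes t: "0 < t" and f: "f \<in> Lp 2" and nonneg: "\<And>g. 0 \<le> f g"
  shows "AE g in lborel. (\<integral>\<^sup>+h. ennreal (K t g h * f h) \<partial>lborel) = ennreal (T t f g)"
  using T_kernel[OF t f]
proof eventually_elim
  case (elim g)
  then show ?case
    by (simp add: nn_integral_eq_integral AE_I2 K_nonneg[OF t] nonneg)
qed

text \<open>Conservation of mass for the indicator of a box says that the mass function k has the
  volume of the box as its integral over it. So k is a density of Lebesgue measure with respect to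
  itself, and densities are unique almost everywhere.\<close>

lemma kernel_mass_1:
  assumes t: "0 < t"
  shows "AE h in lborel. (\<integral>\<^sup>+g. ennreal (K t g h) \<partial>lborel) = 1"
proof -
  have Km [measurable]: "(\<lambda>(x, y). K t x y) \<in> borel_measurable (borel \<Otimes>\<^sub>M borel)"
    by (rule K_measurable[OF t])
  define k where "k h = (\<integral>\<^sup>+g. ennreal (K t g h) \<partial>lborel)" for h
  have km [measurable]: "k \<in> borel_measurable lborel"
    unfolding k_def by measurable
  have box: "(\<integral>\<^sup>+h. k h * indicator (box l u) h \<partial>lborel) = emeasure lborel (box l u)"
    for l u :: "('m, 'k) grushin"
  proof -
    define f :: "('m, 'k) grushin \<Rightarrow> real" where "f = indicator (box l u)"
    have fin: "emeasure lborel (box l u) < \<infinity>" by (intro emeasure_bounded_finite bounded_box)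
    have f1: "integrable lborel f" unfolding f_def using fin by (intro integrable_real_indicator) auto
    have f2: "f \<in> Lp 2" unfolding f_def using fin by (intro indicator_Lp2) auto
    have nonneg: "0 \<le> f g" for g by (simp add: f_def)
    obtain C where "integrable lborel (T t f) \<and> (LINT g|lborel. T t f g) \<le> C"
      using T_integrable[OF f2 nonneg f1, of t] t by (meson atLeastAtMost_iff less_imp_le order_refl)
    then have T1: "integrable lborel (T t f)" by simp
    have [measurable]: "f \<in> borel_measurable borel" using f2 by (rule Lp2_measurable)
    have "(\<integral>\<^sup>+h. k h * indicator (box l u) h \<partial>lborel)
        = (\<integral>\<^sup>+h. (\<integral>\<^sup>+g. ennreal (K t g h * f h) \<partial>lborel) \<partial>lborel)"
    proof (rule nn_integral_cong)
      fix h
      have "k h * indicator (box l u) h = k h * ennreal (f h)"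
        by (simp add: f_def ennreal_indicator)
      also have "\<dots> = (\<integral>\<^sup>+g. ennreal (K t g h) * ennreal (f h) \<partial>lborel)"
        unfolding k_def by (rule nn_integral_multc[symmetric]) measurable
      also have "\<dots> = (\<integral>\<^sup>+g. ennreal (K t g h * f h) \<partial>lborel)"
        by (simp add: ennreal_mult K_nonneg[OF t] nonneg)
      finally show "k h * indicator (box l u) h = (\<integral>\<^sup>+g. ennreal (K t g h * f h) \<partial>lborel)" .
    qed
    also have "\<dots> = (\<integral>\<^sup>+g. (\<integral>\<^sup>+h. ennreal (K t g h * f h) \<partial>lborel) \<partial>lborel)"
      by (rule lborel_pair.Fubini') measurable
    also have "\<dots> = (\<integral>\<^sup>+g. ennreal (T t f g) \<partial>lborel)"
      by (rule nn_integral_cong_AE[OF T_nn_integral[OF t f2 nonneg]])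
    also have "\<dots> = ennreal (LINT g|lborel. T t f g)"
      using t by (intro nn_integral_eq_integral T1 T_nonneg f2 nonneg) auto
    \<comment> \<open>Frequency 0: the wave is the constant 1, whichever coordinate is
      taken.\<close>
    also have "(LINT g|lborel. T t f g) = (LINT g|lborel. f g)"
      using wave_integral[OF f2 nonneg f1, of t undefined 0] t by (simp add: wave_def)
    also have "ennreal (LINT g|lborel. f g) = (\<integral>\<^sup>+g. ennreal (f g) \<partial>lborel)"
      by (intro nn_integral_eq_integral[symmetric] f1) (simp add: nonneg)
    also have "\<dots> = emeasure lborel (box l u)" by (simp add: f_def ennreal_indicator)
    finally show ?thesis .
  qed
  have "lborel = density lborel k"
  proof (rule lborel_eqI)
    fix l u :: "('m, 'k) grushin" assume "\<And>b. b \<in> Basis \<Longrightarrow> l \<bullet> b \<le> u \<bullet> b"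
    then show "emeasure (density lborel k) (box l u) = (\<Prod>b\<in>Basis. (u - l) \<bullet> b)"
      by (subst emeasure_density) (simp_all add: box emeasure_lborel_box)
  qed simp
  then have "density lborel k = density lborel (\<lambda>_. 1)" by (simp add: density_1)
  moreover have "(\<lambda>_. 1 :: ennreal) \<in> borel_measurable (lborel :: ('m, 'k) grushin measure)" by simp
  ultimately show ?thesis
    using sigma_finite_measure.density_unique_iff[OF sigma_finite_lborel km] unfolding k_def by blast
qed

text \<open>Unit mass is known for integration in one variable. If the weight sits on the outer
  variable, symmetry of K suffices; otherwise the order of integration is exchanged first.\<close>

lemma kernel_marginals:
  assumes t: "0 < t" and \<phi> [measurable]: "\<phi> \<in> borel_measurable borel" and nonneg: "\<And>g. 0 \<le> \<phi> g"
  shows "(\<integral>\<^sup>+g. \<integral>\<^sup>+h. ennreal (K t g h * \<phi> h) \<partial>lborel \<partial>lborel) = (\<integral>\<^sup>+g. ennreal (\<phi> g) \<partial>lborel)"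
    and "(\<integral>\<^sup>+g. \<integral>\<^sup>+h. ennreal (K t g h * \<phi> g) \<partial>lborel \<partial>lborel) = (\<integral>\<^sup>+g. ennreal (\<phi> g) \<partial>lborel)"
proof -
  have Km [measurable]: "(\<lambda>(x, y). K t x y) \<in> borel_measurable (borel \<Otimes>\<^sub>M borel)"
    by (rule K_measurable[OF t])
  have one: "(\<integral>\<^sup>+g. \<integral>\<^sup>+h. ennreal (K t h g * \<phi> g) \<partial>lborel \<partial>lborel) = (\<integral>\<^sup>+g. ennreal (\<phi> g) \<partial>lborel)"
  proof (rule nn_integral_cong_AE)
    show "AE g in lborel. (\<integral>\<^sup>+h. ennreal (K t h g * \<phi> g) \<partial>lborel) = ennreal (\<phi> g)"
      using kernel_mass_1[OF t]
    proof eventually_elim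
      case (elim g)
      have "(\<integral>\<^sup>+h. ennreal (K t h g * \<phi> g) \<partial>lborel) = (\<integral>\<^sup>+h. ennreal (K t h g) * ennreal (\<phi> g) \<partial>lborel)"
        by (simp add: ennreal_mult K_nonneg[OF t] nonneg)
      also have "\<dots> = (\<integral>\<^sup>+h. ennreal (K t h g) \<partial>lborel) * ennreal (\<phi> g)"
        by (rule nn_integral_multc) measurable
      finally show ?case by (simp add: elim)
    qed
  qed
  then show "(\<integral>\<^sup>+g. \<integral>\<^sup>+h. ennreal (K t g h * \<phi> g) \<partial>lborel \<partial>lborel) = (\<integral>\<^sup>+g. ennreal (\<phi> g) \<partial>lborel)"
    by (simp add: K_sym[OF t])
  have "(\<integral>\<^sup>+g. \<integral>\<^sup>+h. ennreal (K t g h * \<phi> h) \<partial>lborel \<partial>lborel)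
      = (\<integral>\<^sup>+h. \<integral>\<^sup>+g. ennreal (K t g h * \<phi> h) \<partial>lborel \<partial>lborel)"
    by (rule lborel_pair.Fubini'[symmetric]) measurable
  then show "(\<integral>\<^sup>+g. \<integral>\<^sup>+h. ennreal (K t g h * \<phi> h) \<partial>lborel \<partial>lborel) = (\<integral>\<^sup>+g. ennreal (\<phi> g) \<partial>lborel)"
    using one by simp
qed

text \<open>The average of \<open>cos ((j - l) \<theta>)\<close> over \<open>j, l < N\<close> is non-negative, being the squared modulus of an
  exponential sum, and at least \<open>1 / 2\<close> on the ball if \<open>\<theta>\<close> is a small multiple of a coordinate; in the
  limit only the \<open>N\<close> diagonal terms survive.\<close>

lemma kernel_decay:
  "((\<lambda>t. \<integral>\<^sup>+g. \<integral>\<^sup>+h. ennreal (K t g h * (indicator (cball 0 r) g * indicator (cball 0 r) h)) \<partial>lborel \<partial>lborel)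
      \<longlongrightarrow> 0) at_top"
proof -
  define S :: "('m, 'k) grushin set" where "S = cball 0 r"
  define f :: "('m, 'k) grushin \<Rightarrow> real" where "f = indicator S"
  define J where "J t = (\<integral>\<^sup>+g. \<integral>\<^sup>+h. ennreal (K t g h * (f g * f h)) \<partial>lborel \<partial>lborel)" for t
  define i :: 'm where "i = undefined"
  have f1: "integrable lborel f" unfolding f_def S_def
    by (intro integrable_real_indicator emeasure_bounded_finite) auto
  have f2: "f \<in> Lp 2" unfolding f_def S_def
    by (intro indicator_Lp2 emeasure_bounded_finite) auto
  have nonneg: "0 \<le> f g" for g by (simp add: f_def)
  have fm [measurable]: "f \<in> borel_measurable borel" using f2 by (rule Lp2_measurable)
  define I where "I = (LINT g|lborel. f g)"
  have I: "0 \<le> I" unfolding I_def by (intro integral_nonneg_AE) (simp add: nonneg)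
  have T1: "integrable lborel (T t f)" if "0 < t" for t
    using T_integrable[OF f2 nonneg f1, of t] that by (meson atLeastAtMost_iff less_imp_le order_refl)
  have wm [measurable]: "wave i \<xi> \<in> borel_measurable (borel :: ('m, 'k) grushin measure)" for \<xi>
  proof (rule borel_measurable_continuous_onI)
    have "continuously_differentiable 0 (wave i \<xi> :: ('m, 'k) grushin \<Rightarrow> real)" by (rule wave_partials(3))
    then show "continuous_on UNIV (wave i \<xi> :: ('m, 'k) grushin \<Rightarrow> real)" by simp
  qed
  have wave1: "\<bar>wave i \<xi> g\<bar> \<le> 1" for \<xi> and g :: "('m, 'k) grushin" by (simp add: wave_def)
  have int_wave: "integrable lborel (\<lambda>g. h g * wave i \<xi> g)" if "integrable lborel h"
    for h :: "('m, 'k) grushin \<Rightarrow> real" and \<xi>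
  proof (rule Bochner_Integration.integrable_bound[OF that])
    show "(\<lambda>g. h g * wave i \<xi> g) \<in> borel_measurable lborel" using that by measurable
    show "AE g in lborel. norm (h g * wave i \<xi> g) \<le> norm (h g)"
      by (intro AE_I2) (simp only: abs_mult real_norm_def, intro mult_left_le wave1 abs_ge_zero)
  qed
  have J_eq: "J t = ennreal (LINT g|lborel. T t f g * f g)" if t: "0 < t" for t
  proof -
    have Km [measurable]: "(\<lambda>(x, y). K t x y) \<in> borel_measurable (borel \<Otimes>\<^sub>M borel)"
      by (rule K_measurable[OF t])
    have pos: "AE g in lborel. 0 \<le> T t f g" using t by (intro T_nonneg f2 nonneg) simp
    have "J t = (\<integral>\<^sup>+g. ennreal (T t f g * f g) \<partial>lborel)"
      unfolding J_def
    proof (rule nn_integral_cong_AE)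
      show "AE g in lborel. (\<integral>\<^sup>+h. ennreal (K t g h * (f g * f h)) \<partial>lborel) = ennreal (T t f g * f g)"
        using T_nn_integral[OF t f2 nonneg] pos
      proof eventually_elim
        case (elim g)
        have "(\<integral>\<^sup>+h. ennreal (K t g h * (f g * f h)) \<partial>lborel)
            = (\<integral>\<^sup>+h. ennreal (K t g h * f h) * ennreal (f g) \<partial>lborel)"
          by (simp add: ennreal_mult K_nonneg[OF t] nonneg mult_ac)
        also have "\<dots> = (\<integral>\<^sup>+h. ennreal (K t g h * f h) \<partial>lborel) * ennreal (f g)"
          by (rule nn_integral_multc) measurable
        finally show ?case using elim by (simp add: ennreal_mult nonneg)
      qed
    qed
    also have "\<dots> = ennreal (LINT g|lborel. T t f g * f g)"
      using t pos by (intro nn_integral_eq_integral Lp2_integrable_mult T_mem f2)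
        (auto simp: nonneg elim!: eventually_mono)
    finally show ?thesis .
  qed
  \<comment> \<open>The factor 2 offsets the lower bound 1/2 for the average of the N^2 waves on the
    ball; each wave integral of \<open>T t f\<close> is replaced by its exponential factor times the
    mass I.\<close>
  define Q where "Q N \<xi> t = 2 / (real N)\<^sup>2 *
      (\<Sum>j<N. \<Sum>l<N. exp (- (((real j - real l) * \<xi>)\<^sup>2 * t)) * I)" for N :: nat and \<xi> t
  have JQ: "J t \<le> ennreal (Q N \<xi> t)"
    if t: "0 < t" and N: "0 < N" and \<xi>: "0 < \<xi>" "\<xi> * (real N * (\<bar>r\<bar> + 1)) \<le> 1" for t N \<xi>
  proof -
    define W :: "('m, 'k) grushin \<Rightarrow> real"
      where "W g = (\<Sum>j<N. \<Sum>l<N. wave i ((real j - real l) * \<xi>) g)" for g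
    have W_eq: "W g = (\<Sum>j<N. cos (real j * \<xi> * fst g $ i))\<^sup>2 + (\<Sum>j<N. sin (real j * \<xi> * fst g $ i))\<^sup>2" for g
      by (simp add: W_def wave_def left_diff_distrib cos_diff sum.distrib power2_eq_square sum_product)
    have W0: "0 \<le> W g" for g unfolding W_eq by simp
    have W1: "(real N)\<^sup>2 / 2 \<le> W g" if g: "g \<in> S" for g
    proof -
      have "1 / 2 \<le> wave i ((real j - real l) * \<xi>) g" if "j < N" "l < N" for j l
      proof -
        have "\<bar>fst g $ i\<bar> \<le> norm (fst g)" by (rule component_le_norm_cart)
        also have "\<dots> \<le> norm g" by (metis norm_fst_le prod.collapse)
        also have "\<dots> \<le> \<bar>r\<bar> + 1" using g by (simp add: S_def)
        finally have "\<bar>real j - real l\<bar> * (\<xi> * \<bar>fst g $ i\<bar>) \<le> real N * (\<xi> * (\<bar>r\<bar> + 1))"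
          using that \<xi> by (intro mult_mono) auto
        also have "\<dots> \<le> 1" using \<xi> by (simp add: mult_ac)
        finally have a: "\<bar>(real j - real l) * \<xi> * fst g $ i\<bar> \<le> 1"
          using \<xi> by (simp add: abs_mult mult.assoc)
        \<comment> \<open>The phase is at most 1 in modulus and 1 < pi/3, where cos equals
          1/2.\<close>
        have "1 / 2 = cos (pi / 3)" by (simp add: cos_60)
        also have "\<dots> \<le> cos \<bar>(real j - real l) * \<xi> * fst g $ i\<bar>"
          using a pi_gt3 by (intro cos_monotone_0_pi_le) auto
        finally show ?thesis by (simp add: wave_def)
      qed
      then have "(\<Sum>j<N. \<Sum>l<N. 1 / 2) \<le> W g"
        unfolding W_def by (intro sum_mono) auto
      then show ?thesis by (simp add: power2_eq_square)
    qed
    have intW: "integrable lborel (\<lambda>g. T t f g * W g)"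
      unfolding W_def sum_distrib_left
      by (intro Bochner_Integration.integrable_sum int_wave T1 t)
    have "(LINT g|lborel. T t f g * f g) \<le> (LINT g|lborel. 2 / (real N)\<^sup>2 * (T t f g * W g))"
    proof (rule integral_mono_AE)
      show "integrable lborel (\<lambda>g. T t f g * f g)"
        using t by (intro Lp2_integrable_mult T_mem f2) simp
      show "integrable lborel (\<lambda>g. 2 / (real N)\<^sup>2 * (T t f g * W g))"
        using intW by simp
      have "AE g in lborel. 0 \<le> T t f g" using t by (intro T_nonneg f2 nonneg) simp
      then show "AE g in lborel. T t f g * f g \<le> 2 / (real N)\<^sup>2 * (T t f g * W g)"
      proof eventually_elim
        case (elim g)
        have "f g \<le> 2 / (real N)\<^sup>2 * W g"
          using W0[of g] W1[of g] N by (cases "g \<in> S") (auto simp: f_def field_simps)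
        from mult_left_mono[OF this elim] show ?case by (simp add: mult_ac)
      qed
    qed
    also have "\<dots> = 2 / (real N)\<^sup>2 * (LINT g|lborel. T t f g * W g)" by (rule integral_mult_right_zero)
    also have "(LINT g|lborel. T t f g * W g)
        = (\<Sum>j<N. \<Sum>l<N. LINT g|lborel. T t f g * wave i ((real j - real l) * \<xi>) g)"
      unfolding W_def sum_distrib_left using T1[OF t]
      by (simp add: Bochner_Integration.integral_sum int_wave)
    also have "2 / (real N)\<^sup>2 * \<dots> \<le> Q N \<xi> t"
      unfolding Q_def
    proof (intro mult_left_mono sum_mono)
      fix j l
      let ?x = "(real j - real l) * \<xi>"
      have "(LINT g|lborel. T t f g * wave i ?x g) = exp (- (?x\<^sup>2 * t)) * (LINT g|lborel. f g * wave i ?x g)"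
        using t by (intro wave_integral f2 nonneg f1) simp
      also have "(LINT g|lborel. f g * wave i ?x g) \<le> I"
        unfolding I_def using mult_left_mono[OF abs_le_D1[OF wave1] nonneg]
        by (intro integral_mono int_wave f1) auto
      finally show "(LINT g|lborel. T t f g * wave i ?x g) \<le> exp (- (?x\<^sup>2 * t)) * I" by simp
    qed simp
    finally show ?thesis unfolding J_eq[OF t] by (rule ennreal_leI)
  qed
  have Qlim: "((\<lambda>t. Q N \<xi> t) \<longlongrightarrow> 2 * I / real N) at_top" if N: "0 < N" and \<xi>: "0 < \<xi>" for N \<xi>
  proof -
    have "((\<lambda>t. exp (- (((real j - real l) * \<xi>)\<^sup>2 * t)) * I) \<longlongrightarrow> (if l = j then I else 0)) at_top" for j l
    proof (cases "l = j")
      case False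
      then have "0 < ((real j - real l) * \<xi>)\<^sup>2" using \<xi> by simp
      then have "((\<lambda>t. exp (- (((real j - real l) * \<xi>)\<^sup>2 * t))) \<longlongrightarrow> 0) at_top"
        by (intro filterlim_compose[OF exp_at_bot] filterlim_compose[OF filterlim_uminus_at_bot_at_top]
            filterlim_tendsto_pos_mult_at_top[OF tendsto_const] filterlim_ident)
      from tendsto_mult_left_zero[OF this, of I] show ?thesis using False by simp
    qed simp
    then have "((\<lambda>t. Q N \<xi> t) \<longlongrightarrow> 2 / (real N)\<^sup>2 * (\<Sum>j<N. \<Sum>l<N. if l = j then I else 0)) at_top"
      unfolding Q_def by (intro tendsto_mult_left tendsto_sum)
    moreover have "(\<Sum>j<N. \<Sum>l<N. if l = j then I else 0) = real N * I"
      by (simp add: sum.delta)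
    ultimately show ?thesis using N by (simp add: power2_eq_square)
  qed
  have "(J \<longlongrightarrow> 0) at_top"
  proof (rule order_tendstoI)
    fix y :: ennreal assume y: "0 < y"
    obtain e where e: "0 < e" "ennreal e \<le> y"
      using y by (cases y) (auto intro: that[of 1])
    \<comment> \<open>The majorant tends to 2I/N as t grows, so N is fixed first; then the frequency
      step is the largest for which all phases on the ball are guaranteed to stay within 1.\<close>
    obtain N :: nat where N: "2 * I / e < real N" using reals_Archimedean2 by blast
    have N0: "0 < N" using N e I by (metis divide_nonneg_pos mult_nonneg_nonneg of_nat_0 not_gr_zero
          not_less zero_le_numeral less_le_not_le)
    have lt: "2 * I / real N < e" using N N0 e by (simp add: field_simps)
    define \<xi> where "\<xi> = 1 / (real N * (\<bar>r\<bar> + 1))"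
    have \<xi>: "0 < \<xi>" "\<xi> * (real N * (\<bar>r\<bar> + 1)) \<le> 1" using N0 by (auto simp: \<xi>_def intro!: divide_pos_pos mult_pos_pos)
    have "\<forall>\<^sub>F t in at_top. Q N \<xi> t < e" by (rule order_tendstoD(2)[OF Qlim[OF N0 \<xi>(1)] lt])
    moreover have "\<forall>\<^sub>F t in at_top. (0::real) < t" by (rule eventually_gt_at_top)
    ultimately show "\<forall>\<^sub>F t in at_top. J t < y"
    proof eventually_elim
      case (elim t)
      have "J t \<le> ennreal (Q N \<xi> t)" using elim by (intro JQ N0 \<xi>) auto
      also have "\<dots> < ennreal e" using elim e by (simp add: ennreal_less_iff ennreal_lessI)
      also have "\<dots> \<le> y" by (rule e)
      finally show ?case .
    qed
  qed simp
  then show ?thesis by (simp add: J_def[abs_def] f_def S_def)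
qed

end

section \<open>Large times\<close>

text \<open>Convexity of the p-th power at |a|/(1 - l) and |b|/l with weights 1 - l and l. As l
  tends to 0 the coefficient of |a|^p tends to 1, so b can be treated as a perturbation, at the
  price of a large coefficient when p > 1.\<close>

lemma abs_add_powr_le:
  fixes a b :: real
  assumes p: "1 \<le> p" and l: "0 < l" "l < 1"
  shows "\<bar>a + b\<bar> powr p \<le> (1 - l) powr (1 - p) * \<bar>a\<bar> powr p + l powr (1 - p) * \<bar>b\<bar> powr p"
proof -
  have ge1: "1 \<le> x powr (1 - p)" if "0 < x" "x < 1" for x :: real
    using powr_mono'[of "1 - p" 0 x] that p by simp
  consider "a = 0" | "b = 0" | "a \<noteq> 0" "b \<noteq> 0" by blast
  then show ?thesis
  proof cases
    case 1
    then show ?thesis using mult_right_mono[OF ge1[of l], of "\<bar>b\<bar> powr p"] l p by simp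
  next
    case 2
    then show ?thesis using mult_right_mono[OF ge1[of "1 - l"], of "\<bar>a\<bar> powr p"] l p by simp
  next
    case 3
    have scale: "c * (x / c) powr p = c powr (1 - p) * x powr p" if "0 < c" "0 < x" for c x :: real
      using that by (simp add: powr_divide powr_diff)
    have "\<bar>a + b\<bar> powr p \<le> (\<bar>a\<bar> + \<bar>b\<bar>) powr p"
      using p by (intro powr_mono2) auto
    also have "\<bar>a\<bar> + \<bar>b\<bar> = (1 - l) *\<^sub>R (\<bar>a\<bar> / (1 - l)) + l *\<^sub>R (\<bar>b\<bar> / l)"
      using l by simp
    also have "\<dots> powr p \<le> (1 - l) * (\<bar>a\<bar> / (1 - l)) powr p + l * (\<bar>b\<bar> / l) powr p"
      using convex_onD[OF powr_convex[OF p], of l "\<bar>a\<bar> / (1 - l)" "\<bar>b\<bar> / l"] l 3 by simp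
    also have "\<dots> = (1 - l) powr (1 - p) * \<bar>a\<bar> powr p + l powr (1 - p) * \<bar>b\<bar> powr p"
      using scale[of "1 - l" "\<bar>a\<bar>"] scale[of l "\<bar>b\<bar>"] l 3 by simp
    finally show ?thesis .
  qed
qed

context grushin_heat
begin

section \<open>Integrals of functions of two points against the kernel\<close>

definition kernel_integral :: "real \<Rightarrow> (('m, 'k) grushin \<Rightarrow> ('m, 'k) grushin \<Rightarrow> real) \<Rightarrow> ennreal" where
  "kernel_integral t \<Phi> = (\<integral>\<^sup>+g. \<integral>\<^sup>+h. ennreal (K t g h * \<Phi> g h) \<partial>lborel \<partial>lborel)"

lemma kernel_integral_mono:
  assumes "0 < t" "\<And>g h. \<Phi> g h \<le> \<Psi> g h"
  shows "kernel_integral t \<Phi> \<le> kernel_integral t \<Psi>"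
  unfolding kernel_integral_def
  by (intro nn_integral_mono ennreal_leI mult_left_mono K_nonneg assms)

lemma kernel_integral_lincomb:
  assumes t: "0 < t" and a: "0 \<le> a" and b: "0 \<le> b"
    and \<Phi>: "case_prod \<Phi> \<in> borel_measurable (borel \<Otimes>\<^sub>M borel)" "\<And>g h. 0 \<le> \<Phi> g h"
    and \<Psi>: "case_prod \<Psi> \<in> borel_measurable (borel \<Otimes>\<^sub>M borel)" "\<And>g h. 0 \<le> \<Psi> g h"
  shows "kernel_integral t (\<lambda>g h. a * \<Phi> g h + b * \<Psi> g h)
    = ennreal a * kernel_integral t \<Phi> + ennreal b * kernel_integral t \<Psi>"
proof -
  note [measurable] = K_measurable[OF t] \<Phi>(1) \<Psi>(1)
  have "kernel_integral t (\<lambda>g h. a * \<Phi> g h + b * \<Psi> g h)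
      = (\<integral>\<^sup>+g. \<integral>\<^sup>+h. ennreal a * ennreal (K t g h * \<Phi> g h) + ennreal b * ennreal (K t g h * \<Psi> g h) \<partial>lborel \<partial>lborel)"
    unfolding kernel_integral_def
    by (simp add: ennreal_mult[symmetric] ennreal_plus[symmetric] a b \<Phi>(2) \<Psi>(2) K_nonneg[OF t]
        algebra_simps del: ennreal_plus)
  also have "\<dots> = (\<integral>\<^sup>+g. ennreal a * (\<integral>\<^sup>+h. ennreal (K t g h * \<Phi> g h) \<partial>lborel)
      + ennreal b * (\<integral>\<^sup>+h. ennreal (K t g h * \<Psi> g h) \<partial>lborel) \<partial>lborel)"
    by (simp add: nn_integral_add nn_integral_cmult)
  also have "\<dots> = ennreal a * kernel_integral t \<Phi> + ennreal b * kernel_integral t \<Psi>"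
    unfolding kernel_integral_def by (simp add: nn_integral_add nn_integral_cmult)
  finally show ?thesis .
qed

text \<open>The function F(t) of the overview.\<close>

definition energy :: "real \<Rightarrow> (('m, 'k) grushin \<Rightarrow> real) \<Rightarrow> real \<Rightarrow> ennreal" where
  "energy p u t = kernel_integral t (\<lambda>g h. \<bar>u h - u g\<bar> powr p)"

definition mass :: "real \<Rightarrow> (('m, 'k) grushin \<Rightarrow> real) \<Rightarrow> real" where
  "mass p u = (LINT g|lborel. \<bar>u g\<bar> powr p)"

lemma mass_nonneg: "0 \<le> mass p u"
  by (simp add: mass_def)

lemma nn_integral_mass: "u \<in> Lp p \<Longrightarrow> (\<integral>\<^sup>+g. ennreal (\<bar>u g\<bar> powr p) \<partial>lborel) = ennreal (mass p u)"
  unfolding mass_def by (intro nn_integral_eq_integral) (auto simp: Lp_def)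

lemma kernel_integral_mass:
  assumes t: "0 < t" and u: "u \<in> Lp p"
  shows "kernel_integral t (\<lambda>g h. \<bar>u g\<bar> powr p) = ennreal (mass p u)"
    and "kernel_integral t (\<lambda>g h. \<bar>u h\<bar> powr p) = ennreal (mass p u)"
proof -
  have m: "(\<lambda>g. \<bar>u g\<bar> powr p) \<in> borel_measurable borel" using u by (auto simp: Lp_def)
  show "kernel_integral t (\<lambda>g h. \<bar>u g\<bar> powr p) = ennreal (mass p u)"
    unfolding kernel_integral_def kernel_marginals(2)[OF t m powr_ge_zero] by (rule nn_integral_mass[OF u])
  show "kernel_integral t (\<lambda>g h. \<bar>u h\<bar> powr p) = ennreal (mass p u)"
    unfolding kernel_integral_def kernel_marginals(1)[OF t m powr_ge_zero] by (rule nn_integral_mass[OF u])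
qed

text \<open>Equal weights l = 1/2 and the two marginals. The bound is uniform in t, which makes the
  energy of a small remainder small at all times.\<close>

lemma energy_le_mass:
  assumes p: "1 \<le> p" and t: "0 < t" and u: "u \<in> Lp p"
  shows "energy p u t \<le> ennreal (2 * (1 / 2) powr (1 - p) * mass p u)"
proof -
  have [measurable]: "u \<in> borel_measurable borel" using u by (simp add: Lp_def)
  let ?c = "(1 / 2 :: real) powr (1 - p)"
  have "energy p u t \<le> kernel_integral t (\<lambda>g h. ?c * \<bar>u g\<bar> powr p + ?c * \<bar>u h\<bar> powr p)"
    unfolding energy_def
  proof (rule kernel_integral_mono[OF t])
    fix g h
    show "\<bar>u h - u g\<bar> powr p \<le> ?c * \<bar>u g\<bar> powr p + ?c * \<bar>u h\<bar> powr p"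
      using abs_add_powr_le[OF p, of "1 / 2" "- u g" "u h"] by simp
  qed
  also have "\<dots> = ennreal ?c * ennreal (mass p u) + ennreal ?c * ennreal (mass p u)"
    by (subst kernel_integral_lincomb[OF t]) (simp_all add: kernel_integral_mass[OF t u])
  also have "\<dots> = ennreal (2 * ?c * mass p u)"
    by (simp add: ennreal_mult[symmetric] ennreal_plus[symmetric] mass_nonneg del: ennreal_plus)
  finally show ?thesis .
qed

lemma energy_perturb:
  assumes p: "1 \<le> p" and l: "0 < l" "l < 1" and t: "0 < t" and u: "u \<in> Lp p" and v: "v \<in> Lp p"
  shows "energy p (\<lambda>g. u g + v g) t
    \<le> ennreal ((1 - l) powr (1 - p)) * energy p u t + ennreal (l powr (1 - p)) * energy p v t"
proof -
  have [measurable]: "u \<in> borel_measurable borel" "v \<in> borel_measurable borel"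
    using u v by (auto simp: Lp_def)
  have "energy p (\<lambda>g. u g + v g) t \<le> kernel_integral t (\<lambda>g h. (1 - l) powr (1 - p) * \<bar>u h - u g\<bar> powr p
      + l powr (1 - p) * \<bar>v h - v g\<bar> powr p)"
    unfolding energy_def
  proof (rule kernel_integral_mono[OF t])
    fix g h
    have eq: "u h + v h - (u g + v g) = (u h - u g) + (v h - v g)" by simp
    show "\<bar>u h + v h - (u g + v g)\<bar> powr p
        \<le> (1 - l) powr (1 - p) * \<bar>u h - u g\<bar> powr p + l powr (1 - p) * \<bar>v h - v g\<bar> powr p"
      unfolding eq by (rule abs_add_powr_le[OF p l])
  qed
  also have "\<dots> = ennreal ((1 - l) powr (1 - p)) * energy p u t + ennreal (l powr (1 - p)) * energy p v t"
    unfolding energy_def by (rule kernel_integral_lincomb[OF t]) simp_all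
  finally show ?thesis .
qed

text \<open>The integrands |u(h) - u(g)|^p and |u(g)|^p + |u(h)|^p agree unless both points lie in
  the ball, where they differ by at most a constant. The second integrates to exactly twice the mass
  by the marginals, and the kernel mass of the square of the ball tends to 0.\<close>

lemma energy_tendsto_bounded:
  assumes p: "1 \<le> p" and u: "u \<in> Lp p" and M: "0 \<le> M" "\<And>g. \<bar>u g\<bar> \<le> M"
    and supp: "\<And>g. g \<notin> cball 0 r \<Longrightarrow> u g = 0"
  shows "(energy p u \<longlongrightarrow> ennreal (2 * mass p u)) at_top"
proof -
  define s where "s g h = (indicator (cball 0 r) g * indicator (cball 0 r) h :: real)" for g h :: "('m, 'k) grushin"
  define J where "J t = kernel_integral t s" for t
  have J: "(J \<longlongrightarrow> 0) at_top"
    using kernel_decay[of r] by (simp add: J_def[abs_def] kernel_integral_def s_def)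
  have [measurable]: "u \<in> borel_measurable borel" using u by (simp add: Lp_def)
  have "(\<lambda>(g, h). s g h) = indicator (cball 0 r \<times> cball 0 r)"
    by (auto simp: s_def indicator_def fun_eq_iff)
  then have [measurable]: "(\<lambda>(g, h). s g h) \<in> borel_measurable (borel \<Otimes>\<^sub>M borel)" by simp
  have s0: "0 \<le> s g h" for g h by (simp add: s_def)
  have sum: "kernel_integral t (\<lambda>g h. \<bar>u g\<bar> powr p + \<bar>u h\<bar> powr p) = ennreal (2 * mass p u)" if "0 < t" for t
    using kernel_integral_lincomb[OF that, of 1 1 "\<lambda>g h. \<bar>u g\<bar> powr p" "\<lambda>g h. \<bar>u h\<bar> powr p"]
    by (simp add: kernel_integral_mass[OF that u] mass_nonneg ennreal_plus[symmetric] del: ennreal_plus)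
  have pm: "\<bar>u g\<bar> powr p \<le> M powr p" for g using M p by (intro powr_mono2) auto
  have upper: "energy p u t \<le> ennreal (2 * mass p u) + ennreal ((2 * M) powr p) * J t" if t: "0 < t" for t
  proof -
    have "energy p u t \<le> kernel_integral t (\<lambda>g h. 1 * (\<bar>u g\<bar> powr p + \<bar>u h\<bar> powr p) + (2 * M) powr p * s g h)"
      unfolding energy_def
    proof (rule kernel_integral_mono[OF t])
      fix g h
      have "\<bar>u h - u g\<bar> powr p \<le> (2 * M) powr p"
        using M(2)[of g] M(2)[of h] p by (intro powr_mono2) auto
      moreover have "\<bar>u h - u g\<bar> powr p \<le> \<bar>u g\<bar> powr p + \<bar>u h\<bar> powr p" if "u g = 0 \<or> u h = 0"
        using that by auto
      ultimately show "\<bar>u h - u g\<bar> powr p \<le> 1 * (\<bar>u g\<bar> powr p + \<bar>u h\<bar> powr p) + (2 * M) powr p * s g h"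
        using supp[of g] supp[of h]
        by (cases "g \<in> cball 0 r"; cases "h \<in> cball 0 r") (auto simp: s_def add_increasing)
    qed
    also have "\<dots> = ennreal 1 * kernel_integral t (\<lambda>g h. \<bar>u g\<bar> powr p + \<bar>u h\<bar> powr p) + ennreal ((2 * M) powr p) * J t"
      unfolding J_def by (rule kernel_integral_lincomb[OF t]) (simp_all add: s0)
    finally show ?thesis by (simp add: sum[OF t])
  qed
  have lower: "ennreal (2 * mass p u) \<le> energy p u t + ennreal (2 * M powr p) * J t" if t: "0 < t" for t
  proof -
    have "ennreal (2 * mass p u) = kernel_integral t (\<lambda>g h. \<bar>u g\<bar> powr p + \<bar>u h\<bar> powr p)"
      using sum[OF t] by simp
    also have "\<dots> \<le> kernel_integral t (\<lambda>g h. 1 * \<bar>u h - u g\<bar> powr p + 2 * M powr p * s g h)"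
    proof (rule kernel_integral_mono[OF t])
      fix g h
      show "\<bar>u g\<bar> powr p + \<bar>u h\<bar> powr p \<le> 1 * \<bar>u h - u g\<bar> powr p + 2 * M powr p * s g h"
      proof (cases "g \<in> cball 0 r \<and> h \<in> cball 0 r")
        case True
        have "\<bar>u g\<bar> powr p + \<bar>u h\<bar> powr p \<le> \<bar>u h - u g\<bar> powr p + 2 * M powr p"
          using pm[of g] pm[of h] powr_ge_zero[of "\<bar>u h - u g\<bar>" p] by linarith
        then show ?thesis using True by (simp add: s_def)
      next
        case False
        then show ?thesis using supp[of g] supp[of h] by (auto simp: s_def)
      qed
    qed
    also have "\<dots> = ennreal 1 * energy p u t + ennreal (2 * M powr p) * J t"
      unfolding energy_def J_def by (rule kernel_integral_lincomb[OF t]) (simp_all add: s0)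
    finally show ?thesis by simp
  qed
  show ?thesis
  proof (rule tendsto_sandwich)
    show "\<forall>\<^sub>F t in at_top. ennreal (2 * mass p u) - ennreal (2 * M powr p) * J t \<le> energy p u t"
      using eventually_gt_at_top[of 0]
      by eventually_elim (use lower in \<open>simp add: ennreal_minus_le_iff add.commute\<close>)
    show "\<forall>\<^sub>F t in at_top. energy p u t \<le> ennreal (2 * mass p u) + ennreal ((2 * M) powr p) * J t"
      using eventually_gt_at_top[of 0] by eventually_elim (use upper in simp)
    have "((\<lambda>t. ennreal (2 * mass p u) - ennreal (2 * M powr p) * J t)
        \<longlongrightarrow> ennreal (2 * mass p u) - ennreal (2 * M powr p) * 0) at_top"
      by (intro tendsto_diff_ennreal tendsto_const ennreal_tendsto_cmult J) auto
    then show "((\<lambda>t. ennreal (2 * mass p u) - ennreal (2 * M powr p) * J t) \<longlongrightarrow> ennreal (2 * mass p u)) at_top"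
      by simp
    have "((\<lambda>t. ennreal (2 * mass p u) + ennreal ((2 * M) powr p) * J t)
        \<longlongrightarrow> ennreal (2 * mass p u) + ennreal ((2 * M) powr p) * 0) at_top"
      by (intro tendsto_add tendsto_const ennreal_tendsto_cmult J) auto
    then show "((\<lambda>t. ennreal (2 * mass p u) + ennreal ((2 * M) powr p) * J t) \<longlongrightarrow> ennreal (2 * mass p u)) at_top"
      by simp
  qed
qed

text \<open>Approximation by truncations \<open>v n\<close>, cut in both size and support. The
  remainder \<open>w n\<close> has disjoint support, so the masses add exactly, and its energy is
  small uniformly in time.\<close>

lemma energy_tendsto:
  assumes p: "1 \<le> p" and u: "u \<in> Lp p"
  shows "(energy p u \<longlongrightarrow> ennreal (2 * mass p u)) at_top"
proof -
  have um [measurable]: "u \<in> borel_measurable borel" and ui: "integrable lborel (\<lambda>g. \<bar>u g\<bar> powr p)"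
    using u by (auto simp: Lp_def)
  define A where "A n = {g :: ('m, 'k) grushin. norm g \<le> real n \<and> \<bar>u g\<bar> \<le> real n}" for n :: nat
  have Am [measurable]: "A n \<in> sets borel" for n unfolding A_def by measurable
  define v where "v n g = (if g \<in> A n then u g else 0)" for n g
  define w where "w n g = (if g \<in> A n then 0 else u g)" for n g
  have vm [measurable]: "v n \<in> borel_measurable borel" and wm [measurable]: "w n \<in> borel_measurable borel" for n
    unfolding v_def w_def by measurable
  have v: "v n \<in> Lp p" and w: "w n \<in> Lp p" for n
    unfolding Lp_def by (auto intro!: Bochner_Integration.integrable_bound[OF ui] simp: v_def w_def)
  have uvw: "u = (\<lambda>g. v n g + w n g)" for n by (auto simp: v_def w_def)
  have v_eq: "v n = (\<lambda>g. u g + - w n g)" for n by (auto simp: v_def w_def)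
  have w': "(\<lambda>g. - w n g) \<in> Lp p" for n using w[of n] by (simp add: Lp_def)
  have mass_sum: "mass p u = mass p (v n) + mass p (w n)" for n
  proof -
    have "mass p (v n) + mass p (w n) = (LINT g|lborel. \<bar>v n g\<bar> powr p + \<bar>w n g\<bar> powr p)"
      unfolding mass_def using v[of n] w[of n] by (simp add: Lp_def)
    also have "\<dots> = mass p u" unfolding mass_def
      by (rule Bochner_Integration.integral_cong) (auto simp: v_def w_def)
    finally show ?thesis by simp
  qed
  have w_lim: "(\<lambda>n. mass p (w n)) \<longlonglongrightarrow> 0"
  proof -
    have "(\<lambda>n. mass p (w n)) \<longlonglongrightarrow> (LINT g|(lborel :: ('m, 'k) grushin measure). 0)"
      unfolding mass_def
    proof (rule integral_dominated_convergence[OF _ _ ui])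
      show "AE g in lborel. (\<lambda>n. \<bar>w n g\<bar> powr p) \<longlonglongrightarrow> 0"
      proof (rule AE_I2)
        fix g
        obtain N :: nat where N: "max (norm g) \<bar>u g\<bar> \<le> real N" using real_arch_simple by blast
        have "\<forall>\<^sub>F n in sequentially. \<bar>w n g\<bar> powr p = 0"
          using eventually_ge_at_top[of N]
        proof eventually_elim
          case (elim n)
          then have "real N \<le> real n" by simp
          then show ?case using N by (simp add: w_def A_def)
        qed
        then show "(\<lambda>n. \<bar>w n g\<bar> powr p) \<longlonglongrightarrow> 0" by (rule tendsto_eventually)
      qed
    qed (auto simp: w_def)
    then show ?thesis by simp
  qed
  have v_lim: "((\<lambda>t. enn2real (energy p (v n) t)) \<longlongrightarrow> 2 * mass p (v n)) at_top" for n
  proof (rule tendsto_enn2real)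
    show "(energy p (v n) \<longlongrightarrow> ennreal (2 * mass p (v n))) at_top"
      by (rule energy_tendsto_bounded[OF p v, of "real n" n "real n"]) (auto simp: v_def A_def)
  qed (simp add: mass_nonneg)
  let ?C = "2 * (1 / 2 :: real) powr (1 - p)"
  have fin: "energy p x t < \<infinity>" and le: "enn2real (energy p x t) \<le> ?C * mass p x"
    if "x \<in> Lp p" "0 < t" for x t
  proof -
    have "energy p x t \<le> ennreal (?C * mass p x)" by (rule energy_le_mass[OF p that(2,1)])
    then show "energy p x t < \<infinity>" and "enn2real (energy p x t) \<le> ?C * mass p x"
      by (auto intro: order_le_less_trans enn2real_leI simp: mass_nonneg)
  qed
  have perturb: "enn2real (energy p (\<lambda>g. x g + y g) t) \<le> (1 - l) powr (1 - p) * enn2real (energy p x t)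
      + l powr (1 - p) * enn2real (energy p y t)"
    if "x \<in> Lp p" "y \<in> Lp p" "0 < t" "0 < l" "l < 1" for x y t l
  proof (rule enn2real_leI)
    have "energy p (\<lambda>g. x g + y g) t \<le> ennreal ((1 - l) powr (1 - p)) * energy p x t + ennreal (l powr (1 - p)) * energy p y t"
      using that by (intro energy_perturb p)
    also have "energy p x t = ennreal (enn2real (energy p x t))" using fin[OF that(1,3)] by simp
    also have "energy p y t = ennreal (enn2real (energy p y t))" using fin[OF that(2,3)] by simp
    finally show "energy p (\<lambda>g. x g + y g) t \<le> ennreal ((1 - l) powr (1 - p) * enn2real (energy p x t)
      + l powr (1 - p) * enn2real (energy p y t))"
      by (simp add: ennreal_mult)
  qed simp
  have neg: "energy p (\<lambda>g. - x g) t = energy p x t" for x t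
    unfolding energy_def by (simp add: abs_minus_commute)
  have "((\<lambda>t. enn2real (energy p u t)) \<longlongrightarrow> 2 * mass p u) at_top"
  proof (rule tendstoI)
    fix e :: real assume e: "0 < e"
    \<comment> \<open>B dominates both the limit 2 \<open>mass p u\<close> and the uniform bound for
      the energy, so one choice of l makes the excess of the main coefficient over 1 harmless in
      both directions.\<close>
    define B where "B = ?C * mass p u + 2 * mass p u + 1"
    have C0: "0 \<le> ?C" by simp
    have m0: "0 \<le> mass p x" for x by (rule mass_nonneg)
    have B: "1 \<le> B" "0 \<le> ?C * mass p u" using C0 m0[of u] by (auto simp: B_def)
    have "((\<lambda>l. (1 - l) powr (1 - p)) \<longlongrightarrow> (1 - 0) powr (1 - p)) (at_right 0)"
      by (intro tendsto_intros) auto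
    then have "\<forall>\<^sub>F l in at_right 0. (1 - l) powr (1 - p) < 1 + e / (8 * B)"
      using e B by (intro order_tendstoD(2)) auto
    moreover have "\<forall>\<^sub>F l in at_right 0. 0 < l \<and> l < (1 :: real)"
      by (auto intro: eventually_at_rightI[of 0 1])
    ultimately have "\<forall>\<^sub>F l in at_right 0. (1 - l) powr (1 - p) < 1 + e / (8 * B) \<and> 0 < l \<and> l < (1 :: real)"
      by (rule eventually_conj)
    then obtain l where l: "(1 - l) powr (1 - p) < 1 + e / (8 * B)" "0 < l" "l < 1"
      using eventually_happens'[OF trivial_limit_at_right_real] by blast
    define \<mu> where "\<mu> = (1 - l) powr (1 - p)"
    define c where "c = l powr (1 - p)"
    have c: "0 < c" using l by (simp add: c_def)
    have \<mu>1: "1 \<le> \<mu>" using powr_mono'[of "1 - p" 0 "1 - l"] l p by (simp add: \<mu>_def)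
    have \<mu>B: "(\<mu> - 1) * B \<le> e / 8"
      using l(1) B by (simp add: \<mu>_def field_simps)
    \<comment> \<open>The truncation level n is chosen after l, since c may be large for small
      l.\<close>
    have "0 < e / (8 * (c * ?C + 2))" using e c C0 by (intro divide_pos_pos) (auto intro: add_nonneg_pos)
    with w_lim have "\<forall>\<^sub>F n in sequentially. mass p (w n) < e / (8 * (c * ?C + 2))"
      by (rule order_tendstoD)
    then obtain n where "mass p (w n) < e / (8 * (c * ?C + 2))" by (auto simp: eventually_sequentially)
    moreover have "0 < 8 * (c * ?C + 2)" using c C0 by (intro mult_pos_pos add_nonneg_pos) auto
    ultimately have "mass p (w n) * (8 * (c * ?C + 2)) < e"
      by (simp only: pos_less_divide_eq)
    then have wn: "(c * ?C + 2) * mass p (w n) < e / 8" by (simp add: algebra_simps)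
    define d where "d = e / (8 * \<mu>)"
    have d: "0 < d" "\<mu> * d = e / 8" "d \<le> e / 8" using e \<mu>1 by (auto simp: d_def field_simps)
    have "\<forall>\<^sub>F t in at_top. dist (enn2real (energy p (v n) t)) (2 * mass p (v n)) < d"
      by (rule tendstoD[OF v_lim d(1)])
    moreover have "\<forall>\<^sub>F t in at_top. (0::real) < t" by (rule eventually_gt_at_top)
    ultimately show "\<forall>\<^sub>F t in at_top. dist (enn2real (energy p u t)) (2 * mass p u) < e"
    proof eventually_elim
      case (elim t)
      define Fu Fv Fw where "Fu = enn2real (energy p u t)" and "Fv = enn2real (energy p (v n) t)"
        and "Fw = enn2real (energy p (w n) t)"
      have near: "2 * mass p (v n) - d < Fv" "Fv < 2 * mass p (v n) + d"
        using elim by (auto simp: Fv_def dist_real_def)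
      have "c * Fw \<le> c * (?C * mass p (w n))"
        unfolding Fw_def using c le[OF w elim(2), of n] by (intro mult_left_mono) auto
      moreover have "c * (?C * mass p (w n)) + 2 * mass p (w n) < e / 8" using wn by (simp add: algebra_simps)
      ultimately have Fw: "c * Fw + 2 * mass p (w n) < e / 8" by linarith
      have Fw0: "0 \<le> c * Fw" using c by (simp add: Fw_def)
      have up: "Fu \<le> \<mu> * Fv + c * Fw"
        unfolding Fu_def Fv_def Fw_def \<mu>_def c_def
        by (subst uvw[of n]) (intro perturb v w elim l)
      \<comment> \<open>The lower estimate is the same perturbation bound with the roles reversed,
        for \<open>v n\<close> = u + (- \<open>w n\<close>).\<close>
      have down: "Fv \<le> \<mu> * Fu + c * Fw"
        unfolding Fu_def Fv_def Fw_def \<mu>_def c_def neg[of "w n", symmetric]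
        by (subst v_eq[of n]) (intro perturb u w' elim l)
      have "\<mu> * Fv \<le> \<mu> * (2 * mass p u + d)"
        using near(2) mass_sum[of n] m0[of "w n"] \<mu>1 by (intro mult_left_mono) auto
      moreover have "\<mu> * (2 * mass p u + d) = 2 * mass p u + (\<mu> - 1) * (2 * mass p u) + e / 8"
        unfolding distrib_left d(2) by (simp add: algebra_simps)
      moreover have "(\<mu> - 1) * (2 * mass p u) \<le> (\<mu> - 1) * B"
        using \<mu>1 B by (intro mult_left_mono) (auto simp: B_def)
      ultimately have "Fu < 2 * mass p u + e" using up Fw \<mu>B e m0[of "w n"] by linarith
      moreover have "(\<mu> - 1) * Fu \<le> (\<mu> - 1) * B"
        unfolding Fu_def using \<mu>1 le[OF u elim(2)] m0[of u] by (intro mult_left_mono) (auto simp: B_def)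
      then have "\<mu> * Fu \<le> Fu + e / 8" using \<mu>B by (simp add: algebra_simps)
      then have "2 * mass p u - e < Fu"
        using down near(1) mass_sum[of n] Fw Fw0 d(3) e m0[of "w n"] by linarith
      ultimately show ?case by (simp add: Fu_def dist_real_def abs_less_iff)
    qed
  qed
  then have "((\<lambda>t. ennreal (enn2real (energy p u t))) \<longlongrightarrow> ennreal (2 * mass p u)) at_top"
    by (rule tendsto_ennrealI)
  then show ?thesis
  proof (rule Lim_transform_eventually)
    show "\<forall>\<^sub>F t in at_top. ennreal (enn2real (energy p u t)) = energy p u t"
      using eventually_gt_at_top[of 0] by eventually_elim (use fin[OF u] in simp)
  qed
qed

text \<open>The kernel is measurable jointly on positive times only; the indicator replaces it by 0
  elsewhere.\<close>

lemma energy_measurable: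
  assumes [measurable]: "u \<in> borel_measurable borel"
  shows "(\<lambda>t. energy p u t * indicator {0<..} t) \<in> borel_measurable lborel"
proof -
  define Kf where "Kf x = (indicator ({0<..} \<times> UNIV) x *\<^sub>R (case x of (t, g, h) \<Rightarrow> K t g h) :: real)"
    for x :: "real \<times> ('m, 'k) grushin \<times> ('m, 'k) grushin"
  have Kf [measurable]: "Kf \<in> borel_measurable (borel \<Otimes>\<^sub>M (borel \<Otimes>\<^sub>M borel))"
    using K_borel unfolding set_borel_measurable_def Kf_def[abs_def] borel_prod .
  have "(\<lambda>t. \<integral>\<^sup>+g. \<integral>\<^sup>+h. ennreal (Kf (t, g, h) * \<bar>u h - u g\<bar> powr p) \<partial>lborel \<partial>lborel) \<in> borel_measurable lborel"
    by measurable
  also have "(\<lambda>t. \<integral>\<^sup>+g. \<integral>\<^sup>+h. ennreal (Kf (t, g, h) * \<bar>u h - u g\<bar> powr p) \<partial>lborel \<partial>lborel)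
      = (\<lambda>t. energy p u t * indicator {0<..} t)"
    by (rule ext) (auto simp: Kf_def energy_def kernel_integral_def indicator_def)
  finally show ?thesis .
qed

end

section \<open>The limit of the seminorms\<close>

lemma nn_integral_powr_tail:
  assumes a: "0 < a" and e: "0 < e"
  shows "(\<integral>\<^sup>+t. ennreal (t powr (- (e + 1))) * indicator {a..} t \<partial>lborel) = ennreal (a powr (- e) / e)"
proof -
  have "(\<integral>\<^sup>+t. ennreal (t powr (- (e + 1))) * indicator {a..} t \<partial>lborel) = 0 - (- (a powr (- e)) / e)"
  proof (rule nn_integral_FTC_atLeast)
    fix x :: real assume "a \<le> x"
    then have x: "0 < x" using a by simp
    show "((\<lambda>x. - (x powr (- e)) / e) has_real_derivative x powr (- (e + 1))) (at x)"
      using x e by (auto intro!: derivative_eq_intros simp: powr_diff)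
  next
    have "((\<lambda>x. - (x powr (- e)) / e) \<longlongrightarrow> - 0 / e) at_top"
      using e by (intro tendsto_intros tendsto_neg_powr filterlim_ident) auto
    then show "((\<lambda>x. - (x powr (- e)) / e) \<longlongrightarrow> 0) at_top" by simp
  qed auto
  then show ?thesis by simp
qed

text \<open>An Abelian argument. Beyond T, b times the integral of t^(-bq-1) is T^(-bq)/q, which
  tends to 1/q and weights values of F close to L. Below T, finiteness at b0 bounds the integral
  uniformly in b < b0, and the factor b removes it.\<close>

lemma weighted_integral_tendsto:
  fixes F :: "real \<Rightarrow> ennreal"
  assumes F: "(F \<longlongrightarrow> ennreal L) at_top" and L: "0 \<le> L" and q: "0 < q" and b0: "0 < b0"
    and meas: "(\<lambda>t. F t * indicator {0<..} t) \<in> borel_measurable lborel"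
    and fin: "(\<integral>\<^sup>+t\<in>{0<..}. F t / ennreal (t powr (b0 * q + 1)) \<partial>lborel) < \<infinity>"
  shows "((\<lambda>b. ennreal b * (\<integral>\<^sup>+t\<in>{0<..}. F t / ennreal (t powr (b * q + 1)) \<partial>lborel))
    \<longlongrightarrow> ennreal (L / q)) (at_right 0)"
proof -
  define G where "G t = F t * indicator {0<..} t" for t
  define X where "X b = (\<integral>\<^sup>+t\<in>{0<..}. F t / ennreal (t powr (b * q + 1)) \<partial>lborel)" for b
  have Gm [measurable]: "G \<in> borel_measurable lborel" using meas by (simp add: G_def[abs_def])
  have X_eq: "X b = (\<integral>\<^sup>+t. G t * ennreal (t powr (- (b * q + 1))) \<partial>lborel)" for b
    unfolding X_def
  proof (rule nn_integral_cong)
    fix t :: real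
    show "F t / ennreal (t powr (b * q + 1)) * indicator {0<..} t = G t * ennreal (t powr (- (b * q + 1)))"
    proof (cases "0 < t")
      case True
      then have "inverse (ennreal (t powr (b * q + 1))) = ennreal (t powr (- (b * q + 1)))"
        by (subst inverse_ennreal) (auto simp: powr_minus simp del: minus_add_distrib)
      then show ?thesis using True by (simp add: G_def divide_ennreal_def)
    qed (simp add: G_def)
  qed
  have upper: "ennreal b * X b \<le> ennreal (b * (T powr (b0 * q) * enn2real (X b0)) + U * T powr (- (b * q)) / q)"
    if b: "0 < b" "b < b0" and T: "1 \<le> T" and U: "0 \<le> U" "\<And>t. T \<le> t \<Longrightarrow> F t \<le> ennreal U" for b T U
  proof -
    have "X b \<le> (\<integral>\<^sup>+t. ennreal (T powr (b0 * q)) * (G t * ennreal (t powr (- (b0 * q + 1))))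
        + ennreal U * (ennreal (t powr (- (b * q + 1))) * indicator {T..} t) \<partial>lborel)"
      unfolding X_eq
    proof (rule nn_integral_mono)
      fix t :: real
      show "G t * ennreal (t powr (- (b * q + 1))) \<le> ennreal (T powr (b0 * q)) * (G t * ennreal (t powr (- (b0 * q + 1))))
        + ennreal U * (ennreal (t powr (- (b * q + 1))) * indicator {T..} t)"
      proof (cases "T \<le> t")
        case True
        then have "G t \<le> ennreal U" using U(2)[OF True] T by (simp add: G_def)
        then have "G t * ennreal (t powr (- (b * q + 1))) \<le> ennreal U * ennreal (t powr (- (b * q + 1)))"
          by (rule mult_right_mono) simp
        then show ?thesis using True by (simp add: add_increasing)
      next
        case False
        show ?thesis
        proof (cases "0 < t")
          case True
          \<comment> \<open>For t < T the surplus power t^((b0 - b) q) is at most T^(b0 q), using T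
            >= 1; this bound is independent of b.\<close>
          have "t powr (- (b * q + 1)) = t powr ((b0 - b) * q) * t powr (- (b0 * q + 1))"
            using True by (simp add: powr_add[symmetric] algebra_simps)
          also have "t powr ((b0 - b) * q) \<le> T powr ((b0 - b) * q)"
            using True False b q by (intro powr_mono2) auto
          also have "\<dots> \<le> T powr (b0 * q)"
            using T b q by (intro powr_mono) auto
          finally have "t powr (- (b * q + 1)) \<le> T powr (b0 * q) * t powr (- (b0 * q + 1))"
            by (simp add: mult_right_mono)
          then have "G t * ennreal (t powr (- (b * q + 1))) \<le> G t * ennreal (T powr (b0 * q) * t powr (- (b0 * q + 1)))"
            by (intro mult_left_mono ennreal_leI) auto
          then show ?thesis using False by (simp add: ennreal_mult mult_ac)
        qed (simp add: G_def)
      qed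
    qed
    also have "\<dots> = ennreal (T powr (b0 * q)) * X b0
        + ennreal U * (\<integral>\<^sup>+t. ennreal (t powr (- (b * q + 1))) * indicator {T..} t \<partial>lborel)"
      unfolding X_eq by (simp add: nn_integral_add nn_integral_cmult)
    also have "(\<integral>\<^sup>+t. ennreal (t powr (- (b * q + 1))) * indicator {T..} t \<partial>lborel)
        = ennreal (T powr (- (b * q)) / (b * q))"
      using T b q by (intro nn_integral_powr_tail) auto
    also have "X b0 = ennreal (enn2real (X b0))" using fin by (simp add: X_def)
    finally have "ennreal b * X b \<le> ennreal b * (ennreal (T powr (b0 * q)) * ennreal (enn2real (X b0))
        + ennreal U * ennreal (T powr (- (b * q)) / (b * q)))"
      by (intro mult_left_mono) auto
    also have "\<dots> = ennreal (b * (T powr (b0 * q) * enn2real (X b0) + U * (T powr (- (b * q)) / (b * q))))"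
      using b q U by (simp add: ennreal_mult[symmetric] ennreal_plus[symmetric] del: ennreal_plus)
    also have "b * (T powr (b0 * q) * enn2real (X b0) + U * (T powr (- (b * q)) / (b * q)))
        = b * (T powr (b0 * q) * enn2real (X b0)) + U * T powr (- (b * q)) / q"
      using b q by (simp add: field_simps)
    finally show ?thesis .
  qed
  have lower: "ennreal (U * T powr (- (b * q)) / q) \<le> ennreal b * X b"
    if b: "0 < b" and T: "1 \<le> T" and U: "\<And>t. T \<le> t \<Longrightarrow> ennreal U \<le> F t" for b T U
  proof -
    have "ennreal (U * T powr (- (b * q)) / q) = ennreal b * (ennreal U * ennreal (T powr (- (b * q)) / (b * q)))"
    proof -
      have "U * T powr (- (b * q)) / q = b * (U * (T powr (- (b * q)) / (b * q)))"
        using b q by simp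
      then show ?thesis using b q by (simp only: ennreal_mult' ennreal_mult'' less_imp_le
            divide_nonneg_nonneg powr_ge_zero mult_nonneg_nonneg)
    qed
    also have "ennreal (T powr (- (b * q)) / (b * q)) = (\<integral>\<^sup>+t. ennreal (t powr (- (b * q + 1))) * indicator {T..} t \<partial>lborel)"
      using T b q by (intro nn_integral_powr_tail[symmetric]) auto
    also have "ennreal U * \<dots> = (\<integral>\<^sup>+t. ennreal U * (ennreal (t powr (- (b * q + 1))) * indicator {T..} t) \<partial>lborel)"
      by (rule nn_integral_cmult[symmetric]) simp
    also have "\<dots> \<le> X b"
      unfolding X_eq
    proof (rule nn_integral_mono)
      fix t :: real
      show "ennreal U * (ennreal (t powr (- (b * q + 1))) * indicator {T..} t) \<le> G t * ennreal (t powr (- (b * q + 1)))"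
      proof (cases "T \<le> t")
        case True
        then have "ennreal U \<le> G t" using U[OF True] T by (simp add: G_def)
        then show ?thesis using True by (simp add: mult_right_mono)
      qed simp
    qed
    finally show ?thesis by (simp add: mult_left_mono)
  qed
  have T_lim: "((\<lambda>b. U * T powr (- (b * q)) / q) \<longlongrightarrow> U / q) (at_right 0)" if "1 \<le> T" for T U
  proof -
    have "((\<lambda>b. U * T powr (- (b * q)) / q) \<longlongrightarrow> U * T powr (- (0 * q)) / q) (at_right 0)"
      using that q by (intro tendsto_intros) auto
    then show ?thesis using that by simp
  qed
  have "((\<lambda>b. ennreal b * X b) \<longlongrightarrow> ennreal (L / q)) (at_right 0)"
  proof (rule order_tendstoI)
    fix y assume y: "ennreal (L / q) < y"
    have "((\<lambda>e. ennreal ((L + e) / q)) \<longlongrightarrow> ennreal ((L + 0) / q)) (at_right 0)"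
      using q by (intro tendsto_ennrealI tendsto_intros) auto
    then have "\<forall>\<^sub>F e in at_right 0. ennreal ((L + e) / q) < y" using y by (intro order_tendstoD(2)) auto
    then have "\<forall>\<^sub>F e in at_right 0. ennreal ((L + e) / q) < y \<and> 0 < e"
      using eventually_at_right_less[of "0::real"] by (rule eventually_conj)
    then obtain e where e: "ennreal ((L + e) / q) < y" "0 < e"
      using eventually_happens'[OF trivial_limit_at_right_real] by blast
    have "ennreal L < ennreal (L + e)" using e L by (simp add: ennreal_less_iff)
    then have "\<forall>\<^sub>F t in at_top. F t < ennreal (L + e)" by (rule order_tendstoD(2)[OF F])
    then obtain T0 where T0: "\<And>t. T0 \<le> t \<Longrightarrow> F t < ennreal (L + e)" by (auto simp: eventually_at_top_linorder)
    define T where "T = max 1 T0"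
    have T: "1 \<le> T" "\<And>t. T \<le> t \<Longrightarrow> F t \<le> ennreal (L + e)" using T0 by (auto simp: T_def less_imp_le)
    have "((\<lambda>b. b * (T powr (b0 * q) * enn2real (X b0)) + (L + e) * T powr (- (b * q)) / q)
        \<longlongrightarrow> 0 * (T powr (b0 * q) * enn2real (X b0)) + (L + e) / q) (at_right 0)"
      by (intro tendsto_add T_lim T tendsto_mult tendsto_const tendsto_ident_at)
    then have "((\<lambda>b. ennreal (b * (T powr (b0 * q) * enn2real (X b0)) + (L + e) * T powr (- (b * q)) / q))
        \<longlongrightarrow> ennreal ((L + e) / q)) (at_right 0)"
      by (intro tendsto_ennrealI) simp
    from order_tendstoD(2)[OF this e(1)]
    have "\<forall>\<^sub>F b in at_right 0. ennreal (b * (T powr (b0 * q) * enn2real (X b0)) + (L + e) * T powr (- (b * q)) / q) < y" .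
    moreover have "\<forall>\<^sub>F b in at_right 0. 0 < b \<and> b < b0"
      using b0 by (auto intro: eventually_at_rightI[of 0 b0])
    ultimately show "\<forall>\<^sub>F b in at_right 0. ennreal b * X b < y"
    proof eventually_elim
      case (elim b)
      have "0 \<le> L + e" using L e by simp
      with upper[of b T "L + e"] elim T show ?case by (auto intro: order_le_less_trans)
    qed
  next
    fix y assume y: "y < ennreal (L / q)"
    have "((\<lambda>e. ennreal ((L - e) / q)) \<longlongrightarrow> ennreal ((L - 0) / q)) (at_right 0)"
      using q by (intro tendsto_ennrealI tendsto_intros) auto
    then have "\<forall>\<^sub>F e in at_right 0. y < ennreal ((L - e) / q)" using y by (intro order_tendstoD(1)) auto
    then have "\<forall>\<^sub>F e in at_right 0. y < ennreal ((L - e) / q) \<and> 0 < e"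
      using eventually_at_right_less[of "0::real"] by (rule eventually_conj)
    then obtain e where e: "y < ennreal ((L - e) / q)" "0 < e"
      using eventually_happens'[OF trivial_limit_at_right_real] by blast
    \<comment> \<open>\<open>ennreal\<close> sends negative reals to 0, so lying strictly above y
      forces the real number to be positive.\<close>
    have "0 < (L - e) / q" using e(1) by (metis ennreal_neg not_le not_less_zero)
    then have "ennreal (L - e) < ennreal L" using e q by (simp add: ennreal_less_iff zero_less_divide_iff)
    then have "\<forall>\<^sub>F t in at_top. ennreal (L - e) < F t" by (rule order_tendstoD(1)[OF F])
    then obtain T0 where T0: "\<And>t. T0 \<le> t \<Longrightarrow> ennreal (L - e) < F t" by (auto simp: eventually_at_top_linorder)
    define T where "T = max 1 T0"
    have T: "1 \<le> T" "\<And>t. T \<le> t \<Longrightarrow> ennreal (L - e) \<le> F t" using T0 by (auto simp: T_def less_imp_le)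
    have "\<forall>\<^sub>F b in at_right 0. y < ennreal ((L - e) * T powr (- (b * q)) / q)"
      by (rule order_tendstoD(1)[OF tendsto_ennrealI[OF T_lim[OF T(1)]] e(1)])
    then show "\<forall>\<^sub>F b in at_right 0. y < ennreal b * X b"
      using eventually_at_right_less[of "0::real"]
    proof eventually_elim
      case (elim b)
      with lower[of b T "L - e"] T show ?case by (auto intro: order_less_le_trans)
    qed
  qed
  then show ?thesis by (simp add: X_def)
qed

lemma powr_ennreal_powr_ennreal:
  assumes "0 < p"
  shows "powr_ennreal (powr_ennreal x (1 / p)) p = x"
proof (cases "x = \<infinity>")
  case False
  then have "ennreal (enn2real x) = x" by (simp add: less_top)
  then show ?thesis using assms False by (simp add: powr_ennreal_def powr_powr)
qed (simp add: powr_ennreal_def)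

theorem theorem3p21:
  fixes \<alpha> p \<beta>0 :: real
    and K :: "real \<Rightarrow> ('m::finite, 'k::finite) grushin \<Rightarrow> ('m, 'k) grushin \<Rightarrow> real"
    and u :: "('m, 'k) grushin \<Rightarrow> real"
  assumes "\<alpha> \<ge> 0"
    and "heat_kernel \<alpha> K"
    and "p \<ge> 1"
    and "0 < \<beta>0" and "\<beta>0 < 1"
    and "u \<in> besov_closure K p \<beta>0"
  shows "((\<lambda>\<beta>. ennreal \<beta> * powr_ennreal (besov_seminorm K p \<beta> u) p)
           \<longlongrightarrow> ennreal (4 / p * Lp_norm p u powr p)) (at_right 0)"
proof -
  obtain T where T: "heat_semigroup \<alpha> T"
    "\<forall>t>0. \<forall>f\<in>Lp 2. AE g in lborel.
       integrable lborel (\<lambda>h. K t g h * f h) \<and> T t f g = (LINT h|lborel. K t g h * f h)"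
    and K: "set_borel_measurable borel ({0<..} \<times> UNIV) (\<lambda>(t, g, h). K t g h)"
    "\<forall>t>0. \<forall>g h. 0 \<le> K t g h \<and> K t g h = K t h g"
    using assms(2) unfolding heat_kernel_def by blast
  interpret grushin_heat \<alpha> K T
    by unfold_locales (use assms(1) T K in blast)+
  have u: "u \<in> Lp p" and fin: "besov_seminorm K p \<beta>0 u < \<infinity>"
    using assms(6) by (auto simp: besov_closure_def besov_space_def)
  define X where "X \<beta> = (\<integral>\<^sup>+t\<in>{0<..}. energy p u t / ennreal (t powr (\<beta> * (p / 2) + 1)) \<partial>lborel)" for \<beta>
  have seminorm: "besov_seminorm K p \<beta> u = powr_ennreal (X \<beta>) (1 / p)" for \<beta>
    by (simp add: besov_seminorm_def X_def energy_def kernel_integral_def)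
  have X: "powr_ennreal (besov_seminorm K p \<beta> u) p = X \<beta>" for \<beta>
    unfolding seminorm using assms(3) by (intro powr_ennreal_powr_ennreal) simp
  have "X \<beta>0 < \<infinity>"
    using fin by (auto simp: seminorm powr_ennreal_def less_top split: if_splits)
  moreover have "u \<in> borel_measurable borel" using u by (simp add: Lp_def)
  \<comment> \<open>Here L = 2 \<open>mass p u\<close> and q = p/2, so that L/q is 4/p times the
    mass.\<close>
  ultimately have "((\<lambda>\<beta>. ennreal \<beta> * X \<beta>) \<longlongrightarrow> ennreal (2 * mass p u / (p / 2))) (at_right 0)"
    unfolding X_def using assms(3,4)
    by (intro weighted_integral_tendsto[where ?b0.0 = \<beta>0] energy_tendsto energy_measurable u) (auto simp: mass_nonneg)
  moreover have "Lp_norm p u powr p = mass p u"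
    using assms(3) by (simp add: Lp_norm_def mass_def powr_powr)
  ultimately show ?thesis by (simp add: X)
qed

end
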